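(* Let $X$ be a complex Banach space and let $T$ be a bounded asymptotically analytic $C_0$-semigroup on $X$ with generator $A$. Suppose that $i\sigma(A)\cap\mathbb{R}=\{0\}$. Then $\|T(t)AR(1,A)\|\to0$ as $t\to\infty$. In fact, given any dominating function $m$ for the resolvent of $A$, any right-inverse $m^{-1}$ of $m$ and any $\varepsilon\in(0,1)$, $$\|T(t)AR(1,A)\|=O\big(m^{-1}(t^{1-\varepsilon})\big)$$ as $t\to\infty$.
   Context: Notation: $\mathcal{B}(X)$ is the space of bounded linear operators on $X$; $\sigma(A)$ and $\rho(A)$ are the spectrum and resolvent set of $A$, $i\sigma(A)=\{i\lambda:\lambda\in\sigma(A)\}$, and $R(\lambda,A)=(\lambda-A)^{-1}$ for $\lambda\in\rho(A)$. A $C_0$-semigroup $T$ is bounded if $\sup_{t\ge0}\|T(t)\|<\infty$. Dominating functions: when $i\sigma(A)\cap\mathbb{R}=\{0\}$, a dominating function for the resolvent of $A$ is a decreasing (not necessarily strictly) function $m:(0,1]\to(0,\infty)$ such that $\|R(is,A)\|\le m(|s|)$ for all real $s$ with $0<|s|\le1$; every dominating function $m$ is assumed to be continuous. A right-inverse $m^{-1}$ of $m$ is a function defined on the range of $m$, with values in $(0,1]$, such that $m(m^{-1}(r))=r$ for all $r$ in the range of $m$. (Since $0\in\sigma(A)$ one has $m(s)\ge s^{-1}$, so the range of $m$ is $[m(1),\infty)$ and $m^{-1}(t^{1-\varepsilon})$ is defined for all sufficiently large $t$.) Asymptotic analyticity: for a set $\Omega\subset\mathbb{C}$, a function $S:\Omega\to\mathcal{B}(X)$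 is exponentially bounded if there are $C\ge0$, $\omega\in\mathbb{R}$ with $\|S(\lambda)\|\le Ce^{\omega|\lambda|}$ for all $\lambda\in\Omega$. $H(\Omega;\mathcal{B}(X))$ denotes the space of all exponentially bounded holomorphic $\mathcal{B}(X)$-valued functions on $\Omega$. For an exponentially bounded function $S$ defined on $(0,\infty)$, its growth bound is $\omega_0(S)=\inf\{\omega\in\mathbb{R}:\|S(t)\|\le Me^{\omega t}\text{ for some }M\ge1\text{ and all }t>0\}$. For $\theta>0$ let $\Sigma_\theta=\{\lambda\in\mathbb{C}\setminus\{0\}:|\arg(\lambda)|<\theta\}$. The non-analytic growth bound of a $C_0$-semigroup $T$ is $\zeta(T)=\inf\{\omega_0(T-S):S\in H(\Sigma_\theta;\mathcal{B}(X))\text{ for some }\theta>0\}$ (with $T-S$ considered on $(0,\infty)$). $T$ is called asymptotically analytic if $\zeta(T)<0$. *)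

theory Defs
  imports "HOL-Analysis.Analysis" "HOL-Library.Landau_Symbols"
begin

section \<open>Complex Banach spaces\<close>

class complex_normed_vector = real_normed_vector +
  fixes scaleC :: "complex \<Rightarrow> 'a \<Rightarrow> 'a"  (infixr "*\<^sub>C" 75)
  assumes scaleC_add_right: "c *\<^sub>C (x + y) = c *\<^sub>C x + c *\<^sub>C y"
    and scaleC_add_left: "(c + d) *\<^sub>C x = c *\<^sub>C x + d *\<^sub>C x"
    and scaleC_scaleC: "c *\<^sub>C (d *\<^sub>C x) = (c * d) *\<^sub>C x"
    and scaleR_scaleC: "r *\<^sub>R x = complex_of_real r *\<^sub>C x"
    and norm_scaleC: "norm (c *\<^sub>C x) = cmod c * norm x"

class complex_banach = complex_normed_vector + banach

lemma bounded_linear_scaleC: "bounded_linear (scaleC c)"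
proof (rule bounded_linear_intro)
  show "c *\<^sub>C (x + y) = c *\<^sub>C x + c *\<^sub>C y" for x y :: 'a
    by (rule scaleC_add_right)
  show "c *\<^sub>C (r *\<^sub>R x) = r *\<^sub>R (c *\<^sub>C x)" for r and x :: 'a
    by (simp add: scaleR_scaleC scaleC_scaleC mult.commute)
  show "norm (c *\<^sub>C x) \<le> norm x * cmod c" for x :: 'a
    by (simp add: norm_scaleC mult.commute)
qed

text \<open>
  The library type of bounded operators only asks for real-linearity. The values
  are scaled pointwise, which makes it a complex normed space; the space
  \<open>\<B>(X)\<close> is the closed complex subspace of complex-linear elements below, with
  the same (operator) norm.
\<close>

instantiation blinfun :: (real_normed_vector, complex_normed_vector) complex_normed_vector
begin

definition scaleC_blinfun :: "complex \<Rightarrow> ('a \<Rightarrow>\<^sub>L 'b) \<Rightarrow> ('a \<Rightarrow>\<^sub>L 'b)" where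
  "scaleC_blinfun c F = Blinfun (\<lambda>x. c *\<^sub>C blinfun_apply F x)"

lemma scaleC_blinfun_apply:
  "blinfun_apply (c *\<^sub>C F) x = c *\<^sub>C blinfun_apply F x" for F :: "'a \<Rightarrow>\<^sub>L 'b"
  unfolding scaleC_blinfun_def
  by (subst bounded_linear_Blinfun_apply)
    (auto intro: bounded_linear_compose[OF bounded_linear_scaleC] blinfun.bounded_linear_right)

instance
proof
  fix c d :: complex and r :: real and F G :: "'a \<Rightarrow>\<^sub>L 'b"
  show "c *\<^sub>C (F + G) = c *\<^sub>C F + c *\<^sub>C G"
    by (rule blinfun_eqI) (simp add: scaleC_blinfun_apply blinfun.add_left scaleC_add_right)
  show "(c + d) *\<^sub>C F = c *\<^sub>C F + d *\<^sub>C F"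
    by (rule blinfun_eqI) (simp add: scaleC_blinfun_apply blinfun.add_left scaleC_add_left)
  show "c *\<^sub>C (d *\<^sub>C F) = (c * d) *\<^sub>C F"
    by (rule blinfun_eqI) (simp add: scaleC_blinfun_apply scaleC_scaleC)
  show "r *\<^sub>R F = complex_of_real r *\<^sub>C F"
    by (rule blinfun_eqI) (simp add: scaleC_blinfun_apply blinfun.scaleR_left scaleR_scaleC)
  have le: "norm (c *\<^sub>C F) \<le> cmod c * norm F" for c and F :: "'a \<Rightarrow>\<^sub>L 'b"
  proof (rule norm_blinfun_bound)
    fix x
    have "cmod c * norm (blinfun_apply F x) \<le> cmod c * (norm F * norm x)"
      by (intro mult_left_mono norm_blinfun) auto
    then show "norm (blinfun_apply (c *\<^sub>C F) x) \<le> cmod c * norm F * norm x"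
      by (simp add: scaleC_blinfun_apply norm_scaleC mult.assoc)
  qed simp
  show "norm (c *\<^sub>C F) = cmod c * norm F"
  proof (cases "c = 0")
    case True
    then show ?thesis using le[of 0 F] by simp
  next
    case False
    have one: "complex_of_real 1 *\<^sub>C x = x" for x :: 'b
      using scaleR_scaleC[of 1 x] by simp
    have "inverse c *\<^sub>C (c *\<^sub>C F) = F"
      using False one by (intro blinfun_eqI) (simp add: scaleC_blinfun_apply scaleC_scaleC)
    then have "norm F \<le> cmod (inverse c) * norm (c *\<^sub>C F)"
      using le[of "inverse c" "c *\<^sub>C F"] by simp
    then have "cmod c * norm F \<le> norm (c *\<^sub>C F)"
      using False by (simp add: norm_divide field_simps)
    then show ?thesis using le[of c F] by simp
  qed
qed

end

definition bounded_clinear :: "('a::complex_normed_vector \<Rightarrow> 'b::complex_normed_vector) \<Rightarrow> bool" where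
  "bounded_clinear f \<longleftrightarrow> bounded_linear f \<and> (\<forall>c x. f (c *\<^sub>C x) = c *\<^sub>C f x)"

definition bounded_operators :: "('a::complex_normed_vector \<Rightarrow>\<^sub>L 'a) set" where
  "bounded_operators = {F. bounded_clinear (blinfun_apply F)}"


section \<open>Unbounded operators, spectrum and resolvent\<close>

text \<open>An unbounded operator \<open>A\<close> is a partial function with domain \<open>dom A\<close>.\<close>

definition resolvent_set :: "('a::complex_normed_vector \<rightharpoonup> 'a) \<Rightarrow> complex set" where
  "resolvent_set A = {l. bij_betw (\<lambda>x. l *\<^sub>C x - the (A x)) (dom A) UNIV \<and>
     bounded_clinear (inv_into (dom A) (\<lambda>x. l *\<^sub>C x - the (A x)))}"

definition spectrum :: "('a::complex_normed_vector \<rightharpoonup> 'a) \<Rightarrow> complex set" where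
  "spectrum A = - resolvent_set A"

text \<open>Only meaningful for \<open>l \<in> resolvent_set A\<close>.\<close>

definition resolvent :: "complex \<Rightarrow> ('a::complex_normed_vector \<rightharpoonup> 'a) \<Rightarrow> 'a \<Rightarrow>\<^sub>L 'a" where
  "resolvent l A = Blinfun (inv_into (dom A) (\<lambda>x. l *\<^sub>C x - the (A x)))"


section \<open>Strongly continuous semigroups\<close>

text \<open>Only the values of \<open>T\<close> on \<open>[0, \<infinity>)\<close> matter.\<close>

definition C0_semigroup :: "(real \<Rightarrow> 'a::complex_normed_vector \<Rightarrow>\<^sub>L 'a) \<Rightarrow> bool" where
  "C0_semigroup T \<longleftrightarrow>
     (\<forall>t\<ge>0. T t \<in> bounded_operators) \<and>
     T 0 = id_blinfun \<and>
     (\<forall>s\<ge>0. \<forall>t\<ge>0. T (s + t) = T s o\<^sub>L T t) \<and>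
     (\<forall>x. ((\<lambda>t. blinfun_apply (T t) x) \<longlongrightarrow> x) (at_right 0))"

definition bounded_semigroup :: "(real \<Rightarrow> 'a::complex_normed_vector \<Rightarrow>\<^sub>L 'a) \<Rightarrow> bool" where
  "bounded_semigroup T \<longleftrightarrow> bounded (T ` {0..})"

definition generator :: "(real \<Rightarrow> 'a::complex_normed_vector \<Rightarrow>\<^sub>L 'a) \<Rightarrow> ('a \<rightharpoonup> 'a)" where
  "generator T x =
     (let q = (\<lambda>h. (blinfun_apply (T h) x - x) /\<^sub>R h)
      in if \<exists>y. (q \<longlongrightarrow> y) (at_right 0) then Some (Lim (at_right 0) q) else None)"


section \<open>Asymptotic analyticity\<close>

definition exponentially_bounded_on ::
    "complex set \<Rightarrow> (complex \<Rightarrow> 'b::real_normed_vector) \<Rightarrow> bool" where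
  "exponentially_bounded_on \<Omega> S \<longleftrightarrow>
     (\<exists>C\<ge>0. \<exists>w::real. \<forall>z\<in>\<Omega>. norm (S z) \<le> C * exp (w * cmod z))"

text \<open>
  Vector-valued analogue of \<^const>\<open>holomorphic_on\<close>. For \<open>\<Omega>\<close> open and \<open>S\<close> with values
  in \<open>bounded_operators\<close>, the derivative automatically lies in that closed subspace.
\<close>

definition vector_holomorphic_on ::
    "(complex \<Rightarrow> 'b::complex_normed_vector) \<Rightarrow> complex set \<Rightarrow> bool" where
  "vector_holomorphic_on S \<Omega> \<longleftrightarrow>
     (\<forall>z\<in>\<Omega>. \<exists>D. (S has_derivative (\<lambda>h. h *\<^sub>C D)) (at z within \<Omega>))"

definition H_space :: "complex set \<Rightarrow> (complex \<Rightarrow> 'a::complex_normed_vector \<Rightarrow>\<^sub>L 'a) set" where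
  "H_space \<Omega> = {S. (\<forall>z\<in>\<Omega>. S z \<in> bounded_operators) \<and>
     exponentially_bounded_on \<Omega> S \<and> vector_holomorphic_on S \<Omega>}"

text \<open>The infimum is taken in the extended reals, since it may be \<open>-\<infinity>\<close>.\<close>

definition growth_bound :: "(real \<Rightarrow> 'b::real_normed_vector) \<Rightarrow> ereal" where
  "growth_bound S =
     Inf (ereal ` {w. \<exists>M\<ge>1. \<forall>t>0. norm (S t) \<le> M * exp (w * t)})"

definition sector :: "real \<Rightarrow> complex set" where
  "sector \<theta> = {z. z \<noteq> 0 \<and> \<bar>Arg z\<bar> < \<theta>}"

definition nonanalytic_growth_bound ::
    "(real \<Rightarrow> 'a::complex_normed_vector \<Rightarrow>\<^sub>L 'a) \<Rightarrow> ereal" where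
  "nonanalytic_growth_bound T =
     Inf {growth_bound (\<lambda>t. T t - S (complex_of_real t)) | S. \<exists>\<theta>>0. S \<in> H_space (sector \<theta>)}"

definition asymptotically_analytic ::
    "(real \<Rightarrow> 'a::complex_normed_vector \<Rightarrow>\<^sub>L 'a) \<Rightarrow> bool" where
  "asymptotically_analytic T \<longleftrightarrow> nonanalytic_growth_bound T < 0"


section \<open>Dominating functions\<close>

text \<open>
  Used only when \<open>\<i>\<sigma>(A) \<inter> \<real> = {0}\<close>, so that all resolvents below are defined. Functions on
  \<open>(0, 1]\<close>, and on the range of \<open>m\<close>, are total functions whose other values are irrelevant.
\<close>

definition dominating_function ::
    "('a::complex_normed_vector \<rightharpoonup> 'a) \<Rightarrow> (real \<Rightarrow> real) \<Rightarrow> bool" where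
  "dominating_function A m \<longleftrightarrow>
     (\<forall>s\<in>{0<..1}. 0 < m s) \<and>
     antimono_on {0<..1} m \<and>
     continuous_on {0<..1} m \<and>
     (\<forall>s::real. 0 < \<bar>s\<bar> \<and> \<bar>s\<bar> \<le> 1 \<longrightarrow>
        norm (resolvent (\<i> * complex_of_real s) A) \<le> m \<bar>s\<bar>)"

definition right_inverse :: "(real \<Rightarrow> real) \<Rightarrow> (real \<Rightarrow> real) \<Rightarrow> bool" where
  "right_inverse m minv \<longleftrightarrow>
     (\<forall>r\<in>m ` {0<..1}. minv r \<in> {0<..1} \<and> m (minv r) = r)"

end

theory Submission
  imports Defs "HOL-Complex_Analysis.Complex_Analysis"
begin

text \<open>
  On \<open>X\<close> the operator \<open>A R(1, A)\<close> is \<open>R(1, A) - I\<close>, and \<open>t \<mapsto> T(t) A R(1, A) x\<close> is the derivative of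
  the bounded orbit \<open>T(t) R(1, A) x\<close>. Norming functionals reduce the claim to scalar functions
  \<open>u(t) = \<xi>(T(t) y)\<close> with \<open>y = A R(1, A) x\<close>, with bounds that are uniform in \<open>\<xi>\<close>. The Laplace
  transform of \<open>u\<close> is \<open>\<xi>(R(z, A) y)\<close>, which continues across the imaginary axis away from \<open>0\<close>.
  One would like to invert the Laplace transform on a contour to the left of the axis, where the
  exponential decays. Two things stand in the way: the behaviour at infinity and the singularity at
  \<open>0\<close>.

  Asymptotic analyticity handles infinity. Split \<open>u = s + d\<close> with \<open>s(t) = \<xi>(S(t) y)\<close>, where \<open>S\<close> is
  holomorphic and exponentially bounded in a sector, and \<open>d\<close> is exponentially small. The transform
  of \<open>d\<close> is holomorphic in a strip to the left of the axis, so the transform of \<open>s\<close> continues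
  into this strip wherever \<open>R(z, A)\<close> is defined. Rotating the half-line of integration inside the sector
  (\<open>laplace_rotate\<close>) bounds this transform by a multiple of \<open>1 / \<bar>Im z\<bar>\<close> for large \<open>\<bar>Im z\<bar>\<close>, in the
  right half-plane first. This bounds the resolvent there, hence a whole strip of fixed width
  belongs to the resolvent set at high frequencies, and the bound persists in it. Near the axis at
  intermediate frequencies the Neumann series suffices. Together: if \<open>\<parallel>R(is, A)\<parallel> \<le> Q\<close> for
  \<open>r \<le> \<bar>s\<bar> \<le> 1\<close>, the transform is bounded by a multiple of \<open>Q / \<bar>Im z\<bar>\<close> for \<open>\<bar>Im z\<bar> \<ge> r\<close> and
  \<open>\<bar>Re z\<bar> \<le> \<eta>\<close>, where \<open>\<eta>\<close> is the minimum of \<open>r\<close> and a multiple of \<open>1 / Q\<close>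
  (\<open>transform_parameters\<close>).

  A cut-off at height \<open>r\<close> handles the singularity at \<open>0\<close>. As \<open>s\<close> has a bounded antiderivative
  (\<open>bounded_antiderivative\<close>), integration by parts gains a factor \<open>\<bar>z\<bar>\<close> near \<open>0\<close>. The factor
  \<open>(1 + r\<^sup>2 / z\<^sup>2)\<^sup>n\<close> vanishes at \<open>\<plusminus>ir\<close>, where the contour changes from the right half-plane to the
  left one, and there it also absorbs the factor \<open>1 / Re z\<close> in the bounds for the transform. A
  detour of size \<open>r\<close> round the origin therefore contributes \<open>O(r)\<close> (\<open>right_half_plane_contour\<close>).
  Along the rest of the axis the contour moves left by \<open>\<eta>\<close>, which yields \<open>e\<^sup>-\<^sup>\<eta>\<^sup>t\<close> on the vertical
  line and \<open>(rt)\<^sup>-\<^sup>n\<close> on the short horizontal edges (\<open>shift_left_bound\<close>). A second factor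
  \<open>N\<^sup>2 / (N\<^sup>2 - z\<^sup>2)\<close> provides convergence at infinity. Its residue at \<open>N\<close> produces averages of \<open>s\<close>
  over times at distance about \<open>1 / N\<close> from \<open>t\<close> (\<open>contour_estimate\<close>), which are close to \<open>s(t)\<close> because
  \<open>s\<close> is Lipschitz near \<open>t\<close> (\<open>tauberian_bound\<close>). The Lipschitz constant is exponential in \<open>t\<close>, so
  \<open>N\<close> is taken exponential in \<open>t\<close>, and since \<open>N\<close> enters the contour bounds through a logarithm, this
  costs only a factor \<open>t\<close>. The outcome (\<open>smoothed_bound\<close>) is
  \<open>\<parallel>T(t) A R(1, A)\<parallel> \<le> K\<^sub>n (r + Q (rt)\<^sup>-\<^sup>n + e\<^sup>-\<^sup>\<eta>\<^sup>t Q (t + 1 / r) + e\<^sup>-\<^sup>a\<^sup>t)\<close>.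

  For fixed \<open>r\<close> only \<open>K\<^sub>n r\<close> survives as \<open>t \<longrightarrow> \<infinity>\<close>, and \<open>r\<close> is arbitrary, so the norm tends to \<open>0\<close>. For the
  rate take \<open>Q = t\<^sup>1\<^sup>-\<^sup>\<epsilon>\<close> and \<open>r = m\<^sup>-\<^sup>1(Q)\<close>. As \<open>0\<close> belongs to the spectrum, \<open>1 / r \<le> 2 Q\<close>, so
  \<open>(rt)\<^sup>-\<^sup>n\<close> is at most a multiple of \<open>t\<^sup>-\<^sup>n\<^sup>\<epsilon>\<close> and \<open>\<eta> t\<close> is at least a multiple of \<open>t\<^sup>\<epsilon>\<close>. With
  \<open>n \<epsilon> \<ge> 2\<close> all terms but the first are \<open>O(1 / Q)\<close> and hence \<open>O(r)\<close> (\<open>smoothed_rate\<close>).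
\<close>

section \<open>Norming functionals\<close>

text \<open>Functionals on subspaces are represented by their graphs, which are subspaces of the product space.
  The value \<open>c\<close> of an extension at \<open>v\<close> must lie above all \<open>a - \<parallel>x - v\<parallel>\<close> and below all
  \<open>\<parallel>x + v\<parallel> - a\<close> for \<open>(x, a)\<close> in the graph. The triangle inequality makes these two sets of bounds
  compatible, and the general \<open>k\<close> follows by scaling.\<close>

lemma graph_extension_step:
  fixes G :: "('a::real_normed_vector \<times> real) set"
  assumes G: "subspace G" and le: "\<And>x c. (x, c) \<in> G \<Longrightarrow> c \<le> norm x"
  obtains c where "\<And>x a k. (x, a) \<in> G \<Longrightarrow> a + k * c \<le> norm (x + k *\<^sub>R v)"
proof -
  define S where "S = (\<lambda>(x, a). a - norm (x - v)) ` G"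
  have cross: "a - norm (x - v) \<le> norm (x' + v) - a'" if "(x, a) \<in> G" "(x', a') \<in> G" for x a x' a'
  proof -
    have "(x + x', a + a') \<in> G"
      using subspace_add[OF G that] by simp
    then have "a + a' \<le> norm (x + x')" by (rule le)
    also have "\<dots> \<le> norm (x - v) + norm (x' + v)"
      using norm_triangle_ineq[of "x - v" "x' + v"] by simp
    finally show ?thesis by simp
  qed
  have z: "(0, 0) \<in> G" using subspace_0[OF G] by (simp add: zero_prod_def)
  then have ne: "S \<noteq> {}" by (auto simp: S_def)
  have bdd: "bdd_above S"
    unfolding bdd_above_def S_def
    by (intro exI[of _ "norm v"]) (use cross[OF _ z] in auto)
  define c where "c = Sup S"
  have lower: "a - norm (x - v) \<le> c" if "(x, a) \<in> G" for x a
    unfolding c_def by (rule cSup_upper[OF _ bdd]) (use that in \<open>force simp: S_def\<close>)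
  have upper: "c \<le> norm (x + v) - a" if "(x, a) \<in> G" for x a
    unfolding c_def by (rule cSup_least[OF ne]) (use cross that in \<open>auto simp: S_def\<close>)
  show ?thesis
  proof
    fix x a and k :: real assume xa: "(x, a) \<in> G"
    have scaled: "(inverse j *\<^sub>R x, inverse j * a) \<in> G" for j
      using subspace_scale[OF G xa, of "inverse j"] by simp
    consider "k = 0" | "k > 0" | "k < 0" by linarith
    then show "a + k * c \<le> norm (x + k *\<^sub>R v)"
    proof cases
      case 1 then show ?thesis using le[OF xa] by simp
    next
      case 2
      have "k * c \<le> k * (norm (inverse k *\<^sub>R x + v) - inverse k * a)"
        using upper[OF scaled[of k]] 2 by (intro mult_left_mono) auto
      also have "\<dots> = norm (k *\<^sub>R (inverse k *\<^sub>R x + v)) - a"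
        using 2 by (simp add: right_diff_distrib)
      also have "k *\<^sub>R (inverse k *\<^sub>R x + v) = x + k *\<^sub>R v"
        using 2 by (simp add: scaleR_add_right)
      finally show ?thesis by simp
    next
      case 3
      define j where "j = - k"
      have j: "j > 0" "k = - j" using 3 by (auto simp: j_def)
      have "j * (inverse j * a - norm (inverse j *\<^sub>R x - v)) \<le> j * c"
        using lower[OF scaled[of j]] j by (intro mult_left_mono) auto
      moreover have "j * (inverse j * a - norm (inverse j *\<^sub>R x - v)) =
          a - norm (j *\<^sub>R (inverse j *\<^sub>R x - v))"
        using j by (simp add: right_diff_distrib)
      ultimately have "a - norm (j *\<^sub>R (inverse j *\<^sub>R x - v)) \<le> j * c" by simp
      also have "j *\<^sub>R (inverse j *\<^sub>R x - v) = x + k *\<^sub>R v"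
        using j by (simp add: scaleR_diff_right)
      finally show ?thesis using j by simp
    qed
  qed
qed

text \<open>Hahn-Banach: Zorn's lemma gives a maximal graph dominated by the norm, and the extension step shows
  that it is defined everywhere. Domination at \<open>(0, c)\<close> makes the relation single-valued.\<close>

lemma real_norming_functional:
  fixes z :: "'a::real_normed_vector"
  obtains f :: "'a \<Rightarrow> real" where "linear f" "\<And>x. \<bar>f x\<bar> \<le> norm x" "f z = norm z"
proof -
  define \<A> where "\<A> = {G :: ('a \<times> real) set. subspace G \<and> (z, norm z) \<in> G \<and>
    (\<forall>x c. (x, c) \<in> G \<longrightarrow> c \<le> norm x)}"
  have "span {(z, norm z)} \<in> \<A>"
  proof -
    have "k * norm z \<le> norm (k *\<^sub>R z)" for k :: real
      by (simp add: mult_right_mono)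
    moreover have "\<exists>k. x = k *\<^sub>R z \<and> c = k * norm z" if "(x, c) \<in> span {(z, norm z)}" for x c
      using that by (auto simp: span_singleton)
    ultimately have "c \<le> norm x" if "(x, c) \<in> span {(z, norm z)}" for x c
      using that by blast
    then show ?thesis
      by (auto simp: \<A>_def subspace_span span_base)
  qed
  then have ne: "\<A> \<noteq> {}" by auto
  have "\<exists>M\<in>\<A>. \<forall>X\<in>\<A>. M \<subseteq> X \<longrightarrow> X = M"
  proof (rule subset_Zorn_nonempty[OF ne])
    fix C assume C: "C \<noteq> {}" "subset.chain \<A> C"
    have CA: "\<And>G. G \<in> C \<Longrightarrow> G \<in> \<A>" using C(2) by (auto simp: subset.chain_def)
    have "subspace (\<Union>C)"
    proof (rule subspaceI)
      show "0 \<in> \<Union>C" using C(1) CA subspace_0 by (fastforce simp: \<A>_def)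
      fix p q assume "p \<in> \<Union>C" "q \<in> \<Union>C"
      then obtain G H where GH: "G \<in> C" "H \<in> C" "p \<in> G" "q \<in> H" by auto
      then have "G \<subseteq> H \<or> H \<subseteq> G" using C(2) by (auto simp: subset_chain_def)
      moreover have "subspace G" "subspace H" using GH CA by (auto simp: \<A>_def)
      ultimately have "p + q \<in> G \<or> p + q \<in> H"
        using GH subspace_add[of G p q] subspace_add[of H p q] by blast
      then show "p + q \<in> \<Union>C" using GH by blast
    next
      fix k :: real and p assume "p \<in> \<Union>C"
      then show "k *\<^sub>R p \<in> \<Union>C" using CA by (auto simp: \<A>_def intro: subspace_scale)
    qed
    then show "\<Union>C \<in> \<A>" using C(1) CA by (fastforce simp: \<A>_def)
  qed
  then obtain M where M: "M \<in> \<A>" and max: "\<And>X. X \<in> \<A> \<Longrightarrow> M \<subseteq> X \<Longrightarrow> X = M" by auto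
  have sub: "subspace M" and zM: "(z, norm z) \<in> M" and le: "\<And>x c. (x, c) \<in> M \<Longrightarrow> c \<le> norm x"
    using M by (auto simp: \<A>_def)
  have total: "\<exists>c. (v, c) \<in> M" for v
  proof -
    obtain c where c: "\<And>x a k. (x, a) \<in> M \<Longrightarrow> a + k * c \<le> norm (x + k *\<^sub>R v)"
      using graph_extension_step[OF sub le, where v = v] by blast
    define X where "X = {p + q | p q. p \<in> M \<and> q \<in> span {(v, c)}}"
    have MX: "M \<subseteq> X"
    proof
      fix p assume "p \<in> M"
      then show "p \<in> X" unfolding X_def using span_zero[of "{(v, c)}"]
        by (intro CollectI exI[of _ p] exI[of _ 0]) simp
    qed
    have "b \<le> norm y" if yb: "(y, b) \<in> X" for y b
    proof -
      obtain x a k where "(x, a) \<in> M" "y = x + k *\<^sub>R v" "b = a + k * c"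
        using yb by (auto simp: X_def span_singleton)
      then show ?thesis using c by simp
    qed
    moreover have "subspace X"
      unfolding X_def by (rule subspace_sums[OF sub subspace_span])
    ultimately have "X \<in> \<A>" using zM MX by (auto simp: \<A>_def)
    then have "X = M" using max MX by blast
    moreover have "(v, c) \<in> X"
      unfolding X_def using subspace_0[OF sub] span_base[of "(v, c)" "{(v, c)}"]
      by (intro CollectI exI[of _ 0] exI[of _ "(v, c)"]) simp
    ultimately show ?thesis by auto
  qed
  have unique: "c = d" if "(x, c) \<in> M" "(x, d) \<in> M" for x c d
    using le[of 0 "c - d"] le[of 0 "d - c"] subspace_diff[OF sub that]
      subspace_diff[OF sub that(2,1)] by simp
  define f where "f v = (SOME c. (v, c) \<in> M)" for v
  have f: "(v, f v) \<in> M" for v unfolding f_def using total[of v] by (rule someI_ex)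
  have feq: "f v = c" if "(v, c) \<in> M" for v c using unique[OF f that] .
  have lin: "linear f"
  proof (rule linearI)
    show "f (x + y) = f x + f y" for x y
      using subspace_add[OF sub f[of x] f[of y]] by (intro feq) simp
    show "f (k *\<^sub>R x) = k *\<^sub>R f x" for k x
      using subspace_scale[OF sub f[of x], of k] by (intro feq) simp
  qed
  moreover have "\<bar>f x\<bar> \<le> norm x" for x
    using le[OF f[of x]] le[OF f[of "- x"]] linear_neg[OF lin, of x] by (simp add: abs_le_iff)
  moreover have "f z = norm z" by (rule feq[OF zM])
  ultimately show thesis by (rule that)
qed

lemma scaleC_zero_simps [simp]:
  fixes x :: "'a::complex_normed_vector"
  shows "1 *\<^sub>C x = x" "0 *\<^sub>C x = 0" "(- c) *\<^sub>C x = - (c *\<^sub>C x)" "c *\<^sub>C 0 = (0::'a)"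
    "c *\<^sub>C (- x) = - (c *\<^sub>C x)"
proof -
  show "1 *\<^sub>C x = x" using scaleR_scaleC[of 1 x] by simp
  show 0: "0 *\<^sub>C x = 0" using scaleR_scaleC[of 0 x] by simp
  show "(- c) *\<^sub>C x = - (c *\<^sub>C x)"
    using scaleC_add_left[of c "- c" x] 0 by (simp add: eq_neg_iff_add_eq_0 add.commute)
  show "c *\<^sub>C 0 = (0::'a)"
    using linear_0[OF bounded_linear.linear[OF bounded_linear_scaleC]] .
  show "c *\<^sub>C (- x) = - (c *\<^sub>C x)"
    using linear_neg[OF bounded_linear.linear[OF bounded_linear_scaleC]] .
qed

lemma scaleC_diff_right: "c *\<^sub>C (x - y) = c *\<^sub>C x - c *\<^sub>C (y::'a::complex_normed_vector)"
  using scaleC_add_right[of c x "- y"] by simp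

lemma scaleC_diff_left: "(c - d) *\<^sub>C x = c *\<^sub>C x - d *\<^sub>C (x::'a::complex_normed_vector)"
  using scaleC_add_left[of c "- d" x] by simp

definition contractive_functional :: "('a::complex_normed_vector \<Rightarrow> complex) \<Rightarrow> bool" where
  "contractive_functional \<xi> \<longleftrightarrow> linear \<xi> \<and> (\<forall>c x. \<xi> (c *\<^sub>C x) = c * \<xi> x) \<and>
     (\<forall>x. cmod (\<xi> x) \<le> norm x)"

lemma contractive_functionalD:
  assumes "contractive_functional \<xi>"
  shows "linear \<xi>" "\<xi> (c *\<^sub>C x) = c * \<xi> x" "cmod (\<xi> x) \<le> norm x" "bounded_linear \<xi>"
    "\<xi> (x + y) = \<xi> x + \<xi> y" "\<xi> (x - y) = \<xi> x - \<xi> y" "\<xi> 0 = 0"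
proof -
  show l: "linear \<xi>" and "\<xi> (c *\<^sub>C x) = c * \<xi> x" and n: "\<And>x. cmod (\<xi> x) \<le> norm x"
    using assms by (auto simp: contractive_functional_def)
  show "bounded_linear \<xi>"
    using l n by (auto simp: bounded_linear_def bounded_linear_axioms_def intro!: exI[of _ 1])
  show "\<xi> (x + y) = \<xi> x + \<xi> y" "\<xi> (x - y) = \<xi> x - \<xi> y" "\<xi> 0 = 0"
    using linear_add[OF l] linear_diff[OF l] linear_0[OF l] by blast+
qed

text \<open>A real functional \<open>f\<close> is the real part of the complex functional \<open>x \<mapsto> f x - \<i> f (\<i> x)\<close>.\<close>

lemma complex_norming_functional:
  fixes z :: "'a::complex_normed_vector"
  obtains \<xi> where "contractive_functional \<xi>" "cmod (\<xi> z) = norm z"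
proof -
  obtain f where lin: "linear f" and le: "\<And>x. \<bar>f x\<bar> \<le> norm x" and fz: "f z = norm (z::'a)"
    using real_norming_functional[of z] by blast
  define \<xi> where "\<xi> x = Complex (f x) (- f (\<i> *\<^sub>C x))" for x
  have add: "\<xi> (x + y) = \<xi> x + \<xi> y" for x y
    by (simp add: \<xi>_def complex_eq_iff scaleC_add_right linear_add[OF lin])
  have scaleC: "\<xi> (c *\<^sub>C x) = c * \<xi> x" for c x
  proof -
    have f: "f (c *\<^sub>C x) = Re c * f x + Im c * f (\<i> *\<^sub>C x)" for c x
    proof -
      have "c *\<^sub>C x = Re c *\<^sub>R x + Im c *\<^sub>R (\<i> *\<^sub>C x)"
        unfolding scaleR_scaleC scaleC_scaleC scaleC_add_left[symmetric]
        by (metis complex_eq mult.commute)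
      then show ?thesis by (simp add: linear_add[OF lin] linear_scale[OF lin])
    qed
    have "f (\<i> *\<^sub>C c *\<^sub>C x) = - Im c * f x + Re c * f (\<i> *\<^sub>C x)"
      unfolding scaleC_scaleC by (subst f) simp
    then show ?thesis by (simp add: \<xi>_def complex_eq_iff f[of c x])
  qed
  have "linear \<xi>"
    by (rule linearI) (simp_all add: add scaleR_scaleC scaleC scaleR_conv_of_real)
  moreover have bound: "cmod (\<xi> x) \<le> norm x" for x
  proof (cases "\<xi> x = 0")
    case False
    \<comment> \<open>Rotating \<open>x\<close> makes the value real, and there the functional is \<open>f\<close>.\<close>
    define c where "c = cnj (\<xi> x) / cmod (\<xi> x)"
    have c: "cmod c = 1" "c * \<xi> x = cmod (\<xi> x)"
      using False complex_norm_square[of "\<xi> x"]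
      by (auto simp: c_def norm_divide mult.commute power2_eq_square divide_simps)
    have "cmod (\<xi> x) = Re (\<xi> (c *\<^sub>C x))" by (simp add: scaleC c)
    also have "\<dots> \<le> norm (c *\<^sub>C x)" using le[of "c *\<^sub>C x"] by (simp add: \<xi>_def)
    finally show ?thesis using c by (simp add: norm_scaleC)
  qed simp
  moreover have "cmod (\<xi> z) = norm z"
    using bound[of z] complex_Re_le_cmod[of "\<xi> z"] fz by (simp add: \<xi>_def)
  ultimately show thesis using that scaleC by (auto simp: contractive_functional_def)
qed

text \<open>Norm estimates of vectors and operators reduce to scalar estimates that are uniform over
  contractive functionals. Integration and complex analysis then take place in the complex numbers
  only.\<close>

lemma norm_le_of_functionals:
  fixes x :: "'a::complex_normed_vector"
  assumes "\<And>\<xi>. contractive_functional \<xi> \<Longrightarrow> cmod (\<xi> x) \<le> B"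
  shows "norm x \<le> B"
  using complex_norming_functional[of x] assms by metis

section \<open>Resolvents\<close>

lemma resolvent_inverse:
  fixes A :: "'a::complex_normed_vector \<rightharpoonup> 'a"
  assumes "l \<in> resolvent_set A"
  shows "resolvent l A x \<in> dom A"
    and "l *\<^sub>C resolvent l A x - the (A (resolvent l A x)) = x"
    and "z \<in> dom A \<Longrightarrow> resolvent l A (l *\<^sub>C z - the (A z)) = z"
    and "resolvent l A (c *\<^sub>C x) = c *\<^sub>C resolvent l A x"
proof -
  let ?f = "\<lambda>x. l *\<^sub>C x - the (A x)"
  have bij: "bij_betw ?f (dom A) UNIV" and bl: "bounded_clinear (inv_into (dom A) ?f)"
    using assms by (auto simp: resolvent_set_def)
  have R: "resolvent l A x = inv_into (dom A) ?f x" for x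
    using bl by (simp add: resolvent_def bounded_clinear_def bounded_linear_Blinfun_apply)
  have im: "x \<in> ?f ` dom A" for x using bij by (simp add: bij_betw_def)
  show "resolvent l A x \<in> dom A" using inv_into_into[OF im] by (simp add: R)
  show "?f (resolvent l A x) = x" using f_inv_into_f[OF im] by (simp add: R)
  show "z \<in> dom A \<Longrightarrow> resolvent l A (?f z) = z"
    unfolding R using bij by (intro inv_into_f_f) (auto simp: bij_betw_def)
  show "resolvent l A (c *\<^sub>C x) = c *\<^sub>C resolvent l A x"
    using bl by (simp add: R bounded_clinear_def)
qed

lemma resolvent_setI:
  fixes A :: "'a::complex_normed_vector \<rightharpoonup> 'a" and R :: "'a \<Rightarrow> 'a"
  assumes "\<And>y. R y \<in> dom A" "\<And>y. l *\<^sub>C R y - the (A (R y)) = y"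
    and "\<And>x. x \<in> dom A \<Longrightarrow> R (l *\<^sub>C x - the (A x)) = x"
    and "bounded_clinear R"
  shows "l \<in> resolvent_set A" "resolvent l A = Blinfun R"
proof -
  let ?f = "\<lambda>x. l *\<^sub>C x - the (A x)"
  have bij: "bij_betw ?f (dom A) UNIV"
    by (rule bij_betw_byWitness[where f' = R]) (use assms(1-3) in blast)+
  have "inv_into (dom A) ?f y = R y" for y
    by (rule inv_into_f_eq[OF bij_betw_imp_inj_on[OF bij] assms(1,2)])
  then have "inv_into (dom A) ?f = R" by auto
  then show "l \<in> resolvent_set A" "resolvent l A = Blinfun R"
    unfolding resolvent_set_def resolvent_def using bij assms(4) by simp_all
qed

lemma resolvent_identity:
  fixes A :: "'a::complex_normed_vector \<rightharpoonup> 'a"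
  assumes "l \<in> resolvent_set A" "k \<in> resolvent_set A"
  shows "resolvent k A x = resolvent l A x + (l - k) *\<^sub>C resolvent l A (resolvent k A x)"
proof -
  let ?z = "resolvent k A x"
  have "?z = resolvent l A (l *\<^sub>C ?z - the (A ?z))"
    by (rule resolvent_inverse(3)[OF assms(1) resolvent_inverse(1)[OF assms(2)], symmetric])
  also have "l *\<^sub>C ?z - the (A ?z) = x + (l - k) *\<^sub>C ?z"
  proof -
    have "l *\<^sub>C ?z - the (A ?z) = (k *\<^sub>C ?z - the (A ?z)) + (l - k) *\<^sub>C ?z"
      by (simp add: scaleC_diff_left)
    then show ?thesis unfolding resolvent_inverse(2)[OF assms(2)] .
  qed
  finally show ?thesis unfolding blinfun.add_right resolvent_inverse(4)[OF assms(1)] .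
qed

text \<open>Instead of summing the Neumann series, \<open>l - A = (1 - B) (k - A)\<close> with a contraction \<open>B\<close> is inverted
  through the fixed points \<open>W y\<close> of \<open>w \<mapsto> y + B w\<close>.\<close>

lemma resolvent_perturbation:
  fixes A :: "'a::complex_banach \<rightharpoonup> 'a"
  assumes k: "k \<in> resolvent_set A" and small: "cmod (l - k) * norm (resolvent k A) \<le> 1 / 2"
  shows "l \<in> resolvent_set A" "norm (resolvent l A) \<le> 2 * norm (resolvent k A)"
proof -
  let ?R = "blinfun_apply (resolvent k A)"
  define B where "B x = (k - l) *\<^sub>C ?R x" for x
  have B_le: "norm (B x) \<le> norm x / 2" for x
  proof -
    have "norm (B x) \<le> cmod (l - k) * (norm (resolvent k A) * norm x)"
      unfolding B_def norm_scaleC norm_minus_commute[of k l]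
      by (intro mult_left_mono norm_blinfun) auto
    also have "\<dots> \<le> 1 / 2 * norm x"
      unfolding mult.assoc[symmetric] by (intro mult_right_mono small) auto
    finally show ?thesis by simp
  qed
  have B_diff: "B (x - y) = B x - B y" and B_add: "B (x + y) = B x + B y"
    and B_scaleC: "B (c *\<^sub>C x) = c *\<^sub>C B x" for x y c
    by (simp_all add: B_def blinfun.diff_right blinfun.add_right scaleC_diff_right
        scaleC_add_right resolvent_inverse(4)[OF k] scaleC_scaleC mult.commute)
  have "\<exists>!w. y + B w = w" for y
    by (rule banach_fix_type[of "1/2"])
      (use B_le in \<open>auto simp: dist_norm B_diff[symmetric]\<close>)
  then have "\<forall>y. \<exists>w. y + B w = w" by blast
  then obtain W where W: "\<And>y. y + B (W y) = W y" by metis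
  have W_unique: "w = W y" if "y + B w = w" for w y
  proof -
    have "w - W y = B (w - W y)" using W[of y] that by (metis B_diff add_diff_cancel_left)
    then show ?thesis using B_le[of "w - W y"] by simp
  qed
  have W_le: "norm (W y) \<le> 2 * norm y" for y
    using norm_triangle_ineq[of y "B (W y)"] B_le[of "W y"] unfolding W by simp
  have W_add: "W (x + y) = W x + W y" for x y
    by (rule W_unique[symmetric]) (use W[of x] W[of y] in \<open>simp add: B_add algebra_simps\<close>)
  have W_scaleC: "W (c *\<^sub>C x) = c *\<^sub>C W x" for c x
    by (rule W_unique[symmetric])
      (simp only: B_scaleC W scaleC_add_right[symmetric])
  have R_le: "norm (?R (W y)) \<le> 2 * norm (resolvent k A) * norm y" for y
    using norm_blinfun[of "resolvent k A" "W y"]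
      mult_left_mono[OF W_le[of y] norm_ge_zero[of "resolvent k A"]] by (simp add: mult_ac)
  have bl: "bounded_clinear (\<lambda>y. ?R (W y))"
    unfolding bounded_clinear_def
  proof (intro conjI allI)
    show "bounded_linear (\<lambda>y. ?R (W y))"
      by (rule bounded_linear_intro[where K = "2 * norm (resolvent k A)"])
        (use R_le in \<open>simp_all add: W_add blinfun.add_right scaleR_scaleC W_scaleC
          resolvent_inverse(4)[OF k] mult_ac\<close>)
    show "?R (W (c *\<^sub>C x)) = c *\<^sub>C ?R (W x)" for c x
      by (simp add: W_scaleC resolvent_inverse(4)[OF k])
  qed
  have shift: "l *\<^sub>C z - the (A z) = (k *\<^sub>C z - the (A z)) - (k - l) *\<^sub>C z" for z
    by (simp add: scaleC_diff_left)
  have inv: "l *\<^sub>C ?R (W y) - the (A (?R (W y))) = y" for y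
    unfolding shift resolvent_inverse(2)[OF k] using W[of y] by (simp add: B_def algebra_simps)
  have inv': "?R (W (l *\<^sub>C z - the (A z))) = z" if z: "z \<in> dom A" for z
  proof -
    let ?w = "k *\<^sub>C z - the (A z)"
    have "?w = W (l *\<^sub>C z - the (A z))"
      by (rule W_unique) (unfold B_def resolvent_inverse(3)[OF k z] shift, simp)
    then show ?thesis using resolvent_inverse(3)[OF k z] by simp
  qed
  note new = resolvent_setI[of "\<lambda>y. ?R (W y)", OF resolvent_inverse(1)[OF k] inv inv' bl]
  show "l \<in> resolvent_set A" by (rule new)
  show "norm (resolvent l A) \<le> 2 * norm (resolvent k A)"
    using R_le bl by (intro norm_blinfun_bound)
      (auto simp: new(2) bounded_clinear_def bounded_linear_Blinfun_apply)
qed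

lemma resolvent_set_open: "open (resolvent_set (A :: 'a::complex_banach \<rightharpoonup> 'a))"
  unfolding open_contains_ball
proof safe
  fix k assume k: "k \<in> resolvent_set A"
  define e where "e = 1 / (2 * norm (resolvent k A) + 1)"
  have pos: "2 * norm (resolvent k A) + 1 > 0"
    using norm_ge_zero[of "resolvent k A"] by linarith
  have "ball k e \<subseteq> resolvent_set A"
  proof
    fix l assume "l \<in> ball k e"
    then have "cmod (l - k) * norm (resolvent k A) \<le> e * norm (resolvent k A)"
      by (intro mult_right_mono) (auto simp: dist_norm norm_minus_commute)
    also have "\<dots> \<le> 1 / 2" using pos by (simp add: e_def field_simps)
    finally show "l \<in> resolvent_set A" using resolvent_perturbation[OF k] by blast
  qed
  moreover have "e > 0" using pos by (simp add: e_def)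
  ultimately show "\<exists>e>0. ball k e \<subseteq> resolvent_set A" by blast
qed

lemma continuous_on_resolvent:
  fixes A :: "'a::complex_banach \<rightharpoonup> 'a"
  shows "continuous_on (resolvent_set A) (\<lambda>l. resolvent l A)"
  unfolding continuous_on_def
proof
  fix k assume k: "k \<in> resolvent_set A"
  let ?n = "norm (resolvent k A)"
  have lim: "((\<lambda>l. cmod (l - k) * (2 * ?n * ?n)) \<longlongrightarrow> 0) (at k within resolvent_set A)"
    "((\<lambda>l. cmod (l - k) * ?n) \<longlongrightarrow> 0) (at k within resolvent_set A)"
    by (auto intro!: tendsto_eq_intros)
  have "eventually (\<lambda>l. cmod (l - k) * ?n < 1 / 2) (at k within resolvent_set A)"
    using order_tendstoD(2)[OF lim(2), of "1/2"] by simp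
  then have "eventually (\<lambda>l. norm (resolvent l A - resolvent k A) \<le> cmod (l - k) * (2 * ?n * ?n))
      (at k within resolvent_set A)"
  proof eventually_elim
    case (elim l)
    then have l: "l \<in> resolvent_set A" and n: "norm (resolvent l A) \<le> 2 * ?n"
      using resolvent_perturbation[OF k, of l] by auto
    show ?case
    proof (rule norm_blinfun_bound)
      fix x
      have "(resolvent l A - resolvent k A) x = (k - l) *\<^sub>C resolvent k A (resolvent l A x)"
        using resolvent_identity[OF k l, of x] unfolding blinfun.diff_left diff_eq_eq by (simp only: add.commute)
      then have "norm ((resolvent l A - resolvent k A) x) \<le>
          cmod (l - k) * (?n * (norm (resolvent l A) * norm x))"
        by (auto simp: norm_scaleC norm_minus_commute
            intro!: mult_left_mono order_trans[OF norm_blinfun] norm_blinfun)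
      also have "\<dots> \<le> cmod (l - k) * (?n * (2 * ?n * norm x))"
        by (intro mult_left_mono mult_right_mono n) auto
      finally show "norm ((resolvent l A - resolvent k A) x) \<le> cmod (l - k) * (2 * ?n * ?n) * norm x"
        by (simp add: mult_ac)
    qed simp
  qed
  then have "((\<lambda>l. resolvent l A - resolvent k A) \<longlongrightarrow> 0) (at k within resolvent_set A)"
    by (rule Lim_null_comparison[OF _ lim(1)])
  then show "((\<lambda>l. resolvent l A) \<longlongrightarrow> resolvent k A) (at k within resolvent_set A)"
    by (simp add: LIM_zero_iff)
qed

text \<open>The resolvent identity turns the difference quotient into an expression that is continuous in the
  resolvent.\<close>

lemma resolvent_functional_holomorphic:
  fixes A :: "'a::complex_banach \<rightharpoonup> 'a"
  assumes \<xi>: "contractive_functional \<xi>"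
  shows "(\<lambda>l. \<xi> (resolvent l A x)) holomorphic_on resolvent_set A"
  unfolding holomorphic_on_def
proof
  fix k assume k: "k \<in> resolvent_set A"
  let ?F = "at k within resolvent_set A"
  have limit: "((\<lambda>l. - \<xi> (resolvent k A (resolvent l A x))) \<longlongrightarrow> - \<xi> (resolvent k A (resolvent k A x))) ?F"
    using continuous_on_resolvent[of A] k
    by (intro tendsto_minus bounded_linear.tendsto[OF contractive_functionalD(4)[OF \<xi>]]
        blinfun.tendsto tendsto_const) (auto simp: continuous_on_def)
  have quotient: "- \<xi> (resolvent k A (resolvent l A x)) =
      (\<xi> (resolvent l A x) - \<xi> (resolvent k A x)) / (l - k)"
    if "l \<in> resolvent_set A" "l \<noteq> k" for l
  proof -
    have "\<xi> (resolvent l A x) = \<xi> (resolvent k A x) + (k - l) * \<xi> (resolvent k A (resolvent l A x))"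
      unfolding contractive_functionalD(2,5)[OF \<xi>, symmetric]
      by (rule arg_cong[where f = \<xi>], rule resolvent_identity[OF k that(1)])
    then have "\<xi> (resolvent l A x) - \<xi> (resolvent k A x) = - \<xi> (resolvent k A (resolvent l A x)) * (l - k)"
      by (simp add: algebra_simps)
    then show ?thesis using that(2) by (simp add: eq_divide_eq)
  qed
  have "eventually (\<lambda>l. - \<xi> (resolvent k A (resolvent l A x)) =
      (\<xi> (resolvent l A x) - \<xi> (resolvent k A x)) / (l - k)) ?F"
    unfolding eventually_at_filter by (intro always_eventually allI impI quotient)
  with limit have "((\<lambda>l. (\<xi> (resolvent l A x) - \<xi> (resolvent k A x)) / (l - k)) \<longlongrightarrow>
      - \<xi> (resolvent k A (resolvent k A x))) ?F"
    by (rule Lim_transform_eventually)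
  then show "(\<lambda>l. \<xi> (resolvent l A x)) field_differentiable ?F"
    unfolding field_differentiable_def has_field_derivative_iff by blast
qed

section \<open>Laplace transforms of scalar functions\<close>

lemma exp_decay_integral:
  fixes a :: real
  assumes "a > 0"
  shows "set_integrable lborel {0<..} (\<lambda>t. exp (- (a * t)))"
    and "(LINT t:{0<..}|lborel. exp (- (a * t))) = 1 / a"
proof -
  let ?F = "\<lambda>t. - (exp (- (a * t)) / a)"
  have F: "DERIV ?F t :> exp (- (a * t))" for t
    using assms by (auto intro!: derivative_eq_intros)
  have A: "((?F \<circ> real_of_ereal) \<longlongrightarrow> - (1 / a)) (at_right (ereal 0))"
    unfolding ereal_tendsto_simps using assms by (auto intro!: tendsto_eq_intros)
  have "filterlim (\<lambda>t. a * t) at_top at_top"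
    using assms by (intro filterlim_tendsto_pos_mult_at_top[OF tendsto_const]) (auto intro: filterlim_ident)
  then have "((\<lambda>t. exp (- (a * t))) \<longlongrightarrow> 0) at_top"
    by (intro filterlim_compose[OF exp_at_bot]) (simp add: filterlim_uminus_at_bot)
  then have "(?F \<longlongrightarrow> - (0 / a)) at_top"
    by (intro tendsto_intros) (use assms in auto)
  then have B: "((?F \<circ> real_of_ereal) \<longlongrightarrow> 0) (at_left \<infinity>)"
    unfolding ereal_tendsto_simps by simp
  have *: "set_integrable lborel (einterval (ereal 0) \<infinity>) (\<lambda>t. exp (- (a * t)))"
    "(LBINT t=ereal 0..\<infinity>. exp (- (a * t))) = 0 - - (1 / a)"
    by (rule interval_integral_FTC_nonneg[OF _ F _ _ A B]; simp)+
  from *(1) show "set_integrable lborel {0<..} (\<lambda>t. exp (- (a * t)))"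
    unfolding einterval_eq_Ici .
  from *(2) show "(LINT t:{0<..}|lborel. exp (- (a * t))) = 1 / a"
    unfolding interval_integral_to_infinity_eq by simp
qed

text \<open>The set \<open>S\<close> is the half-line or, for the past of a time \<open>t\<close>, the interval from \<open>0\<close> to \<open>t\<close>. In
  the latter case the transform of a bounded function is entire.\<close>

definition laplace_on :: "real set \<Rightarrow> (real \<Rightarrow> complex) \<Rightarrow> complex \<Rightarrow> complex" where
  "laplace_on S h l = (LINT t:S|lborel. exp (- (l * of_real t)) * h t)"

lemma set_borel_measurable_exp_mult:
  assumes "set_borel_measurable lborel S h"
  shows "set_borel_measurable lborel S (\<lambda>t. exp (- (l * complex_of_real t)) * h t)"
proof -
  have "(\<lambda>t. exp (- (l * complex_of_real t)) * (indicator S t *\<^sub>R h t)) \<in> borel_measurable lborel"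
    using assms unfolding set_borel_measurable_def
    by (intro borel_measurable_times) (auto intro!: borel_measurable_continuous_onI continuous_intros)
  then show ?thesis by (simp add: set_borel_measurable_def)
qed

lemma set_borel_measurable_continuous_open:
  fixes h :: "real \<Rightarrow> complex"
  assumes "open S" "continuous_on S h"
  shows "set_borel_measurable lborel S h"
  using borel_measurable_continuous_on_indicator[OF _ assms(2)] assms(1)
  by (simp add: set_borel_measurable_def)

lemma
  assumes S: "S \<in> sets lborel" "S \<subseteq> {0<..}" and h: "set_borel_measurable lborel S h"
    and le: "\<And>t. t \<in> S \<Longrightarrow> cmod (h t) \<le> C * exp (b * t)" and C: "C \<ge> 0" and l: "b < Re l"
  shows laplace_on_integrable: "set_integrable lborel S (\<lambda>t. exp (- (l * of_real t)) * h t)"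
    and laplace_on_bound: "cmod (laplace_on S h l) \<le> C / (Re l - b)"
proof -
  let ?g = "\<lambda>t. C * exp (- ((Re l - b) * t))"
  have g: "set_integrable lborel {0<..} ?g" "(LINT t:{0<..}|lborel. ?g t) = C / (Re l - b)"
    using exp_decay_integral[of "Re l - b"] l by auto
  have pw: "norm (exp (- (l * of_real t)) * h t) \<le> ?g t" if "t \<in> S" for t
  proof -
    have "norm (exp (- (l * of_real t)) * h t) \<le> exp (- (Re l * t)) * (C * exp (b * t))"
      unfolding norm_mult by (intro mult_mono le that) auto
    also have "\<dots> = ?g t" by (simp add: exp_add[symmetric] algebra_simps)
    finally show ?thesis .
  qed
  have gS: "set_integrable lborel S ?g"
    using set_integrable_subset[OF g(1) S] .
  show int: "set_integrable lborel S (\<lambda>t. exp (- (l * of_real t)) * h t)"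
    by (rule set_integrable_bound[OF gS set_borel_measurable_exp_mult[OF h]])
      (use pw C in \<open>auto simp: abs_mult intro!: AE_I2\<close>)
  have "cmod (laplace_on S h l) \<le> (LINT t:S|lborel. norm (exp (- (l * of_real t)) * h t))"
    unfolding laplace_on_def by (rule set_integral_norm_bound[OF int])
  also have "\<dots> \<le> (LINT t:S|lborel. ?g t)"
    by (rule set_integral_mono[OF set_integrable_norm[OF int] gS pw])
  also have "\<dots> \<le> (LINT t:{0<..}|lborel. ?g t)"
    unfolding set_lebesgue_integral_def
    by (rule integral_mono) (use gS g(1) S C in \<open>auto simp: set_integrable_def indicator_def\<close>)
  finally show "cmod (laplace_on S h l) \<le> C / (Re l - b)" using g(2) by simp
qed

text \<open>The integrable majorant for differentiating a Laplace transform under the integral sign.\<close>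

lemma exp_difference_quotient_bound:
  fixes l k :: complex
  assumes "a \<le> Re l" "a \<le> Re k" "l \<noteq> k" "t \<ge> 0"
  shows "cmod ((exp (- (l * of_real t)) - exp (- (k * of_real t))) / (l - k)) \<le> t * exp (- (a * t))"
proof -
  have "cmod (exp (- (l * of_real t)) - exp (- (k * of_real t))) \<le> t * exp (- (a * t)) * cmod (l - k)"
  proof (rule field_differentiable_bound[where S = "{z. Re z \<ge> a}"])
    show "convex {z. Re z \<ge> a}" by (rule convex_halfspace_Re_ge)
    show "((\<lambda>z. exp (- (z * of_real t))) has_field_derivative - of_real t * exp (- (z * of_real t)))
        (at z within {z. Re z \<ge> a})" for z
      by (auto intro!: derivative_eq_intros)
    show "cmod (- of_real t * exp (- (z * of_real t))) \<le> t * exp (- (a * t))"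
      if "z \<in> {z. Re z \<ge> a}" for z
      using that assms by (auto simp: norm_mult intro!: mult_left_mono mult_right_mono)
  qed (use assms in auto)
  then show ?thesis using assms by (simp add: norm_divide divide_simps)
qed

lemma laplace_on_holomorphic:
  assumes S: "S \<in> sets lborel" "S \<subseteq> {0<..}" and h: "set_borel_measurable lborel S h"
    and le: "\<And>t. t \<in> S \<Longrightarrow> cmod (h t) \<le> C * exp (b * t)" and C: "C \<ge> 0"
  shows "laplace_on S h holomorphic_on {l. b < Re l}"
  unfolding holomorphic_on_def
proof
  fix l assume "l \<in> {l. b < Re l}"
  then have l: "b < Re l" by simp
  define d where "d = (Re l - b) / 3"
  have d: "d > 0" "Re l = b + 3 * d" using l by (simp_all add: d_def field_simps)
  let ?e = "\<lambda>l t. exp (- (l * complex_of_real t))"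
  let ?G = "LINT t:S|lborel. - of_real t * (?e l t * h t)"
  let ?q = "\<lambda>k t. (?e k t - ?e l t) / (k - l) * h t"
  have near: "b + 2 * d < Re k" if "k \<in> ball l d" for k
    using that abs_Re_le_cmod[of "l - k"] d by (auto simp: dist_norm)
  have meas: "set_borel_measurable lborel S (?q k)" for k
  proof -
    have "(\<lambda>t. (?e k t - ?e l t) / (k - l) * (indicator S t *\<^sub>R h t)) \<in> borel_measurable lborel"
      using h unfolding set_borel_measurable_def
      by (intro borel_measurable_times)
        (auto intro!: borel_measurable_continuous_onI continuous_intros simp: divide_inverse)
    then show ?thesis by (simp add: set_borel_measurable_def)
  qed
  have meas': "set_borel_measurable lborel S (\<lambda>t. - of_real t * (?e l t * h t))"
  proof -
    have "(\<lambda>t. - of_real t * (?e l t * (indicator S t *\<^sub>R h t))) \<in> borel_measurable lborel"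
      using h unfolding set_borel_measurable_def
      by (intro borel_measurable_times) (auto intro!: borel_measurable_continuous_onI continuous_intros)
    then show ?thesis by (simp add: set_borel_measurable_def)
  qed
  have dom: "cmod (?q k t) \<le> C / d * exp (- (d * t))" if k: "k \<in> ball l d - {l}" and t: "t \<in> S" for k t
  proof -
    have t0: "t > 0" using t S by auto
    have "cmod ((?e k t - ?e l t) / (k - l)) \<le> t * exp (- ((b + 2 * d) * t))"
      by (rule exp_difference_quotient_bound) (use k near[of k] d t0 in auto)
    then have "cmod (?q k t) \<le> t * exp (- ((b + 2 * d) * t)) * (C * exp (b * t))"
      unfolding norm_mult by (intro mult_mono le t) (use t0 in auto)
    also have "\<dots> = C / d * ((d * t) * exp (- (2 * d * t)))"
      using d by (simp add: exp_add[symmetric] algebra_simps)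
    also have "\<dots> \<le> C / d * (exp (d * t) * exp (- (2 * d * t)))"
      using exp_ge_add_one_self[of "d * t"] C d
      by (intro mult_left_mono mult_right_mono) (auto simp del: exp_ge_add_one_self)
    also have "\<dots> = C / d * exp (- (d * t))"
      by (simp add: exp_add[symmetric])
    finally show ?thesis .
  qed
  have eint: "integrable lborel (\<lambda>t. indicator S t *\<^sub>R (C / d * exp (- (d * t))))"
    using set_integrable_subset[OF exp_decay_integral(1)[OF d(1)] S]
    unfolding set_integrable_def by (auto simp: mult.left_commute dest: integrable_mult_right[of "C / d"])
  have "((\<lambda>k. (laplace_on S h k - laplace_on S h l) / (k - l)) \<longlongrightarrow> ?G) (at l within ball l d)"
    unfolding tendsto_at_iff_sequentially comp_def
  proof (intro allI impI)
    fix X assume X: "\<forall>i. X i \<in> ball l d - {l}" and lim: "X \<longlonglongrightarrow> l"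
    have eq: "(laplace_on S h (X i) - laplace_on S h l) / (X i - l) = (LINT t:S|lborel. ?q (X i) t)" for i
    proof -
      have Xi: "b < Re (X i)" using near[of "X i"] X d(1) by fastforce
      have "laplace_on S h (X i) - laplace_on S h l
          = (LINT t:S|lborel. ?e (X i) t * h t - ?e l t * h t)"
        unfolding laplace_on_def
        by (rule set_integral_diff(2)[symmetric, OF laplace_on_integrable[OF S h le C Xi]
            laplace_on_integrable[OF S h le C l]])
      then have "(laplace_on S h (X i) - laplace_on S h l) / (X i - l)
          = (LINT t:S|lborel. (?e (X i) t * h t - ?e l t * h t) / (X i - l))"
        by simp
      also have "(\<lambda>t. (?e (X i) t * h t - ?e l t * h t) / (X i - l)) = ?q (X i)"
        by (simp add: algebra_simps diff_divide_distrib)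
      finally show ?thesis .
    qed
    show "(\<lambda>i. (laplace_on S h (X i) - laplace_on S h l) / (X i - l)) \<longlonglongrightarrow> ?G"
      unfolding eq set_lebesgue_integral_def
    proof (rule integral_dominated_convergence[OF _ _ eint])
      show "(\<lambda>t. indicator S t *\<^sub>R (- of_real t * (?e l t * h t))) \<in> borel_measurable lborel"
        "(\<lambda>t. indicator S t *\<^sub>R ?q (X i) t) \<in> borel_measurable lborel" for i
        using meas' meas[of "X i"] by (auto simp: set_borel_measurable_def)
      show "AE t in lborel. norm (indicator S t *\<^sub>R ?q (X i) t) \<le> indicator S t *\<^sub>R (C / d * exp (- (d * t)))" for i
        using dom[of "X i"] X by (auto simp: indicator_def)
      have "(\<lambda>i. ?q (X i) t) \<longlonglongrightarrow> - of_real t * ?e l t * h t" for t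
      proof -
        have "((\<lambda>z. ?e z t) has_field_derivative - of_real t * ?e l t) (at l)"
          by (auto intro!: derivative_eq_intros)
        then have "((\<lambda>k. (?e k t - ?e l t) / (k - l)) \<longlongrightarrow> - of_real t * ?e l t) (at l)"
          by (simp add: has_field_derivative_iff)
        moreover have "filterlim X (at l) sequentially"
          using X lim by (auto simp: filterlim_at)
        ultimately have "(\<lambda>i. (?e (X i) t - ?e l t) / (X i - l)) \<longlonglongrightarrow> - of_real t * ?e l t"
          by (rule filterlim_compose)
        then show ?thesis by (intro tendsto_mult tendsto_const)
      qed
      then show "AE t in lborel. (\<lambda>i. indicator S t *\<^sub>R ?q (X i) t) \<longlonglongrightarrow>
          indicator S t *\<^sub>R (- of_real t * (?e l t * h t))"
        by (intro AE_I2 tendsto_scaleR tendsto_const) (simp add: mult.assoc)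
    qed
  qed
  then have "(laplace_on S h has_field_derivative ?G) (at l)"
    using d(1) by (simp add: has_field_derivative_iff at_within_open[of _ "ball l d"])
  then show "laplace_on S h field_differentiable at l within {l. b < Re l}"
    using field_differentiable_at_within field_differentiable_def by blast
qed

text \<open>Integration by parts gains the factor \<open>\<bar>l\<bar>\<close> over the trivial bound \<open>M / Re l\<close>, so a contour of size
  \<open>r\<close> round the origin contributes in proportion to \<open>r\<close>. The extended real end point \<open>e\<close> covers the
  half-line and bounded intervals at once.\<close>

lemma laplace_on_antiderivative_bound:
  assumes S: "S = einterval 0 e" "0 < e"
    and f: "\<And>t. 0 < t \<Longrightarrow> ereal t < e \<Longrightarrow> isCont f t" "\<And>t. 0 < t \<Longrightarrow> ereal t < e \<Longrightarrow> cmod (f t) \<le> M"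
    and w: "\<And>t. 0 < t \<Longrightarrow> ereal t < e \<Longrightarrow> (w has_vector_derivative f t) (at t)"
    and wM: "\<And>t. 0 \<le> t \<Longrightarrow> ereal t \<le> e \<Longrightarrow> cmod (w t) \<le> M"
    and w0: "(w \<longlongrightarrow> w 0) (at_right 0)"
    and we: "\<And>u. e = ereal u \<Longrightarrow> (w \<longlongrightarrow> w u) (at_left u)"
    and l: "Re l > 0"
  shows "cmod (laplace_on S f l) \<le> 3 * M * cmod l / Re l"
proof -
  let ?E = "\<lambda>t. exp (- (l * complex_of_real t))"
  have M: "M \<ge> 0" using wM[of 0] S(2) norm_ge_zero[of "w 0"] order_trans[of 0 "cmod (w 0)" M]
    by (simp add: zero_ereal_def[symmetric] less_imp_le)
  have S': "S \<in> sets lborel" "S \<subseteq> {0<..}" "open S"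
    unfolding S(1) using borel_einterval[of 0 e] open_einterval[of 0 e] by (auto simp: einterval_def)
  have St: "t > 0" "ereal t < e" if "t \<in> S" for t using that by (auto simp: S einterval_def)
  have mf: "set_borel_measurable lborel S f" and mw: "set_borel_measurable lborel S w"
    using St f(1) has_vector_derivative_continuous[OF w] S'(3)
    by (auto intro!: set_borel_measurable_continuous_open continuous_at_imp_continuous_on)
  have int: "set_integrable lborel S (\<lambda>t. ?E t * f t)" "set_integrable lborel S (\<lambda>t. ?E t * w t)"
    and bw: "cmod (laplace_on S w l) \<le> M / Re l"
    using laplace_on_integrable[OF S'(1,2) mf _ M, of 0 l] laplace_on_integrable[OF S'(1,2) mw _ M, of 0 l]
      laplace_on_bound[OF S'(1,2) mw _ M, of 0 l] St f(2) wM l by (auto simp: less_imp_le)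
  obtain B where B: "(((\<lambda>t. ?E t * w t) \<circ> real_of_ereal) \<longlongrightarrow> B) (at_left e)" "cmod B \<le> M"
  proof (cases e)
    case (real u)
    have u: "u > 0" using S(2) real by simp
    have "((\<lambda>t. ?E t * w t) \<longlongrightarrow> ?E u * w u) (at_left u)"
      by (intro tendsto_mult we[OF real] tendsto_intros)
    moreover have "cmod (?E u * w u) \<le> 1 * M"
      unfolding norm_mult using u l wM[of u] M real by (intro mult_mono) auto
    ultimately show ?thesis using that[of "?E u * w u"] real by (simp add: ereal_tendsto_simps)
  next
    case PInf
    have "filterlim (\<lambda>t. Re l * t) at_top at_top"
      using l by (intro filterlim_tendsto_pos_mult_at_top[OF tendsto_const]) (auto intro: filterlim_ident)
    then have "((\<lambda>t. exp (- (Re l * t))) \<longlongrightarrow> 0) at_top"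
      by (intro filterlim_compose[OF exp_at_bot]) (simp add: filterlim_uminus_at_bot)
    then have "((\<lambda>t. exp (- (Re l * t)) * M) \<longlongrightarrow> 0 * M) at_top"
      by (intro tendsto_mult tendsto_const)
    then have lim: "((\<lambda>t. exp (- (Re l * t)) * M) \<longlongrightarrow> 0) at_top" by simp
    have "((\<lambda>t. ?E t * w t) \<longlongrightarrow> 0) at_top"
    proof (rule Lim_null_comparison[OF _ lim])
      show "\<forall>\<^sub>F t in at_top. norm (?E t * w t) \<le> exp (- (Re l * t)) * M"
        using eventually_ge_at_top[of 0]
        by eventually_elim (use PInf wM in \<open>auto simp: norm_mult intro!: mult_left_mono\<close>)
    qed
    then show ?thesis using that[of 0] PInf M by (simp add: ereal_tendsto_simps)
  qed (use S(2) in auto)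
  have "(LBINT t=ereal 0..e. ?E t * f t - l * (?E t * w t)) = B - ?E 0 * w 0"
  proof (rule interval_integral_FTC_integrable[where F = "\<lambda>t. ?E t * w t"])
    show "ereal 0 < e" using S by (simp add: zero_ereal_def)
    fix t assume "ereal 0 < ereal t" "ereal t < e"
    then have t: "0 < t" "ereal t < e" by auto
    have Ed: "(?E has_vector_derivative (- l * ?E t)) (at t)"
      by (rule has_vector_derivative_real_field) (auto intro!: derivative_eq_intros)
    show "((\<lambda>t. ?E t * w t) has_vector_derivative (?E t * f t - l * (?E t * w t))) (at t)"
      using has_vector_derivative_mult[OF Ed w[OF t]] by (simp add: algebra_simps)
    show "isCont (\<lambda>t. ?E t * f t - l * (?E t * w t)) t"
      using f(1)[OF t] has_vector_derivative_continuous[OF w[OF t]] by (auto intro!: continuous_intros)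
  next
    show "set_integrable lborel (einterval (ereal 0) e) (\<lambda>t. ?E t * f t - l * (?E t * w t))"
      using set_integral_diff(1)[OF int(1) set_integrable_mult_right[OF int(2), of l]]
      by (simp add: S zero_ereal_def)
    have "((\<lambda>t. ?E t * w t) \<longlongrightarrow> ?E 0 * w 0) (at_right 0)"
      by (intro tendsto_mult w0 tendsto_intros)
    then show "(((\<lambda>t. ?E t * w t) \<circ> real_of_ereal) \<longlongrightarrow> ?E 0 * w 0) (at_right (ereal 0))"
      by (simp add: ereal_tendsto_simps)
    show "(((\<lambda>t. ?E t * w t) \<circ> real_of_ereal) \<longlongrightarrow> B) (at_left e)" by (rule B)
  qed
  moreover have "(LBINT t=ereal 0..e. ?E t * f t - l * (?E t * w t)) = laplace_on S f l - l * laplace_on S w l"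
    using S(2) set_integral_diff(2)[OF int(1) set_integrable_mult_right[OF int(2), of l]]
    by (simp add: interval_lebesgue_integral_def zero_ereal_def[symmetric] less_imp_le S(1) laplace_on_def)
  ultimately have "laplace_on S f l - l * laplace_on S w l = B - w 0" by simp
  then have "laplace_on S f l = l * laplace_on S w l + B - w 0"
    by (simp only: algebra_simps)
  then have bd: "cmod (laplace_on S f l) \<le> cmod l * (M / Re l) + M + M"
    using norm_triangle_ineq4[of "l * laplace_on S w l + B" "w 0"]
      norm_triangle_ineq[of "l * laplace_on S w l" B] B(2) wM[of 0] S(2)
      mult_left_mono[OF bw norm_ge_zero[of l]]
    by (simp add: norm_mult zero_ereal_def[symmetric] less_imp_le)
  define X where "X = M * (cmod l / Re l)"
  have "M * 1 \<le> X"
    unfolding X_def using l complex_Re_le_cmod[of l] M by (intro mult_left_mono) (auto simp: divide_simps)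
  moreover have "cmod (laplace_on S f l) \<le> X + M + M"
    using bd by (simp add: X_def mult.commute)
  ultimately have "cmod (laplace_on S f l) \<le> 3 * X" by simp
  then show ?thesis by (simp add: X_def mult.assoc)
qed

text \<open>The future of \<open>f\<close> after time \<open>t\<close> is the transform of \<open>f\<close> minus that of the past, up to the factor
  \<open>e\<^sup>l\<^sup>t\<close>. The formula makes the transform of the future continue as far as that of \<open>f\<close>.\<close>

lemma laplace_split:
  assumes f: "continuous_on {0<..} f" "\<And>t. 0 < t \<Longrightarrow> cmod (f t) \<le> M" and l: "Re l > 0" and t: "t > 0"
  shows "laplace_on {0<..} f l = laplace_on {0<..<t} f l + exp (- (l * of_real t)) * laplace_on {0<..} (\<lambda>\<tau>. f (t + \<tau>)) l"
proof -
  let ?g = "\<lambda>x. exp (- (l * complex_of_real x)) * f x"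
  have M: "M \<ge> 0" using f(2)[of 1] norm_ge_zero[of "f 1"] by linarith
  have int: "set_integrable lborel {0<..} ?g"
    using laplace_on_integrable[of "{0<..}" f M 0 l] f l M set_borel_measurable_continuous_open[of "{0<..}" f]
    by auto
  have int': "set_integrable lborel ({0<..<t} \<union> {t<..}) ?g"
    by (rule set_integrable_subset[OF int]) (use t in auto)
  have "laplace_on {0<..} f l = (LINT x:({0<..<t} \<union> {t<..})|lborel. ?g x)"
    unfolding laplace_on_def
  proof (rule set_integral_cong_set)
    have "AE x in lborel. x \<noteq> t" by (rule AE_lborel_singleton)
    then show "AE x in lborel. (x \<in> {0<..<t} \<union> {t<..}) = (x \<in> {0<..})"
      by eventually_elim (use t in auto)
  next
    show "set_borel_measurable lborel {0<..} ?g" "set_borel_measurable lborel ({0<..<t} \<union> {t<..}) ?g"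
      using borel_measurable_integrable[OF int[unfolded set_integrable_def]]
        borel_measurable_integrable[OF int'[unfolded set_integrable_def]]
      unfolding set_borel_measurable_def .
  qed
  also have "\<dots> = laplace_on {0<..<t} f l + (LINT x:{t<..}|lborel. ?g x)"
    unfolding laplace_on_def
    by (rule set_integral_Un) (use t in \<open>auto intro!: set_integrable_subset[OF int]\<close>)
  also have "(LINT x:{t<..}|lborel. ?g x) = (LINT x:{0<..}|lborel. ?g (t + x))"
    unfolding set_lebesgue_integral_def
    by (subst lborel_integral_real_affine[where c = 1 and t = t]) (auto simp: indicator_def)
  also have "\<dots> = exp (- (l * of_real t)) * laplace_on {0<..} (\<lambda>\<tau>. f (t + \<tau>)) l"
    unfolding laplace_on_def set_lebesgue_integral_def integral_mult_right_zero[symmetric]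
    by (intro Bochner_Integration.integral_cong refl)
      (simp add: distrib_left mult.assoc[symmetric] mult_exp_exp)
  finally show ?thesis .
qed

lemma laplace_reflect:
  "exp (l * of_real t) * laplace_on {0<..<t} f l = laplace_on {0<..<t} (\<lambda>\<tau>. f (t - \<tau>)) (- l)"
proof -
  have "laplace_on {0<..<t} f l = (LINT x:{0<..<t}|lborel. exp (- (l * of_real (t - x))) * f (t - x))"
    unfolding laplace_on_def set_lebesgue_integral_def
    by (subst lborel_integral_real_affine[where c = "-1" and t = t])
      (auto simp: indicator_def intro!: Bochner_Integration.integral_cong)
  then show ?thesis
    unfolding laplace_on_def set_lebesgue_integral_def
    by (simp only: integral_mult_right_zero[symmetric])
      (intro Bochner_Integration.integral_cong refl,
        simp add: mult.assoc[symmetric] mult_exp_exp algebra_simps)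
qed

section \<open>Rotating the half-line of integration\<close>

text \<open>A sector round the positive half-line, described by real and imaginary parts so that convexity
  and membership are matters of linear inequalities.\<close>

definition wedge :: "real \<Rightarrow> complex set" where
  "wedge c = {z. 0 < Re z \<and> \<bar>Im z\<bar> < c * Re z}"

lemma wedge_open: "open (wedge c)" and wedge_convex: "convex (wedge c)"
proof -
  have eq: "wedge c = {z. 0 < Re z} \<inter> {z. Im z - c * Re z < 0} \<inter> {z. - Im z - c * Re z < 0}"
    by (auto simp: wedge_def)
  show "open (wedge c)"
    unfolding eq by (intro open_Int open_Collect_less continuous_intros)
  have half: "convex {z. a * Im z - c * Re z < 0}" for a
  proof -
    have "{z. a * Im z - c * Re z < 0} = {z. Complex (- c) a \<bullet> z < 0}"
      by (auto simp: inner_complex_def)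
    then show ?thesis by (simp only: convex_halfspace_lt)
  qed
  show "convex (wedge c)"
    unfolding eq using half[of 1] half[of "-1"] convex_halfspace_Re_gt[of 0]
    by (intro convex_Int) auto
qed

text \<open>Let \<open>\<Phi>\<close> be a primitive of \<open>e\<^sup>-\<^sup>l\<^sup>z s(z)\<close> on the wedge. The two integrals differ by the total
  increment of \<open>\<Phi>(tq) - \<Phi>(t)\<close> over the half-line. The integrand is at most \<open>C e\<^sup>-\<^sup>t\<close> on the segment
  between \<open>t\<close> and \<open>tq\<close>, whose length is at most \<open>t\<close>, so this difference vanishes at both ends.\<close>

lemma laplace_rotate:
  assumes s: "s holomorphic_on wedge c" "\<And>z. z \<in> wedge c \<Longrightarrow> cmod (s z) \<le> C * exp (\<omega> * cmod z)"
    and \<omega>: "\<omega> \<ge> 0" and C: "C \<ge> 0"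
    and q: "Re q = 1" "\<bar>Im q\<bar> < c" "\<bar>Im q\<bar> \<le> 1"
    and l: "2 * \<omega> + 1 \<le> Re l" "2 * \<omega> + 1 \<le> Re (l * q)"
  shows "laplace_on {0<..} (\<lambda>t. s (of_real t)) l = q * laplace_on {0<..} (\<lambda>t. s (of_real t * q)) (l * q)"
proof -
  let ?G = "\<lambda>z. exp (- (l * z)) * s z"
  have G: "?G holomorphic_on wedge c" by (intro holomorphic_intros s)
  obtain \<Phi> where \<Phi>: "\<And>z. z \<in> wedge c \<Longrightarrow> (\<Phi> has_field_derivative ?G z) (at z)"
    using holomorphic_convex_primitive'[OF wedge_convex wedge_open G]
    by (metis at_within_open wedge_open)
  have c: "c > 0" using q by linarith
  have seg: "of_real t * (1 + of_real x * (q - 1)) \<in> wedge c"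
    "cmod (of_real t * (1 + of_real x * (q - 1))) \<le> 2 * t"
    if "t > 0" "0 \<le> x" "x \<le> 1" for t x
  proof -
    have "x * \<bar>Im q\<bar> \<le> 1 * \<bar>Im q\<bar>" using that by (intro mult_right_mono) auto
    then have x: "x * \<bar>Im q\<bar> < c" "x * \<bar>Im q\<bar> \<le> 1" using q by linarith+
    then show "of_real t * (1 + of_real x * (q - 1)) \<in> wedge c"
      using that q by (auto simp: wedge_def abs_mult)
    have "cmod (1 + of_real x * (q - 1)) \<le> 1 + x * \<bar>Im q\<bar>"
      using cmod_le[of "1 + of_real x * (q - 1)"] that q by (simp add: abs_mult)
    then show "cmod (of_real t * (1 + of_real x * (q - 1))) \<le> 2 * t"
      using x that by (simp add: norm_mult)
  qed
  have on_ray: "of_real t * q \<in> wedge c" "of_real t \<in> wedge c"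
    "cmod (of_real t * q) \<le> 2 * t" "cmod (of_real t) \<le> 2 * t" if "t > 0" for t
    using seg[OF that, of 1] seg[OF that, of 0] by simp_all
  have Gs: "cmod (?G (of_real t * (1 + of_real x * (q - 1)))) \<le> C * exp (- t)"
    if t: "t > 0" and x: "0 \<le> x" "x \<le> 1" for t x
  proof -
    let ?z = "of_real t * (1 + of_real x * (q - 1))"
    have "(1 - x) * (2 * \<omega> + 1) + x * (2 * \<omega> + 1) \<le> (1 - x) * Re l + x * Re (l * q)"
      using l x by (intro add_mono mult_left_mono) auto
    then have "t * (2 * \<omega> + 1) \<le> t * ((1 - x) * Re l + x * Re (l * q))"
      using t by (intro mult_left_mono) (auto simp: algebra_simps)
    also have "\<dots> = Re (l * ?z)" by (simp add: algebra_simps)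
    finally have re: "t * (2 * \<omega> + 1) \<le> Re (l * ?z)" .
    have "cmod (?G ?z) \<le> exp (- Re (l * ?z)) * (C * exp (\<omega> * cmod ?z))"
      unfolding norm_mult[of "exp (- (l * ?z))"]
      by (intro mult_mono s(2)[OF seg(1)[OF that]]) auto
    also have "\<dots> \<le> exp (- (t * (2 * \<omega> + 1))) * (C * exp (\<omega> * (2 * t)))"
      using re seg(2)[OF that] \<omega> C by (intro mult_mono) (auto intro!: mult_left_mono)
    also have "\<dots> = C * exp (- t)" by (simp add: exp_add[symmetric] algebra_simps)
    finally show ?thesis .
  qed
  define D where "D t = \<Phi> (of_real t * q) - \<Phi> (of_real t)" for t
  have D: "cmod (D t) \<le> C * (t * exp (- t))" if t: "t > 0" for t
  proof -
    have "cmod (\<Phi> (of_real t * q) - \<Phi> (of_real t)) \<le> C * exp (- t) * cmod (of_real t * q - of_real t)"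
    proof (rule field_differentiable_bound[where S = "closed_segment (of_real t) (of_real t * q)"])
      fix z assume "z \<in> closed_segment (complex_of_real t) (of_real t * q)"
      then obtain x where x: "0 \<le> x" "x \<le> 1" "z = of_real t * (1 + of_real x * (q - 1))"
        by (auto simp: closed_segment_def scaleR_conv_of_real algebra_simps)
      show "(\<Phi> has_field_derivative ?G z) (at z within closed_segment (of_real t) (of_real t * q))"
        unfolding x(3) by (rule has_field_derivative_at_within[OF \<Phi>[OF seg(1)[OF t x(1,2)]]])
      show "cmod (?G z) \<le> C * exp (- t)" unfolding x(3) by (rule Gs[OF t x(1,2)])
    qed auto
    also have "cmod (of_real t * q - of_real t) = t * \<bar>Im q\<bar>"
    proof -
      have "of_real t * q - of_real t = \<i> * of_real (t * Im q)" using q by (simp add: complex_eq_iff)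
      then have "cmod (of_real t * q - of_real t) = \<bar>t * Im q\<bar>"
        by (simp only: norm_mult norm_ii norm_of_real mult_1)
      then show ?thesis using t by (simp add: abs_mult)
    qed
    also have "C * exp (- t) * (t * \<bar>Im q\<bar>) \<le> C * exp (- t) * (t * 1)"
      using t q C by (intro mult_left_mono) auto
    finally show ?thesis by (simp add: D_def mult_ac)
  qed
  have exps: "cmod (s (of_real t)) \<le> C * exp (2 * \<omega> * t)" "cmod (s (of_real t * q)) \<le> C * exp (2 * \<omega> * t)"
    if "t \<in> {0<..}" for t
  proof -
    have "C * exp (\<omega> * cmod z) \<le> C * exp (2 * \<omega> * t)" if "cmod z \<le> 2 * t" for z
      using mult_left_mono[OF that \<omega>] C by (intro mult_left_mono) (auto simp: mult_ac)
    note le = order_trans[OF s(2) this]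
    have "t > 0" using that by simp
    then show "cmod (s (of_real t)) \<le> C * exp (2 * \<omega> * t)" "cmod (s (of_real t * q)) \<le> C * exp (2 * \<omega> * t)"
      using on_ray[of t] by (blast intro: le)+
  qed
  have sc: "isCont (\<lambda>t. s (of_real t)) t" "isCont (\<lambda>t. s (of_real t * q)) t" if "t > 0" for t
  proof -
    have "isCont s z" if "z \<in> wedge c" for z
      using holomorphic_on_imp_continuous_on[OF s(1)] that
      by (simp add: continuous_on_eq_continuous_at[OF wedge_open])
    note at = this[OF on_ray(1)[OF that]] this[OF on_ray(2)[OF that]]
    show "isCont (\<lambda>t. s (of_real t)) t"
      by (rule isCont_o2[where g = s and f = of_real, OF _ at(2)]) (intro continuous_intros)
    show "isCont (\<lambda>t. s (of_real t * q)) t"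
      by (rule isCont_o2[where g = s and f = "\<lambda>t. of_real t * q", OF _ at(1)]) (intro continuous_intros)
  qed
  have meas: "set_borel_measurable lborel {0<..} (\<lambda>t. s (of_real t))"
    "set_borel_measurable lborel {0<..} (\<lambda>t. s (of_real t * q))"
    using sc by (auto intro!: set_borel_measurable_continuous_open continuous_at_imp_continuous_on)
  have int: "set_integrable lborel {0<..} (\<lambda>t. exp (- (l * of_real t)) * s (of_real t))"
    "set_integrable lborel {0<..} (\<lambda>t. exp (- (l * q * of_real t)) * s (of_real t * q))"
    using laplace_on_integrable[OF _ _ meas(1) exps(1) C, of l] laplace_on_integrable[OF _ _ meas(2) exps(2) C, of "l * q"] l
    by auto
  have "(LBINT t=ereal 0..\<infinity>. q * (exp (- (l * q * of_real t)) * s (of_real t * q)) - exp (- (l * of_real t)) * s (of_real t)) = 0 - 0"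
  proof (rule interval_integral_FTC_integrable[where F = D])
    fix t assume "ereal 0 < ereal t"
    then have t: "t > 0" by simp
    have "((\<lambda>z. \<Phi> (z * q)) has_field_derivative ?G (of_real t * q) * q) (at (of_real t))"
      by (rule DERIV_chain2[where f = \<Phi> and g = "\<lambda>z. z * q", OF \<Phi>[OF on_ray(1)[OF t]]])
        (auto intro!: derivative_eq_intros)
    from DERIV_diff[OF this \<Phi>[OF on_ray(2)[OF t]]]
    have "((\<lambda>t. \<Phi> (of_real t * q) - \<Phi> (of_real t)) has_vector_derivative ?G (of_real t * q) * q - ?G (of_real t)) (at t)"
      by (rule has_vector_derivative_real_field)
    then show "(D has_vector_derivative q * (exp (- (l * q * of_real t)) * s (of_real t * q)) - exp (- (l * of_real t)) * s (of_real t)) (at t)"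
      by (simp add: D_def[abs_def] mult_ac)
    show "isCont (\<lambda>t. q * (exp (- (l * q * of_real t)) * s (of_real t * q)) - exp (- (l * of_real t)) * s (of_real t)) t"
      using sc[OF t] by (intro continuous_intros)
  next
    show "set_integrable lborel (einterval (ereal 0) \<infinity>)
        (\<lambda>t. q * (exp (- (l * q * of_real t)) * s (of_real t * q)) - exp (- (l * of_real t)) * s (of_real t))"
      using set_integral_diff(1)[OF set_integrable_mult_right[OF int(2), of q] int(1)] by simp
    have "((\<lambda>t::real. C * (t * exp (- t))) \<longlongrightarrow> C * (0 * exp (- 0))) (at_right 0)"
      by (intro tendsto_intros)
    then have "((\<lambda>t::real. C * (t * exp (- t))) \<longlongrightarrow> 0) (at_right 0)" by simp
    then have "(D \<longlongrightarrow> 0) (at_right 0)"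
      by (rule Lim_null_comparison[OF eventually_at_rightI[of 0 1], rotated 2]) (auto intro: D)
    then show "((D \<circ> real_of_ereal) \<longlongrightarrow> 0) (at_right (ereal 0))" by (simp add: ereal_tendsto_simps)
    have "((\<lambda>t::real. C * (t ^ 1 / exp t)) \<longlongrightarrow> C * 0) at_top"
      by (intro tendsto_mult tendsto_const tendsto_power_div_exp_0)
    then have "((\<lambda>t::real. C * (t * exp (- t))) \<longlongrightarrow> 0) at_top"
      by (simp add: exp_minus divide_inverse)
    then have "(D \<longlongrightarrow> 0) at_top"
      by (rule Lim_null_comparison[OF eventually_mono[OF eventually_gt_at_top[of 0] D], rotated])
    then show "((D \<circ> real_of_ereal) \<longlongrightarrow> 0) (at_left \<infinity>)" by (simp add: ereal_tendsto_simps)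
  qed simp
  then have "(LINT t:{0<..}|lborel. q * (exp (- (l * q * of_real t)) * s (of_real t * q)) - exp (- (l * of_real t)) * s (of_real t)) = 0"
    by (simp add: interval_integral_to_infinity_eq)
  then show ?thesis
    unfolding set_integral_diff(2)[OF set_integrable_mult_right[OF int(2), of q] int(1)]
      set_integral_mult_right laplace_on_def by simp
qed

section \<open>A contour estimate with a vanishing kernel\<close>

lemma rectpath_sides:
  assumes f: "continuous_on (cbox p q) f" and le: "Re p \<le> Re q" "Im p \<le> Im q"
    and int: "(f has_contour_integral I) (rectpath p q)"
  shows "contour_integral (linepath p (Complex (Re q) (Im p))) f
    + contour_integral (linepath (Complex (Re q) (Im p)) q) f
    + contour_integral (linepath q (Complex (Re p) (Im q))) f
    + contour_integral (linepath (Complex (Re p) (Im q)) p) f = I"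
proof -
  have "f contour_integrable_on linepath a b" if "a \<in> cbox p q" "b \<in> cbox p q" for a b
    using f that
    by (intro contour_integrable_continuous_linepath)
      (meson closed_segment_subset continuous_on_subset convex_box(1))
  moreover have "p \<in> cbox p q" "q \<in> cbox p q" "Complex (Re q) (Im p) \<in> cbox p q" "Complex (Re p) (Im q) \<in> cbox p q"
    using le by (auto simp: in_cbox_complex_iff)
  ultimately have ci: "f contour_integrable_on linepath p (Complex (Re q) (Im p))"
    "f contour_integrable_on linepath (Complex (Re q) (Im p)) q"
    "f contour_integrable_on linepath q (Complex (Re p) (Im q))"
    "f contour_integrable_on linepath (Complex (Re p) (Im q)) p"
    by blast+
  have "contour_integral (rectpath p q) f = I" using int by (rule contour_integral_unique)
  then show ?thesis
    using ci unfolding rectpath_def Let_def by (simp add: contour_integrable_join add.assoc)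
qed

lemma rectangle_integral_zero:
  assumes f: "f holomorphic_on cbox p q" and le: "Re p \<le> Re q" "Im p \<le> Im q"
  shows "contour_integral (linepath p (Complex (Re q) (Im p))) f
    + contour_integral (linepath (Complex (Re q) (Im p)) q) f
    + contour_integral (linepath q (Complex (Re p) (Im q))) f
    + contour_integral (linepath (Complex (Re p) (Im q)) p) f = 0"
  by (rule rectpath_sides[OF holomorphic_on_imp_continuous_on[OF f] le],
      rule Cauchy_theorem_convex_simple[OF f])
    (use path_image_rectpath_subset_cbox[OF le] in auto)

text \<open>The first factor vanishes to order \<open>n\<close> at \<open>\<plusminus>\<i>r\<close>, where a contour passes from one side of the
  imaginary axis to the other. The second makes the integrals converge at infinity, and its pole at
  \<open>N\<close> picks out averages at the scale \<open>1 / N\<close>. Both are even, so that a transform and its reflection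
  can be treated alike.\<close>

definition cutoff_kernel :: "nat \<Rightarrow> real \<Rightarrow> real \<Rightarrow> complex \<Rightarrow> complex" where
  "cutoff_kernel n r N z = (1 + of_real (r\<^sup>2) / z\<^sup>2) ^ n * (of_real (N\<^sup>2) / (of_real (N\<^sup>2) - z\<^sup>2))"

lemma kernel_minus: "cutoff_kernel n r N (- z) = cutoff_kernel n r N z"
  by (simp add: cutoff_kernel_def)

lemma kernel_cnj: "cutoff_kernel n r N (cnj z) = cnj (cutoff_kernel n r N z)"
  by (simp add: cutoff_kernel_def)

lemma kernel_holomorphic:
  assumes "0 \<notin> S" "of_real N \<notin> S" "- of_real N \<notin> S"
  shows "cutoff_kernel n r N holomorphic_on S"
proof -
  have "of_real (N\<^sup>2) - z\<^sup>2 \<noteq> 0" if "z \<in> S" for z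
  proof
    assume "of_real (N\<^sup>2) - z\<^sup>2 = 0"
    then have "(of_real N - z) * (of_real N + z) = 0"
      by (simp add: power2_eq_square algebra_simps)
    then have "z = of_real N \<or> z = - of_real N"
      by (auto simp: eq_neg_iff_add_eq_0 add.commute)
    then show False using that assms by auto
  qed
  moreover have "z \<noteq> 0" if "z \<in> S" for z using that assms by auto
  ultimately show ?thesis unfolding cutoff_kernel_def by (intro holomorphic_intros) auto
qed

lemma cutoff_factor_bound:
  assumes "r > 0" "r \<le> cmod z"
  shows "cmod (1 + of_real (r\<^sup>2) / z\<^sup>2) \<le> 2"
proof -
  have "r\<^sup>2 \<le> (cmod z)\<^sup>2" using assms by (intro power_mono) auto
  moreover have "0 < (cmod z)\<^sup>2" using assms by auto
  ultimately have "cmod (of_real (r\<^sup>2) / z\<^sup>2) \<le> 1"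
    by (simp add: norm_divide norm_power del: zero_less_power2)
  then show ?thesis using norm_triangle_ineq[of 1 "of_real (r\<^sup>2) / z\<^sup>2"] by simp
qed

text \<open>On the horizontal lines through \<open>\<plusminus>\<i>r\<close> the factor vanishes linearly at the imaginary axis. To the
  right this compensates the factor \<open>1 / Re z\<close> in the bound of a Laplace transform, to the left it is
  played against the decay of \<open>e\<^sup>t\<^sup>z\<close>.\<close>

lemma cutoff_factor_near_corner:
  assumes r: "r > 0" and z: "\<bar>Im z\<bar> = r" "\<bar>Re z\<bar> \<le> r"
  shows "cmod (1 + of_real (r\<^sup>2) / z\<^sup>2) \<le> 3 * \<bar>Re z\<bar> / r"
proof -
  have z0: "z \<noteq> 0" using z r by auto
  have im: "(Im z)\<^sup>2 = r\<^sup>2" using z(1) by (metis power2_abs)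
  have "z\<^sup>2 + of_real (r\<^sup>2) = of_real (Re z) * (of_real (Re z) + 2 * \<i> * of_real (Im z))"
    using im by (simp add: complex_eq_iff power2_eq_square algebra_simps)
  moreover have "cmod (of_real (Re z) + 2 * \<i> * of_real (Im z)) \<le> \<bar>Re z\<bar> + 2 * \<bar>Im z\<bar>"
    using norm_triangle_ineq[of "of_real (Re z)" "2 * \<i> * of_real (Im z)"] by (simp add: norm_mult)
  ultimately have num: "cmod (z\<^sup>2 + of_real (r\<^sup>2)) \<le> \<bar>Re z\<bar> * (3 * r)"
    using z by (simp add: norm_mult) (intro mult_left_mono, auto)
  have den: "r\<^sup>2 \<le> (cmod z)\<^sup>2" using im by (simp add: cmod_power2)
  have "1 + of_real (r\<^sup>2) / z\<^sup>2 = (z\<^sup>2 + of_real (r\<^sup>2)) / z\<^sup>2" using z0 by (simp add: field_simps)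
  then have "cmod (1 + of_real (r\<^sup>2) / z\<^sup>2) = cmod (z\<^sup>2 + of_real (r\<^sup>2)) / (cmod z)\<^sup>2"
    by (simp only: norm_divide norm_power)
  also have "\<dots> \<le> \<bar>Re z\<bar> * (3 * r) / r\<^sup>2"
    using num den r by (intro frac_le) auto
  also have "\<dots> = 3 * \<bar>Re z\<bar> / r" using r by (simp add: power2_eq_square)
  finally show ?thesis .
qed

lemma regulator_bound_small:
  fixes N :: real
  assumes "N \<ge> 2" "(cmod z)\<^sup>2 \<le> 2"
  shows "cmod (of_real (N\<^sup>2) / (of_real (N\<^sup>2) - z\<^sup>2)) \<le> 2"
proof -
  have N: "N\<^sup>2 \<ge> 2\<^sup>2" using assms by (intro power_mono) auto
  have "N\<^sup>2 - (cmod z)\<^sup>2 \<le> cmod (of_real (N\<^sup>2) - z\<^sup>2)"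
    using norm_triangle_ineq2[of "of_real (N\<^sup>2)" "z\<^sup>2"] by (simp add: norm_power)
  then have "N\<^sup>2 / 2 \<le> cmod (of_real (N\<^sup>2) - z\<^sup>2)" using N assms(2) by simp
  then have "N\<^sup>2 / cmod (of_real (N\<^sup>2) - z\<^sup>2) \<le> N\<^sup>2 / (N\<^sup>2 / 2)"
    using N by (intro divide_left_mono mult_pos_pos) auto
  then show ?thesis using assms by (simp add: norm_divide norm_power)
qed

lemma kernel_far:
  assumes "r > 0" "r \<le> Y" "N > 0" "N < Y" "Y \<le> cmod z"
  shows "cmod (cutoff_kernel n r N z) \<le> 2 ^ n * (N\<^sup>2 / (Y\<^sup>2 - N\<^sup>2))"
proof -
  have Y: "N\<^sup>2 < Y\<^sup>2" using assms by (intro power_strict_mono) auto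
  have Yz: "Y\<^sup>2 \<le> (cmod z)\<^sup>2" using assms by (intro power_mono) auto
  have "Y\<^sup>2 - N\<^sup>2 \<le> cmod (of_real (N\<^sup>2) - z\<^sup>2)"
    using norm_triangle_ineq2[of "z\<^sup>2" "of_real (N\<^sup>2)"] Yz by (simp add: norm_power norm_minus_commute)
  then have "cmod (of_real (N\<^sup>2) / (of_real (N\<^sup>2) - z\<^sup>2)) \<le> N\<^sup>2 / (Y\<^sup>2 - N\<^sup>2)"
    unfolding norm_divide using Y by (intro frac_le) (auto simp: norm_power)
  then show ?thesis
    unfolding cutoff_kernel_def norm_mult norm_power
    using assms by (intro mult_mono power_mono cutoff_factor_bound) auto
qed

text \<open>The far sides of the contours have length proportional to \<open>Y\<close>, and the kernel decays on them like
  \<open>1 / Y\<^sup>2\<close>.\<close>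

lemma far_error_tendsto:
  fixes B N :: real
  shows "((\<lambda>Y. Y * (B * (N\<^sup>2 / (Y\<^sup>2 - N\<^sup>2)))) \<longlongrightarrow> 0) at_top"
proof -
  have sq: "filterlim (\<lambda>Y::real. Y\<^sup>2) at_top at_top"
    by (rule filterlim_pow_at_top[OF _ filterlim_ident]) simp
  have "((\<lambda>Y::real. N\<^sup>2 / Y\<^sup>2) \<longlongrightarrow> 0) at_top"
    by (rule tendsto_divide_0[OF tendsto_const]) (rule filterlim_at_top_imp_at_infinity[OF sq])
  moreover have "((\<lambda>Y::real. B * N\<^sup>2 / Y) \<longlongrightarrow> 0) at_top"
    by (rule tendsto_divide_0[OF tendsto_const]) (rule filterlim_at_top_imp_at_infinity[OF filterlim_ident])
  ultimately have "((\<lambda>Y. B * N\<^sup>2 / Y / (1 - N\<^sup>2 / Y\<^sup>2)) \<longlongrightarrow> 0 / (1 - 0)) at_top"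
    by (intro tendsto_intros) auto
  moreover have "\<forall>\<^sub>F Y in at_top. B * N\<^sup>2 / Y / (1 - N\<^sup>2 / Y\<^sup>2) = Y * (B * (N\<^sup>2 / (Y\<^sup>2 - N\<^sup>2)))"
    using eventually_gt_at_top[of "max 0 \<bar>N\<bar>"]
  proof eventually_elim
    case (elim Y)
    then have "N\<^sup>2 < Y\<^sup>2" using abs_le_square_iff[of Y N] by auto
    then show ?case using elim by (simp add: divide_simps) (simp add: power2_eq_square)
  qed
  ultimately show ?thesis by (simp add: Lim_transform_eventually)
qed

text \<open>The integral over the part of the imaginary axis between the distances \<open>r\<close> and \<open>Y\<close> from the
  origin, upwards, divided by \<open>\<i>\<close>. As a real integral it is visibly invariant under reflection.\<close>

definition axis_integral :: "real \<Rightarrow> real \<Rightarrow> (complex \<Rightarrow> complex) \<Rightarrow> complex" where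
  "axis_integral r Y H = integral {r..Y} (\<lambda>y. H (Complex 0 y) + H (Complex 0 (- y)))"

lemma axis_integral_contours:
  assumes rY: "r < Y" and H: "continuous_on {z. Re z = 0 \<and> r \<le> \<bar>Im z\<bar>} H" and r: "r > 0"
  shows "\<i> * axis_integral r Y H = contour_integral (linepath (Complex 0 r) (Complex 0 Y)) H
    + contour_integral (linepath (Complex 0 (- Y)) (Complex 0 (- r))) H"
proof -
  have c: "continuous_on {r..Y} (\<lambda>y. H (Complex 0 y))" "continuous_on {r..Y} (\<lambda>y. H (Complex 0 (- y)))"
    using r by (auto intro!: continuous_on_compose2[OF H] continuous_intros simp: Complex_eq)
  have "integral {- Y..- r} (\<lambda>y. H (Complex 0 y)) = integral {r..Y} (\<lambda>y. H (Complex 0 (- y)))"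
    using Henstock_Kurzweil_Integration.integral_reflect_real[of Y r "\<lambda>y. H (Complex 0 (- y))"] by simp
  then show ?thesis
    using rY c unfolding axis_integral_def
    by (subst integral_add)
      (auto simp: contour_integral_linepath_same_Re[where c = 0] algebra_simps
        intro: integrable_continuous_real)
qed

lemma axis_integral_linear:
  assumes r: "r > 0" and "continuous_on {z. Re z = 0 \<and> r \<le> \<bar>Im z\<bar>} G"
    "continuous_on {z. Re z = 0 \<and> r \<le> \<bar>Im z\<bar>} H"
  shows "axis_integral r Y (\<lambda>z. G z + H z) = axis_integral r Y G + axis_integral r Y H"
proof -
  have c: "continuous_on {r..Y} (\<lambda>y. F (Complex 0 y))" "continuous_on {r..Y} (\<lambda>y. F (Complex 0 (- y)))"
    if "continuous_on {z. Re z = 0 \<and> r \<le> \<bar>Im z\<bar>} F" for F :: "complex \<Rightarrow> complex"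
    using r by (auto intro!: continuous_on_compose2[OF that] continuous_intros simp: Complex_eq)
  show ?thesis
    unfolding axis_integral_def
    by (subst integral_add[symmetric])
      (use c[OF assms(2)] c[OF assms(3)] in
        \<open>auto intro!: integrable_continuous_real continuous_intros integral_cong simp: algebra_simps\<close>)
qed

lemma axis_integral_minus: "axis_integral r Y (\<lambda>z. H (- z)) = axis_integral r Y H"
  unfolding axis_integral_def by (intro integral_cong) (simp add: Complex_eq add.commute)

text \<open>One of the \<open>n\<close> zeros of the kernel at \<open>\<plusminus>\<i>r\<close> is used up by the factor \<open>1 / Re z\<close>. The bound does
  not involve \<open>r\<close>, because \<open>\<bar>z\<bar>\<close> is comparable to \<open>r\<close> on these three sides.\<close>

lemma bump_bound:
  assumes r: "0 < r" "r \<le> 1" and N: "N \<ge> 2" and n: "n \<ge> 1" and M: "M \<ge> 0"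
    and g: "0 < Re z \<Longrightarrow> cmod (g z) \<le> 3 * M * cmod z / Re z"
    and z: "0 \<le> Re z" "Re z \<le> r" "\<bar>Im z\<bar> = r \<or> Re z = r \<and> \<bar>Im z\<bar> \<le> r"
  shows "cmod (g z * cutoff_kernel n r N z) \<le> 18 * M * 2 ^ n"
proof -
  let ?k = "1 + of_real (r\<^sup>2) / z\<^sup>2" and ?\<rho> = "of_real (N\<^sup>2) / (of_real (N\<^sup>2) - z\<^sup>2)"
  have zr: "r \<le> cmod z" using z abs_Im_le_cmod[of z] abs_Re_le_cmod[of z] by auto
  have k: "cmod ?k \<le> 2" by (rule cutoff_factor_bound[OF r(1) zr])
  have "cmod z \<le> \<bar>Re z\<bar> + \<bar>Im z\<bar>" by (rule cmod_le)
  then have z2: "cmod z \<le> 2 * r" using z by auto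
  have "(cmod z)\<^sup>2 \<le> r\<^sup>2 + r\<^sup>2"
    unfolding cmod_power2 using z r by (intro add_mono) (auto simp: abs_le_square_iff[symmetric])
  moreover have "r\<^sup>2 \<le> 1" using r by (simp add: power_le_one)
  ultimately have \<rho>: "cmod ?\<rho> \<le> 2" by (intro regulator_bound_small N) auto
  have gk: "cmod (g z) * cmod ?k \<le> 18 * M"
  proof (cases "Re z = 0")
    case True
    then have "\<bar>Im z\<bar> = r" using z r by auto
    then show ?thesis using cutoff_factor_near_corner[OF r(1), of z] True r M by simp
  next
    case False
    then have pos: "0 < Re z" using z by simp
    show ?thesis
    proof (cases "\<bar>Im z\<bar> = r")
      case True
      have "cmod (g z) * cmod ?k \<le> (3 * M * (2 * r) / Re z) * (3 * Re z / r)"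
        using cutoff_factor_near_corner[OF r(1) True] z pos r M z2
        by (intro mult_mono order_trans[OF g[OF pos]] divide_right_mono mult_left_mono) auto
      also have "\<dots> = 18 * M" using pos r by simp
      finally show ?thesis .
    next
      case False
      then have "Re z = r" using z by auto
      have "3 * M * cmod z / Re z \<le> 3 * M * (2 * r) / r"
        unfolding \<open>Re z = r\<close> using r M z2 by (intro divide_right_mono mult_left_mono) auto
      then have "cmod (g z) * cmod ?k \<le> (3 * M * (2 * r) / r) * 2"
        using r M k by (intro mult_mono order_trans[OF g[OF pos]]) auto
      also have "\<dots> \<le> 18 * M" using r M by simp
      finally show ?thesis .
    qed
  qed
  obtain j where j: "n = Suc j" using n by (cases n) auto
  have "cmod (g z * cutoff_kernel n r N z) = (cmod (g z) * cmod ?k) * (cmod ?k ^ j * cmod ?\<rho>)"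
    unfolding cutoff_kernel_def norm_mult norm_power j power_Suc by (simp only: mult_ac)
  also have "\<dots> \<le> (18 * M) * (2 ^ j * 2)"
  proof (rule mult_mono[OF gk])
    show "cmod ?k ^ j * cmod ?\<rho> \<le> 2 ^ j * 2"
      using k \<rho> by (intro mult_mono power_mono) auto
  qed (use M in auto)
  finally show ?thesis by (simp add: j mult_ac)
qed

text \<open>The axis from \<open>-\<i>Y\<close> to \<open>\<i>Y\<close>, with the part below height \<open>r\<close> replaced by three sides of a rectangle
  in the right half-plane, is closed by a large rectangle. Cauchy's theorem is applied to the
  pieces above \<open>r\<close>, below \<open>-r\<close> and between, and the middle piece contains the pole \<open>N\<close>. What
  remains is the residue, the detour of length \<open>4 r\<close> round the origin, and the far sides.\<close>

lemma right_half_plane_contour: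
  assumes r: "0 < r" "r \<le> 1" and N: "N \<ge> 2" and n: "n \<ge> 1" and M: "M \<ge> 0" and B: "B \<ge> 0"
    and hol: "g holomorphic_on {z. 0 < Re z \<or> 0 \<le> Re z \<and> r \<le> \<bar>Im z\<bar>}"
    and g: "\<And>z. 0 < Re z \<Longrightarrow> cmod (g z) \<le> 3 * M * cmod z / Re z"
    and gB: "\<And>z. 0 \<le> Re z \<Longrightarrow> r \<le> \<bar>Im z\<bar> \<Longrightarrow> cmod (g z) \<le> B"
    and Y: "N < Y"
  shows "cmod (axis_integral r Y (\<lambda>z. g z * cutoff_kernel n r N z)
      - of_real pi * of_real N * g (of_real N) * (1 + of_real (r\<^sup>2) / of_real (N\<^sup>2)) ^ n)
    \<le> 72 * M * 2 ^ n * r + 4 * (Y * ((B + 6 * M) * 2 ^ n * (N\<^sup>2 / (Y\<^sup>2 - N\<^sup>2))))"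
proof -
  define H where "H z = g z * cutoff_kernel n r N z" for z
  define L where "L a b = contour_integral (linepath a b) H" for a b
  let ?D = "{z. 0 < Re z \<or> 0 \<le> Re z \<and> r \<le> \<bar>Im z\<bar>}"
  have rY: "r < Y" "0 < Y" "r < N" using r N Y by auto
  have holD: "H holomorphic_on S" if "S \<subseteq> ?D" "of_real N \<notin> S" for S
    unfolding H_def using that N r
    by (intro holomorphic_intros holomorphic_on_subset[OF hol] kernel_holomorphic) auto
  have cont: "continuous_on S H" if "S \<subseteq> ?D" "of_real N \<notin> S" for S
    using holD[OF that] by (rule holomorphic_on_imp_continuous_on)
  have upper: "L (Complex 0 r) (Complex Y r) + L (Complex Y r) (Complex Y Y)
      + L (Complex Y Y) (Complex 0 Y) + L (Complex 0 Y) (Complex 0 r) = 0"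
    unfolding L_def using rectangle_integral_zero[of H "Complex 0 r" "Complex Y Y"] rY r
    by (fastforce intro!: holD simp: in_cbox_complex_iff)
  have lower: "L (Complex 0 (- Y)) (Complex Y (- Y)) + L (Complex Y (- Y)) (Complex Y (- r))
      + L (Complex Y (- r)) (Complex 0 (- r)) + L (Complex 0 (- r)) (Complex 0 (- Y)) = 0"
    unfolding L_def using rectangle_integral_zero[of H "Complex 0 (- Y)" "Complex Y (- r)"] rY r
    by (fastforce intro!: holD simp: in_cbox_complex_iff)
  \<comment> \<open>The middle rectangle contains the pole \<open>N\<close> of the second factor.\<close>
  define G where "G z = - (g z * (1 + of_real (r\<^sup>2) / z\<^sup>2) ^ n * (of_real (N\<^sup>2) / (of_real N + z)))" for z
  have HG: "H z = G z / (z - of_real N)" if "z \<noteq> of_real N" "z \<noteq> - of_real N" for z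
  proof -
    have "of_real (N\<^sup>2) - z\<^sup>2 = - ((of_real N + z) * (z - of_real N))"
      by (simp add: power2_eq_square algebra_simps)
    then show ?thesis by (simp add: H_def cutoff_kernel_def G_def)
  qed
  let ?p = "Complex r (- r)" and ?q = "Complex Y r"
  have boxD: "cbox ?p ?q \<subseteq> {z. 0 < Re z}" using r by (auto simp: in_cbox_complex_iff)
  have NZ: "z \<noteq> 0" "of_real N + z \<noteq> 0" if "0 < Re z" for z
  proof -
    show "z \<noteq> 0" using that by auto
    have "Re (of_real N + z) > 0" using that N by simp
    then show "of_real N + z \<noteq> 0" by (metis less_irrefl zero_complex.sel(1))
  qed
  have Ghol: "G holomorphic_on cbox ?p ?q"
    unfolding G_def using boxD NZ
    by (intro holomorphic_intros holomorphic_on_subset[OF hol]) auto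
  have Nbox: "of_real N \<in> box ?p ?q" using r N Y rY by (auto simp: in_box_complex_iff)
  have pathN: "path_image (rectpath ?p ?q) \<subseteq> cbox ?p ?q - {of_real N}"
    using path_image_rectpath_cbox_minus_box[of ?p ?q] Nbox rY r by auto
  have "((\<lambda>w. G w / (w - of_real N)) has_contour_integral
      2 * pi * \<i> * winding_number (rectpath ?p ?q) (of_real N) * G (of_real N)) (rectpath ?p ?q)"
    using Nbox pathN
    by (intro Cauchy_integral_formula_convex_simple[OF _ Ghol]) (auto simp: interior_cbox)
  then have Gint: "((\<lambda>w. G w / (w - of_real N)) has_contour_integral 2 * pi * \<i> * G (of_real N)) (rectpath ?p ?q)"
    by (simp add: winding_number_rectpath[OF Nbox])
  have Hint: "(H has_contour_integral 2 * pi * \<i> * G (of_real N)) (rectpath ?p ?q)"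
  proof (rule has_contour_integral_eq[OF Gint])
    fix w assume "w \<in> path_image (rectpath ?p ?q)"
    then have w: "w \<noteq> of_real N" "0 < Re w" using pathN boxD by auto
    then have "w \<noteq> - of_real N" using N by auto
    then show "G w / (w - of_real N) = H w" using HG w by simp
  qed
  have H_side: "continuous_on (closed_segment a b) H"
    if "a \<in> ?D" "b \<in> ?D" "Re a = Re b \<and> Re a \<noteq> N \<and> (r \<le> Re a \<or> 0 \<le> Im a * Im b) \<or> Im a = Im b \<and> \<bar>Im a\<bar> \<ge> r" for a b
    using that r N
    by (intro cont) (auto simp: closed_segment_same_Re closed_segment_same_Im closed_segment_eq_real_ivl
        mult_le_0_iff zero_le_mult_iff split: if_splits)
  have ci: "H contour_integrable_on linepath a b" if "continuous_on (closed_segment a b) H" for a b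
    using that by (rule contour_integrable_continuous_linepath)
  have middle: "L ?p (Complex Y (- r)) + L (Complex Y (- r)) ?q + L ?q (Complex r r) + L (Complex r r) ?p
      = 2 * pi * \<i> * G (of_real N)"
  proof -
    have "contour_integral (rectpath ?p ?q) H = 2 * pi * \<i> * G (of_real N)"
      using Hint by (rule contour_integral_unique)
    moreover have "H contour_integrable_on linepath ?p (Complex Y (- r))"
      "H contour_integrable_on linepath (Complex Y (- r)) ?q"
      "H contour_integrable_on linepath ?q (Complex r r)"
      "H contour_integrable_on linepath (Complex r r) ?p"
      using r rY Y by (auto intro!: ci H_side)
    ultimately show ?thesis
      unfolding rectpath_def Let_def L_def by (simp add: contour_integrable_join add.assoc)
  qed
  have split_up: "L (Complex 0 r) (Complex Y r) = L (Complex 0 r) (Complex r r) + L (Complex r r) (Complex Y r)"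
    unfolding L_def using r rY
    by (intro contour_integral_split_linepath H_side) (auto simp: closed_segment_same_Im closed_segment_eq_real_ivl)
  have split_low: "L (Complex Y (- r)) (Complex 0 (- r)) = L (Complex Y (- r)) (Complex r (- r)) + L (Complex r (- r)) (Complex 0 (- r))"
    unfolding L_def using r rY
    by (intro contour_integral_split_linepath H_side) (auto simp: closed_segment_same_Im closed_segment_eq_real_ivl)
  have rev: "L (Complex r r) (Complex Y r) = - L (Complex Y r) (Complex r r)"
    "L (Complex Y (- r)) (Complex r (- r)) = - L (Complex r (- r)) (Complex Y (- r))"
    "L (Complex 0 Y) (Complex 0 r) = - L (Complex 0 r) (Complex 0 Y)"
    "L (Complex 0 (- r)) (Complex 0 (- Y)) = - L (Complex 0 (- Y)) (Complex 0 (- r))"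
    unfolding L_def using r rY N
    by (auto intro!: contour_integral_reverse_linepath H_side)
  define bump where "bump = L (Complex 0 r) (Complex r r) + L (Complex r r) (Complex r (- r)) + L (Complex r (- r)) (Complex 0 (- r))"
  define far where "far = L (Complex Y (- r)) (Complex Y r) + L (Complex Y r) (Complex Y Y) + L (Complex Y Y) (Complex 0 Y)
    + L (Complex 0 (- Y)) (Complex Y (- Y)) + L (Complex Y (- Y)) (Complex Y (- r))"
  have axis: "\<i> * axis_integral r Y H = L (Complex 0 r) (Complex 0 Y) + L (Complex 0 (- Y)) (Complex 0 (- r))"
    unfolding L_def using r rY N by (intro axis_integral_contours cont) auto
  have "bump + far - \<i> * axis_integral r Y H =
      (L (Complex 0 r) (Complex Y r) + L (Complex Y r) (Complex Y Y)
        + L (Complex Y Y) (Complex 0 Y) + L (Complex 0 Y) (Complex 0 r))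
      + (L (Complex 0 (- Y)) (Complex Y (- Y)) + L (Complex Y (- Y)) (Complex Y (- r))
        + L (Complex Y (- r)) (Complex 0 (- r)) + L (Complex 0 (- r)) (Complex 0 (- Y)))
      + (L ?p (Complex Y (- r)) + L (Complex Y (- r)) ?q + L ?q (Complex r r) + L (Complex r r) ?p)"
    unfolding axis split_up split_low rev bump_def far_def by (simp only: algebra_simps) simp
  then have total: "\<i> * axis_integral r Y H + 2 * pi * \<i> * G (of_real N) = bump + far"
    unfolding upper lower middle by (simp add: algebra_simps)
  have GN: "2 * G (of_real N) = - (of_real N * g (of_real N) * (1 + of_real (r\<^sup>2) / of_real (N\<^sup>2)) ^ n)"
    using N by (simp add: G_def power2_eq_square)
  have L_le: "cmod (L a b) \<le> K * cmod (b - a)"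
    if "continuous_on (closed_segment a b) H" "K \<ge> 0" "\<And>z. z \<in> closed_segment a b \<Longrightarrow> cmod (H z) \<le> K" for a b K
    unfolding L_def using ci[OF that(1)] that(2,3) by (rule contour_integral_bound_linepath)
  have bump_pt: "cmod (H z) \<le> 18 * M * 2 ^ n"
    if "0 \<le> Re z" "Re z \<le> r" "\<bar>Im z\<bar> = r \<or> Re z = r \<and> \<bar>Im z\<bar> \<le> r" for z
    unfolding H_def by (rule bump_bound[OF r N n M _ that]) (rule g)
  have "cmod (L (Complex 0 r) (Complex r r)) \<le> 18 * M * 2 ^ n * cmod (Complex r r - Complex 0 r)"
    "cmod (L (Complex r r) (Complex r (- r))) \<le> 18 * M * 2 ^ n * cmod (Complex r (- r) - Complex r r)"
    "cmod (L (Complex r (- r)) (Complex 0 (- r))) \<le> 18 * M * 2 ^ n * cmod (Complex 0 (- r) - Complex r (- r))"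
    using r rY N M
    by (auto intro!: L_le H_side bump_pt simp: closed_segment_same_Re closed_segment_same_Im closed_segment_eq_real_ivl)
  moreover have "Complex r r - Complex 0 r = of_real r" "Complex r (- r) - Complex r r = \<i> * of_real (- (2 * r))"
    "Complex 0 (- r) - Complex r (- r) = of_real (- r)"
    by (simp_all add: complex_eq_iff)
  ultimately have bumps: "cmod (L (Complex 0 r) (Complex r r)) \<le> 18 * M * 2 ^ n * r"
    "cmod (L (Complex r r) (Complex r (- r))) \<le> 18 * M * 2 ^ n * (2 * r)"
    "cmod (L (Complex r (- r)) (Complex 0 (- r))) \<le> 18 * M * 2 ^ n * r"
    using r by (simp_all add: norm_mult)
  have "cmod bump \<le> 18 * M * 2 ^ n * r + 18 * M * 2 ^ n * (2 * r) + 18 * M * 2 ^ n * r"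
    unfolding bump_def by (intro order_trans[OF norm_triangle_ineq] add_mono bumps)
  then have bump_le: "cmod bump \<le> 72 * M * 2 ^ n * r" by (simp add: mult_ac)
  define \<delta> where "\<delta> = (B + 6 * M) * 2 ^ n * (N\<^sup>2 / (Y\<^sup>2 - N\<^sup>2))"
  have YN: "N\<^sup>2 < Y\<^sup>2" using N Y by (intro power_strict_mono) auto
  have \<delta>: "\<delta> \<ge> 0" unfolding \<delta>_def using B M YN by simp
  have far_pt: "cmod (H z) \<le> \<delta>" if z: "Re z = Y \<and> \<bar>Im z\<bar> \<le> Y \<or> \<bar>Im z\<bar> = Y \<and> 0 \<le> Re z" for z
  proof -
    have "Y \<le> cmod z" using z abs_Re_le_cmod[of z] abs_Im_le_cmod[of z] by auto
    then have k: "cmod (cutoff_kernel n r N z) \<le> 2 ^ n * (N\<^sup>2 / (Y\<^sup>2 - N\<^sup>2))"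
      using r N Y rY by (intro kernel_far) auto
    have "cmod (g z) \<le> B + 6 * M"
    proof (cases "\<bar>Im z\<bar> = Y \<and> 0 \<le> Re z")
      case True
      then show ?thesis using gB[of z] rY M by auto
    next
      case False
      then have z': "Re z = Y" "\<bar>Im z\<bar> \<le> Y" using z by auto
      then have "cmod z \<le> 2 * Y" using cmod_le[of z] rY by simp
      then have "3 * M * cmod z / Re z \<le> 3 * M * (2 * Y) / Y"
        using M z' rY by (intro frac_le mult_left_mono) auto
      then show ?thesis using g[of z] z' rY B by simp
    qed
    then show ?thesis
      unfolding H_def norm_mult \<delta>_def mult.assoc using k B M by (intro mult_mono) auto
  qed
  have "cmod (L (Complex Y (- r)) (Complex Y r)) \<le> \<delta> * cmod (Complex Y r - Complex Y (- r))"
    "cmod (L (Complex Y r) (Complex Y Y)) \<le> \<delta> * cmod (Complex Y Y - Complex Y r)"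
    "cmod (L (Complex Y Y) (Complex 0 Y)) \<le> \<delta> * cmod (Complex 0 Y - Complex Y Y)"
    "cmod (L (Complex 0 (- Y)) (Complex Y (- Y))) \<le> \<delta> * cmod (Complex Y (- Y) - Complex 0 (- Y))"
    "cmod (L (Complex Y (- Y)) (Complex Y (- r))) \<le> \<delta> * cmod (Complex Y (- r) - Complex Y (- Y))"
    using r rY N Y \<delta>
    by (auto intro!: L_le H_side far_pt simp: closed_segment_same_Re closed_segment_same_Im closed_segment_eq_real_ivl)
  moreover have "Complex Y r - Complex Y (- r) = \<i> * of_real (2 * r)" "Complex Y Y - Complex Y r = \<i> * of_real (Y - r)"
    "Complex 0 Y - Complex Y Y = of_real (- Y)" "Complex Y (- Y) - Complex 0 (- Y) = of_real Y"
    "Complex Y (- r) - Complex Y (- Y) = \<i> * of_real (Y - r)"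
    by (simp_all add: complex_eq_iff)
  ultimately have fars: "cmod (L (Complex Y (- r)) (Complex Y r)) \<le> \<delta> * (2 * r)"
    "cmod (L (Complex Y r) (Complex Y Y)) \<le> \<delta> * (Y - r)"
    "cmod (L (Complex Y Y) (Complex 0 Y)) \<le> \<delta> * Y"
    "cmod (L (Complex 0 (- Y)) (Complex Y (- Y))) \<le> \<delta> * Y"
    "cmod (L (Complex Y (- Y)) (Complex Y (- r))) \<le> \<delta> * (Y - r)"
    using r rY by (simp_all add: norm_mult del: of_real_diff)
  have "cmod far \<le> \<delta> * (2 * r) + \<delta> * (Y - r) + \<delta> * Y + \<delta> * Y + \<delta> * (Y - r)"
    unfolding far_def by (intro order_trans[OF norm_triangle_ineq] add_mono fars)
  then have far_le: "cmod far \<le> 4 * (Y * \<delta>)" by (simp add: algebra_simps)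
  have "\<i> * (axis_integral r Y H - of_real pi * of_real N * g (of_real N) * (1 + of_real (r\<^sup>2) / of_real (N\<^sup>2)) ^ n)
      = \<i> * axis_integral r Y H + of_real pi * \<i> * (2 * G (of_real N))"
    unfolding GN by (simp add: algebra_simps)
  also have "\<dots> = bump + far" using total by (simp add: mult_ac)
  finally have "cmod (axis_integral r Y H - of_real pi * of_real N * g (of_real N) * (1 + of_real (r\<^sup>2) / of_real (N\<^sup>2)) ^ n)
      = cmod (bump + far)"
    by (metis norm_mult norm_ii mult_1)
  also have "\<dots> \<le> 72 * M * 2 ^ n * r + 4 * (Y * \<delta>)"
    by (intro order_trans[OF norm_triangle_ineq] add_mono bump_le far_le)
  finally show ?thesis unfolding H_def[abs_def] \<delta>_def .
qed

text \<open>A single term of the exponential series. It converts a zero of order \<open>n\<close> into the factor \<open>t\<^sup>-\<^sup>n\<close>,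
  and makes exponential decay beat any power.\<close>

lemma power_le_fact_exp:
  fixes x :: real
  assumes "x \<ge> 0"
  shows "x ^ n \<le> fact n * exp x"
proof -
  have "(\<Sum>k<Suc n. x ^ k /\<^sub>R fact k) \<le> exp x"
    unfolding exp_def using assms by (intro sum_le_suminf summable_exp_generic) auto
  moreover have "x ^ n /\<^sub>R fact n \<le> (\<Sum>k<Suc n. x ^ k /\<^sub>R fact k)"
    using assms by (intro member_le_sum) auto
  ultimately have "x ^ n /\<^sub>R fact n \<le> exp x" by linarith
  then show ?thesis by (simp add: field_simps)
qed

text \<open>The size of the kernel times \<open>1 / y\<close> on a vertical line. The logarithm allows \<open>N\<close> to grow
  exponentially.\<close>

lemma log_integral_bound:
  fixes r N Y :: real
  assumes "0 < r" "r < Y" "N > 0"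
  shows "(\<lambda>y. 2 * N\<^sup>2 / (y * (N\<^sup>2 + y\<^sup>2))) integrable_on {r..Y}"
    and "integral {r..Y} (\<lambda>y. 2 * N\<^sup>2 / (y * (N\<^sup>2 + y\<^sup>2))) \<le> ln (1 + N\<^sup>2 / r\<^sup>2)"
proof -
  have "((\<lambda>y. - ln (1 + N\<^sup>2 / y\<^sup>2)) has_vector_derivative 2 * N\<^sup>2 / (y * (N\<^sup>2 + y\<^sup>2))) (at y within {r..Y})"
    if "y \<in> {r..Y}" for y
  proof -
    have y: "y > 0" using that assms by auto
    have p: "1 + N\<^sup>2 / y\<^sup>2 > 0" by (rule add_pos_nonneg) auto
    have "((\<lambda>y. - ln (1 + N\<^sup>2 / y\<^sup>2)) has_real_derivative
        - ((1 / (1 + N\<^sup>2 / y\<^sup>2)) * - (N\<^sup>2 * (2 * y) / (y\<^sup>2 * y\<^sup>2)))) (at y)"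
      using y p by (auto intro!: derivative_eq_intros)
    also have "- ((1 / (1 + N\<^sup>2 / y\<^sup>2)) * - (N\<^sup>2 * (2 * y) / (y\<^sup>2 * y\<^sup>2))) = 2 * N\<^sup>2 / (y * (N\<^sup>2 + y\<^sup>2))"
    proof -
      have "1 + N\<^sup>2 / y\<^sup>2 = (N\<^sup>2 + y\<^sup>2) / y\<^sup>2" using y by (simp add: field_simps)
      then show ?thesis using y by (simp add: power2_eq_square mult_ac)
    qed
    finally show ?thesis
      by (simp add: has_real_derivative_iff_has_vector_derivative has_vector_derivative_at_within)
  qed
  then have int: "((\<lambda>y. 2 * N\<^sup>2 / (y * (N\<^sup>2 + y\<^sup>2))) has_integral (- ln (1 + N\<^sup>2 / Y\<^sup>2) - - ln (1 + N\<^sup>2 / r\<^sup>2))) {r..Y}"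
    using assms by (intro fundamental_theorem_of_calculus) auto
  then show "(\<lambda>y. 2 * N\<^sup>2 / (y * (N\<^sup>2 + y\<^sup>2))) integrable_on {r..Y}" by blast
  have "0 \<le> ln (1 + N\<^sup>2 / Y\<^sup>2)" by (intro ln_ge_zero) simp
  then show "integral {r..Y} (\<lambda>y. 2 * N\<^sup>2 / (y * (N\<^sup>2 + y\<^sup>2))) \<le> ln (1 + N\<^sup>2 / r\<^sup>2)"
    using integral_unique[OF int] by simp
qed

text \<open>The upper half of the axis is moved to the line \<open>Re z = - \<eta>\<close>. The three terms come from the bottom
  edge at height \<open>r\<close>, from the vertical line and from the far edge.\<close>

lemma shift_left_bound:
  assumes r: "0 < r" "r \<le> 1" and N: "N \<ge> 2" and \<eta>: "0 < \<eta>" "\<eta> \<le> r" and P: "P \<ge> 0" and t: "t > 0"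
    and hol: "F holomorphic_on {z. - \<eta> \<le> Re z \<and> Re z \<le> 0 \<and> r \<le> Im z}"
    and F: "\<And>z. - \<eta> \<le> Re z \<Longrightarrow> Re z \<le> 0 \<Longrightarrow> r \<le> Im z \<Longrightarrow> cmod (F z) \<le> P / Im z"
    and Y: "N < Y"
  shows "cmod (integral {r..Y} (\<lambda>y. exp (of_real t * Complex 0 y) * F (Complex 0 y) * cutoff_kernel n r N (Complex 0 y)))
    \<le> 2 * P * (fact n * (3 / (r * t)) ^ n) + exp (- (\<eta> * t)) * P * 2 ^ n * ln (1 + N\<^sup>2 / r\<^sup>2)
      + Y * (P * 2 ^ n * (N\<^sup>2 / (Y\<^sup>2 - N\<^sup>2)))"
proof -
  define H where "H z = exp (of_real t * z) * F z * cutoff_kernel n r N z" for z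
  define L where "L a b = contour_integral (linepath a b) H" for a b
  let ?D = "{z. - \<eta> \<le> Re z \<and> Re z \<le> 0 \<and> r \<le> Im z}"
  have rY: "r < Y" "1 \<le> Y" using r N Y by auto
  have holD: "H holomorphic_on S" if "S \<subseteq> ?D" for S
    unfolding H_def using that r N
    by (intro holomorphic_intros holomorphic_on_subset[OF hol] kernel_holomorphic) auto
  have rect: "L (Complex (- \<eta>) r) (Complex 0 r) + L (Complex 0 r) (Complex 0 Y)
      + L (Complex 0 Y) (Complex (- \<eta>) Y) + L (Complex (- \<eta>) Y) (Complex (- \<eta>) r) = 0"
    unfolding L_def using rectangle_integral_zero[of H "Complex (- \<eta>) r" "Complex 0 Y"] rY r \<eta>
      holD[of "cbox (Complex (- \<eta>) r) (Complex 0 Y)"]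
    by (auto simp: in_cbox_complex_iff subset_iff)
  have side: "continuous_on (closed_segment a b) H" if "a \<in> ?D" "b \<in> ?D" for a b
  proof -
    have "convex ?D"
    proof -
      have "?D = {z. Re z \<ge> - \<eta>} \<inter> {z. Re z \<le> 0} \<inter> {z. Im z \<ge> r}" by auto
      then show ?thesis
        by (simp only:) (intro convex_Int convex_halfspace_Re_ge convex_halfspace_Re_le convex_halfspace_Im_ge)
    qed
    then show ?thesis
      using that by (intro holomorphic_on_imp_continuous_on holD closed_segment_subset)
  qed
  have L_le: "cmod (L a b) \<le> K * cmod (b - a)"
    if "a \<in> ?D" "b \<in> ?D" "K \<ge> 0" "\<And>z. z \<in> closed_segment a b \<Longrightarrow> cmod (H z) \<le> K" for a b K
    unfolding L_def using contour_integrable_continuous_linepath[OF side[OF that(1,2)]] that(3,4)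
    by (rule contour_integral_bound_linepath)
  \<comment> \<open>Bottom edge: the zero of order \<open>n\<close> at \<open>\<i>r\<close> is traded for the factor \<open>(rt)\<^sup>-\<^sup>n\<close>.\<close>
  have bottom: "cmod (L (Complex (- \<eta>) r) (Complex 0 r)) \<le> 2 * P * (fact n * (3 / (r * t)) ^ n)"
  proof -
    let ?K = "P / r * ((3 / (r * t)) ^ n * fact n * 2)"
    have pt: "cmod (H z) \<le> ?K" if z: "z \<in> closed_segment (Complex (- \<eta>) r) (Complex 0 r)" for z
    proof -
      define \<sigma> where "\<sigma> = - Re z"
      have \<sigma>: "0 \<le> \<sigma>" "\<sigma> \<le> \<eta>" "Re z = - \<sigma>" "Im z = r"
        using z \<eta> by (auto simp: \<sigma>_def closed_segment_same_Im closed_segment_eq_real_ivl)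
      have "(cmod z)\<^sup>2 \<le> r\<^sup>2 + r\<^sup>2"
        unfolding cmod_power2 using \<sigma> \<eta> r by (intro add_mono) (auto intro!: power_mono)
      moreover have "r\<^sup>2 \<le> 1" using r by (simp add: power_le_one)
      ultimately have \<rho>: "cmod (of_real (N\<^sup>2) / (of_real (N\<^sup>2) - z\<^sup>2)) \<le> 2"
        by (intro regulator_bound_small N) auto
      have k: "cmod (1 + of_real (r\<^sup>2) / z\<^sup>2) \<le> 3 * \<sigma> / r"
        using cutoff_factor_near_corner[OF r(1), of z] \<sigma> r \<eta> by simp
      have pe: "exp (- (t * \<sigma>)) * (3 * \<sigma> / r) ^ n \<le> (3 / (r * t)) ^ n * fact n"
      proof -
        have "(3 * \<sigma> / r) ^ n = (3 / (r * t)) ^ n * (t * \<sigma>) ^ n"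
          using t r by (simp add: power_mult_distrib[symmetric])
        also have "\<dots> \<le> (3 / (r * t)) ^ n * (fact n * exp (t * \<sigma>))"
          using t \<sigma> r by (intro mult_left_mono power_le_fact_exp) auto
        finally have pow: "(3 * \<sigma> / r) ^ n \<le> (3 / (r * t)) ^ n * (fact n * exp (t * \<sigma>))" .
        have "exp (- (t * \<sigma>)) * (3 * \<sigma> / r) ^ n \<le> exp (- (t * \<sigma>)) * ((3 / (r * t)) ^ n * (fact n * exp (t * \<sigma>)))"
          by (intro mult_left_mono pow) auto
        also have "\<dots> = (3 / (r * t)) ^ n * fact n * (exp (- (t * \<sigma>)) * exp (t * \<sigma>))"
          by (simp only: mult_ac)
        finally show ?thesis by (simp add: mult_exp_exp)
      qed
      have "cmod (H z) = cmod (F z) * ((exp (- (t * \<sigma>)) * cmod (1 + of_real (r\<^sup>2) / z\<^sup>2) ^ n)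
          * cmod (of_real (N\<^sup>2) / (of_real (N\<^sup>2) - z\<^sup>2)))"
        unfolding H_def cutoff_kernel_def norm_mult norm_power using \<sigma> by (simp add: mult_ac)
      also have "\<dots> \<le> P / r * (((3 / (r * t)) ^ n * fact n) * 2)"
      proof (rule mult_mono[OF _ mult_mono[OF _ \<rho>]])
        show "cmod (F z) \<le> P / r" using F[of z] \<sigma> by simp
        have "exp (- (t * \<sigma>)) * cmod (1 + of_real (r\<^sup>2) / z\<^sup>2) ^ n \<le> exp (- (t * \<sigma>)) * (3 * \<sigma> / r) ^ n"
          by (intro mult_left_mono power_mono k) auto
        then show "exp (- (t * \<sigma>)) * cmod (1 + of_real (r\<^sup>2) / z\<^sup>2) ^ n \<le> (3 / (r * t)) ^ n * fact n"
          using pe by linarith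
      qed (use P r t in auto)
      finally show ?thesis by simp
    qed
    have "cmod (L (Complex (- \<eta>) r) (Complex 0 r)) \<le> ?K * cmod (Complex 0 r - Complex (- \<eta>) r)"
      by (rule L_le[OF _ _ _ pt]) (use P r \<eta> t in auto)
    also have "Complex 0 r - Complex (- \<eta>) r = of_real \<eta>" by (simp add: complex_eq_iff)
    also have "?K * cmod (of_real \<eta>) \<le> ?K * r" using P r \<eta> t by (intro mult_left_mono) auto
    finally show ?thesis using r by (simp add: mult_ac)
  qed
  have top: "cmod (L (Complex 0 Y) (Complex (- \<eta>) Y)) \<le> Y * (P * 2 ^ n * (N\<^sup>2 / (Y\<^sup>2 - N\<^sup>2)))"
  proof -
    let ?K = "P * (2 ^ n * (N\<^sup>2 / (Y\<^sup>2 - N\<^sup>2)))"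
    have YN: "N\<^sup>2 < Y\<^sup>2" using N Y by (intro power_strict_mono) auto
    have K: "?K \<ge> 0" using P YN by simp
    have "cmod (H z) \<le> ?K" if z: "z \<in> closed_segment (Complex 0 Y) (Complex (- \<eta>) Y)" for z
    proof -
      have z': "- \<eta> \<le> Re z" "Re z \<le> 0" "Im z = Y"
        using z \<eta> by (auto simp: closed_segment_same_Im closed_segment_eq_real_ivl split: if_splits)
      have "Y \<le> cmod z" using abs_Im_le_cmod[of z] z' rY by simp
      then have k: "cmod (cutoff_kernel n r N z) \<le> 2 ^ n * (N\<^sup>2 / (Y\<^sup>2 - N\<^sup>2))"
        using r N Y rY by (intro kernel_far) auto
      have "cmod (F z) \<le> P / Y" using F[of z] z' rY by simp
      also have "\<dots> \<le> P / 1" using P rY by (intro divide_left_mono) auto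
      finally have "cmod (F z) \<le> P" by simp
      moreover have "cmod (exp (of_real t * z)) \<le> 1" using z' t by (simp add: mult_nonneg_nonpos)
      ultimately have "cmod (exp (of_real t * z)) * cmod (F z) \<le> 1 * P" by (intro mult_mono) auto
      then show ?thesis unfolding H_def norm_mult using k P by (intro mult_mono) auto
    qed
    then have "cmod (L (Complex 0 Y) (Complex (- \<eta>) Y)) \<le> ?K * cmod (Complex (- \<eta>) Y - Complex 0 Y)"
      using K r \<eta> rY by (intro L_le) auto
    also have "Complex (- \<eta>) Y - Complex 0 Y = of_real (- \<eta>)" by (simp add: complex_eq_iff)
    also have "?K * cmod (of_real (- \<eta>)) \<le> ?K * Y" using K r \<eta> rY by (intro mult_left_mono) auto
    finally show ?thesis by (simp add: mult_ac)
  qed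
  have left: "cmod (L (Complex (- \<eta>) Y) (Complex (- \<eta>) r)) \<le> exp (- (\<eta> * t)) * P * 2 ^ n * ln (1 + N\<^sup>2 / r\<^sup>2)"
  proof -
    let ?C = "exp (- (\<eta> * t)) * P * 2 ^ n"
    have pt: "cmod (H (Complex (- \<eta>) y)) \<le> ?C * (2 * N\<^sup>2 / (y * (N\<^sup>2 + y\<^sup>2)))" if y: "y \<in> {r..Y}" for y
    proof -
      let ?z = "Complex (- \<eta>) y"
      have y0: "y > 0" "r \<le> y" using y r by auto
      have "\<eta>\<^sup>2 \<le> 1" using \<eta> r by (simp add: power_le_one)
      moreover have "4 \<le> N\<^sup>2" using power_mono[of 2 N 2] N by simp
      ultimately have "2 * \<eta>\<^sup>2 \<le> N\<^sup>2 + y\<^sup>2" using zero_le_power2[of y] by linarith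
      then have "(N\<^sup>2 + y\<^sup>2) / 2 \<le> N\<^sup>2 - \<eta>\<^sup>2 + y\<^sup>2" by (simp add: field_simps)
      also have "\<dots> = Re (of_real (N\<^sup>2) - ?z\<^sup>2)" by (simp add: power2_eq_square)
      also have "\<dots> \<le> cmod (of_real (N\<^sup>2) - ?z\<^sup>2)" by (rule complex_Re_le_cmod)
      finally have den: "(N\<^sup>2 + y\<^sup>2) / 2 \<le> cmod (of_real (N\<^sup>2) - ?z\<^sup>2)" .
      have pos: "0 < N\<^sup>2 + y\<^sup>2" using y0 by (simp add: add_nonneg_pos)
      have "cmod (of_real (N\<^sup>2) / (of_real (N\<^sup>2) - ?z\<^sup>2)) = N\<^sup>2 / cmod (of_real (N\<^sup>2) - ?z\<^sup>2)"
        by (simp only: norm_divide norm_of_real) simp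
      also have "\<dots> \<le> N\<^sup>2 / ((N\<^sup>2 + y\<^sup>2) / 2)"
        using den pos by (intro divide_left_mono mult_pos_pos) auto
      finally have \<rho>: "cmod (of_real (N\<^sup>2) / (of_real (N\<^sup>2) - ?z\<^sup>2)) \<le> 2 * N\<^sup>2 / (N\<^sup>2 + y\<^sup>2)" by (simp add: mult.commute)
      have k: "cmod (1 + of_real (r\<^sup>2) / ?z\<^sup>2) \<le> 2"
        using cutoff_factor_bound[OF r(1), of ?z] y0 abs_Im_le_cmod[of ?z] by simp
      have "cmod (H ?z) = exp (- (\<eta> * t)) * (cmod (F ?z) * (cmod (1 + of_real (r\<^sup>2) / ?z\<^sup>2) ^ n
          * cmod (of_real (N\<^sup>2) / (of_real (N\<^sup>2) - ?z\<^sup>2))))"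
        unfolding H_def cutoff_kernel_def norm_mult norm_power by (simp add: mult_ac)
      also have "\<dots> \<le> exp (- (\<eta> * t)) * (P / y * (2 ^ n * (2 * N\<^sup>2 / (N\<^sup>2 + y\<^sup>2))))"
        using F[of ?z] y0 \<eta> P pos by (intro mult_left_mono mult_mono power_mono k \<rho>) auto
      finally show ?thesis by (simp add: mult_ac)
    qed
    have "L (Complex (- \<eta>) Y) (Complex (- \<eta>) r) = - L (Complex (- \<eta>) r) (Complex (- \<eta>) Y)"
      unfolding L_def using side \<eta> r rY by (intro contour_integral_reverse_linepath) auto
    also have "L (Complex (- \<eta>) r) (Complex (- \<eta>) Y) = \<i> * integral {r..Y} (\<lambda>y. H (Complex (- \<eta>) y))"
      unfolding L_def using rY by (intro contour_integral_linepath_same_Re) auto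
    finally have "cmod (L (Complex (- \<eta>) Y) (Complex (- \<eta>) r)) = cmod (integral {r..Y} (\<lambda>y. H (Complex (- \<eta>) y)))"
      by (simp add: norm_mult)
    also have "\<dots> \<le> integral {r..Y} (\<lambda>y. ?C * (2 * N\<^sup>2 / (y * (N\<^sup>2 + y\<^sup>2))))"
    proof (rule integral_norm_bound_integral[OF _ _ pt])
      have "continuous_on {r..Y} (\<lambda>y. H (Complex (- \<eta>) y))"
        by (rule continuous_on_compose2[OF holomorphic_on_imp_continuous_on[OF holD[OF order_refl]]])
          (use \<eta> r in \<open>auto intro!: continuous_intros simp: Complex_eq\<close>)
      then show "(\<lambda>y. H (Complex (- \<eta>) y)) integrable_on {r..Y}" by (rule integrable_continuous_real)
      show "(\<lambda>y. ?C * (2 * N\<^sup>2 / (y * (N\<^sup>2 + y\<^sup>2)))) integrable_on {r..Y}"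
        using log_integral_bound(1)[of r Y N] r rY N by (intro integrable_on_mult_right) auto
    qed
    also have "\<dots> = ?C * integral {r..Y} (\<lambda>y. 2 * N\<^sup>2 / (y * (N\<^sup>2 + y\<^sup>2)))"
      by (rule integral_mult_right)
    also have "\<dots> \<le> ?C * ln (1 + N\<^sup>2 / r\<^sup>2)"
      using log_integral_bound(2)[of r Y N] r rY N P by (intro mult_left_mono) auto
    finally show ?thesis .
  qed
  have "\<i> * integral {r..Y} (\<lambda>y. H (Complex 0 y)) = L (Complex 0 r) (Complex 0 Y)"
    unfolding L_def using rY by (intro contour_integral_linepath_same_Re[symmetric]) auto
  also have "\<dots> = - (L (Complex (- \<eta>) r) (Complex 0 r) + L (Complex 0 Y) (Complex (- \<eta>) Y)
      + L (Complex (- \<eta>) Y) (Complex (- \<eta>) r))"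
    unfolding eq_neg_iff_add_eq_0 rect[symmetric] by (simp only: add_ac)
  finally have "cmod (integral {r..Y} (\<lambda>y. H (Complex 0 y))) =
      cmod (L (Complex (- \<eta>) r) (Complex 0 r) + L (Complex 0 Y) (Complex (- \<eta>) Y)
      + L (Complex (- \<eta>) Y) (Complex (- \<eta>) r))"
    by (metis norm_mult norm_ii mult_1 norm_minus_cancel)
  also have "\<dots> \<le> cmod (L (Complex (- \<eta>) r) (Complex 0 r)) + cmod (L (Complex 0 Y) (Complex (- \<eta>) Y))
      + cmod (L (Complex (- \<eta>) Y) (Complex (- \<eta>) r))"
    by (intro order_trans[OF norm_triangle_ineq] add_mono order_refl)
  finally show ?thesis using bottom top left unfolding H_def by linarith
qed

text \<open>Let \<open>g\<close> and \<open>G\<close> be the transforms of the future and of the reversed past of \<open>f\<close> seen from time \<open>t\<close>,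
  so that \<open>e\<^sup>t\<^sup>z F(z) = g(z) + G(-z)\<close>. Both are transforms of functions with bounded antiderivatives, and
  as the kernel is even, \<open>right_half_plane_contour\<close> applies to \<open>g\<close> and to \<open>G\<close> and gives their values
  at \<open>N\<close>. The axis integrals add up to that of \<open>e\<^sup>t\<^sup>z F(z)\<close>, which is shifted to the left.\<close>

lemma contour_estimate:
  assumes r: "0 < r" "r \<le> 1" and N: "N \<ge> 2" and n: "n \<ge> 1" and \<eta>: "0 < \<eta>" "\<eta> \<le> r"
    and P: "P \<ge> 0" and t: "t > 0"
    and f: "continuous_on {0<..} f" "\<And>\<tau>. 0 < \<tau> \<Longrightarrow> cmod (f \<tau>) \<le> M"
    and w: "\<And>\<tau>. 0 < \<tau> \<Longrightarrow> (w has_vector_derivative f \<tau>) (at \<tau>)" "continuous_on {0..} w"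
      "\<And>\<tau>. 0 \<le> \<tau> \<Longrightarrow> cmod (w \<tau>) \<le> M"
    and U: "open U" "{z. 0 < Re z \<or> \<bar>Re z\<bar> \<le> \<eta> \<and> r \<le> \<bar>Im z\<bar>} \<subseteq> U" "F holomorphic_on U"
    and lap: "\<And>z. 0 < Re z \<Longrightarrow> F z = laplace_on {0<..} f z"
    and F: "\<And>z. \<bar>Re z\<bar> \<le> \<eta> \<Longrightarrow> r \<le> \<bar>Im z\<bar> \<Longrightarrow> cmod (F z) \<le> P / \<bar>Im z\<bar>"
  shows "N * cmod (laplace_on {0<..} (\<lambda>\<tau>. f (t + \<tau>)) (of_real N) + laplace_on {0<..<t} (\<lambda>\<tau>. f (t - \<tau>)) (of_real N))
    \<le> 144 * M * 2 ^ n * r + 4 * P * (fact n * (3 / (r * t)) ^ n)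
      + 2 * (exp (- (\<eta> * t)) * P * 2 ^ n * ln (1 + N\<^sup>2 / r\<^sup>2))" (is "_ \<le> ?bound")
proof -
  let ?D = "{z. 0 < Re z \<or> \<bar>Re z\<bar> \<le> \<eta> \<and> r \<le> \<bar>Im z\<bar>}"
  let ?R = "{z. 0 < Re z \<or> 0 \<le> Re z \<and> r \<le> \<bar>Im z\<bar>}"
  let ?ax = "{z. Re z = 0 \<and> r \<le> \<bar>Im z\<bar>}"
  have hol: "F holomorphic_on ?D" using U(2,3) by (rule holomorphic_on_subset[rotated])
  define G where "G z = laplace_on {0<..<t} (\<lambda>\<tau>. f (t - \<tau>)) z" for z
  define g where "g z = exp (of_real t * z) * F z - G (- z)" for z
  have M: "M \<ge> 0" using w(3)[of 0] norm_ge_zero[of "w 0"] by linarith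
  have f_cont: "isCont f \<tau>" if "\<tau> > 0" for \<tau>
    using f(1) that by (simp add: continuous_on_eq_continuous_at)
  have f_ahead: "continuous_on {0<..} (\<lambda>\<tau>. f (t + \<tau>))" and f_back: "continuous_on {0<..<t} (\<lambda>\<tau>. f (t - \<tau>))"
    using t by (auto intro!: continuous_on_compose2[OF f(1)] continuous_intros)
  have back_meas: "set_borel_measurable lborel {0<..<t} (\<lambda>\<tau>. f (t - \<tau>))"
    using f_back by (intro set_borel_measurable_continuous_open) auto
  have back_le: "cmod (f (t - \<tau>)) \<le> (M * exp (\<bar>b\<bar> * t)) * exp (b * \<tau>)" if "\<tau> \<in> {0<..<t}" for \<tau> b
  proof -
    have "\<bar>b\<bar> * \<tau> \<le> \<bar>b\<bar> * t" using that by (intro mult_left_mono) auto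
    moreover have "- \<bar>b\<bar> * \<tau> \<le> b * \<tau>" using that by (intro mult_right_mono) auto
    ultimately have "1 \<le> exp (\<bar>b\<bar> * t + b * \<tau>)" by simp
    then have "M * 1 \<le> M * exp (\<bar>b\<bar> * t + b * \<tau>)" using M by (intro mult_left_mono)
    then show ?thesis using f(2)[of "t - \<tau>"] that by (simp add: exp_add)
  qed
  have G_hol: "G holomorphic_on UNIV"
  proof -
    have "G holomorphic_on {z. b < Re z}" for b
      unfolding G_def[abs_def]
      by (rule laplace_on_holomorphic[OF _ _ back_meas back_le]) (use M in auto)
    then have "G field_differentiable at z" for z
      by (rule holomorphic_on_imp_differentiable_at[of _ "{u. Re z - 1 < Re u}"]) (auto intro: open_halfspace_Re_gt)
    then show ?thesis by (simp add: holomorphic_on_def)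
  qed
  have G_le: "cmod (G z) \<le> M * exp t" if "0 \<le> Re z" for z
  proof -
    have "cmod (G z) \<le> (M * exp t) / (Re z - (- 1))"
      unfolding G_def by (rule laplace_on_bound[OF _ _ back_meas]) (use back_le[of _ "-1"] M that in auto)
    also have "\<dots> \<le> (M * exp t) / 1" using that M by (intro divide_left_mono) auto
    finally show ?thesis by simp
  qed
  have G_small: "cmod (G z) \<le> 3 * M * cmod z / Re z" if "0 < Re z" for z
    unfolding G_def
  proof (rule laplace_on_antiderivative_bound[where e = "ereal t" and w = "\<lambda>\<tau>. - w (t - \<tau>)"])
    fix \<tau> :: real assume \<tau>: "0 < \<tau>" "ereal \<tau> < ereal t"
    then have "0 < t - \<tau>" by simp
    have inner: "((\<lambda>\<tau>. t - \<tau>) has_vector_derivative - 1) (at \<tau>)"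
      by (auto intro!: derivative_eq_intros)
    have "((w \<circ> (\<lambda>\<tau>. t - \<tau>)) has_vector_derivative - 1 *\<^sub>R f (t - \<tau>)) (at \<tau>)"
      by (rule vector_diff_chain_at[OF inner w(1)]) fact
    then show "((\<lambda>\<tau>. - w (t - \<tau>)) has_vector_derivative f (t - \<tau>)) (at \<tau>)"
      using has_vector_derivative_minus by (fastforce simp: o_def)
    show "isCont (\<lambda>\<tau>. f (t - \<tau>)) \<tau>"
      using f_back \<tau> by (simp add: continuous_on_eq_continuous_at)
    show "cmod (f (t - \<tau>)) \<le> M" using \<tau> by (intro f(2)) simp
  next
    have wc: "continuous_on {..t} (\<lambda>\<tau>. - w (t - \<tau>))"
      by (auto intro!: continuous_on_compose2[OF w(2)] continuous_intros)
    have "isCont (\<lambda>\<tau>. - w (t - \<tau>)) 0"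
      using t by (intro continuous_on_interior[OF wc]) simp
    then show "((\<lambda>\<tau>. - w (t - \<tau>)) \<longlongrightarrow> - w (t - 0)) (at_right 0)"
      unfolding isCont_def by (rule tendsto_within_subset) simp
    show "((\<lambda>\<tau>. - w (t - \<tau>)) \<longlongrightarrow> - w (t - u)) (at_left u)" if "ereal t = ereal u" for u
    proof -
      have "((\<lambda>\<tau>. - w (t - \<tau>)) \<longlongrightarrow> - w (t - u)) (at u within {..t})"
        using wc[unfolded continuous_on_def, THEN bspec, of u] that by simp
      then show ?thesis by (rule tendsto_within_subset) (use that in auto)
    qed
  qed (use t that w(3) in \<open>auto simp: zero_ereal_def\<close>)
  have g_eq: "g z = laplace_on {0<..} (\<lambda>\<tau>. f (t + \<tau>)) z" if "0 < Re z" for z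
  proof -
    have split: "laplace_on {0<..} f z = laplace_on {0<..<t} f z
        + exp (- (z * of_real t)) * laplace_on {0<..} (\<lambda>\<tau>. f (t + \<tau>)) z"
      by (rule laplace_split[OF f(1) _ that t]) (rule f(2))
    have alg: "a * (b + c * d) = a * b + (a * c) * d" for a b c d :: complex
      by (simp add: algebra_simps)
    have "exp (of_real t * z) * F z = exp (z * of_real t) * laplace_on {0<..<t} f z
        + (exp (z * of_real t) * exp (- (z * of_real t))) * laplace_on {0<..} (\<lambda>\<tau>. f (t + \<tau>)) z"
      unfolding lap[OF that] mult.commute[of "of_real t" z]
      unfolding split by (rule alg)
    then show ?thesis
      unfolding g_def G_def laplace_reflect[of z t f, symmetric] by (simp add: mult_exp_exp mult.commute[of "of_real t" z])
  qed
  have g_small: "cmod (g z) \<le> 3 * M * cmod z / Re z" if "0 < Re z" for z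
    unfolding g_eq[OF that]
  proof (rule laplace_on_antiderivative_bound[where e = \<infinity> and w = "\<lambda>\<tau>. w (t + \<tau>)"])
    fix \<tau> :: real assume \<tau>: "0 < \<tau>"
    have inner: "((\<lambda>\<tau>. t + \<tau>) has_vector_derivative 1) (at \<tau>)"
      by (auto intro!: derivative_eq_intros)
    have "((w \<circ> (\<lambda>\<tau>. t + \<tau>)) has_vector_derivative 1 *\<^sub>R f (t + \<tau>)) (at \<tau>)"
      by (rule vector_diff_chain_at[OF inner w(1)]) (use \<tau> t in simp)
    then show "((\<lambda>\<tau>. w (t + \<tau>)) has_vector_derivative f (t + \<tau>)) (at \<tau>)" by (simp add: o_def)
    show "isCont (\<lambda>\<tau>. f (t + \<tau>)) \<tau>"
      using f_ahead \<tau> by (simp add: continuous_on_eq_continuous_at)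
    show "cmod (f (t + \<tau>)) \<le> M" using \<tau> t by (intro f(2)) simp
  next
    have "isCont w t" using w(2) t by (intro continuous_on_interior[OF w(2)]) (simp add: interior_Ici)
    then have "isCont (\<lambda>\<tau>. w (t + \<tau>)) 0" by (intro isCont_o2[where g = w and f = "\<lambda>\<tau>. t + \<tau>"] continuous_intros) simp
    then show "((\<lambda>\<tau>. w (t + \<tau>)) \<longlongrightarrow> w (t + 0)) (at_right 0)"
      unfolding isCont_def by (rule tendsto_within_subset) simp
  qed (use t that w(3) in \<open>auto simp: zero_ereal_def\<close>)
  \<comment> \<open>A crude bound, needed on the far sides of the contours only, where it disappears in the limit.\<close>
  define B where "B = M / \<eta> + exp (t * \<eta>) * (P / r) + M * exp t + M * exp (\<eta> * t + t)"
  have B0: "B \<ge> 0" "M * exp t \<le> B" unfolding B_def using M P \<eta> r by auto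
  have g_B: "cmod (g z) \<le> B" if z: "0 \<le> Re z" "r \<le> \<bar>Im z\<bar>" for z
  proof (cases "Re z \<le> \<eta>")
    case True
    have back_bound: "cmod (G (- z)) \<le> M * exp (\<eta> * t + t)"
    proof -
      have le: "cmod (f (t - \<tau>)) \<le> M * exp (\<eta> * t + t) * exp (- (1 + \<eta>) * \<tau>)" if "\<tau> \<in> {0<..<t}" for \<tau>
      proof -
        have "\<bar>- (1 + \<eta>)\<bar> * t = \<eta> * t + t" using \<eta> by (simp add: distrib_right)
        then show ?thesis using back_le[OF that, of "- (1 + \<eta>)"] by simp
      qed
      have "cmod (G (- z)) \<le> M * exp (\<eta> * t + t) / (Re (- z) - (- (1 + \<eta>)))"
        unfolding G_def by (rule laplace_on_bound[OF _ _ back_meas le]) (use M True in auto)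
      also have "\<dots> \<le> M * exp (\<eta> * t + t) / 1"
        using M True by (intro divide_left_mono) auto
      finally show ?thesis by simp
    qed
    have "cmod (F z) \<le> P / \<bar>Im z\<bar>" using z True by (intro F) auto
    also have "\<dots> \<le> P / r" using z r P by (intro divide_left_mono) auto
    finally have "cmod (exp (of_real t * z) * F z) \<le> exp (t * \<eta>) * (P / r)"
      unfolding norm_mult using t True by (intro mult_mono) auto
    then have "cmod (g z) \<le> exp (t * \<eta>) * (P / r) + M * exp (\<eta> * t + t)"
      unfolding g_def using back_bound
      by (intro order_trans[OF norm_triangle_ineq4] add_mono)
    moreover have "0 \<le> M / \<eta>" "0 \<le> M * exp t" using M \<eta> by auto
    ultimately show ?thesis unfolding B_def by linarith
  next
    case False
    then have pos: "0 < Re z" using \<eta> by simp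
    have "set_borel_measurable lborel {0<..} (\<lambda>\<tau>. f (t + \<tau>))"
      by (rule set_borel_measurable_continuous_open[OF open_greaterThan f_ahead])
    then have "cmod (g z) \<le> M / (Re z - 0)"
      unfolding g_eq[OF pos]
      by (rule laplace_on_bound[rotated 2]) (use pos M t f(2) in simp_all)
    also have "\<dots> \<le> M / \<eta>" using False \<eta> M by (intro divide_left_mono) auto
    also have "\<dots> \<le> B" unfolding B_def using M P \<eta> r by simp
    finally show ?thesis .
  qed
  have G_neg_hol: "(\<lambda>z. G (- z)) holomorphic_on S" for S
  proof -
    have "(G \<circ> uminus) holomorphic_on S"
      by (intro holomorphic_on_compose holomorphic_on_subset[OF G_hol] holomorphic_on_minus
          holomorphic_on_ident subset_UNIV)
    then show ?thesis by (simp add: o_def)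
  qed
  have g_hol: "g holomorphic_on ?R"
    unfolding g_def using \<eta>
    by (intro holomorphic_intros holomorphic_on_subset[OF hol] G_neg_hol) auto
  let ?k = "cutoff_kernel n r N"
  have kc: "continuous_on ?ax ?k"
    using r N by (intro holomorphic_on_imp_continuous_on kernel_holomorphic) auto
  have "g holomorphic_on ?ax" by (rule holomorphic_on_subset[OF g_hol]) auto
  note gc = holomorphic_on_imp_continuous_on[OF this] holomorphic_on_imp_continuous_on[OF G_neg_hol]
  have axis_sum: "axis_integral r Y (\<lambda>z. g z * ?k z) + axis_integral r Y (\<lambda>z. G z * ?k z)
      = axis_integral r Y (\<lambda>z. exp (of_real t * z) * F z * ?k z)" for Y
  proof -
    have "axis_integral r Y (\<lambda>z. G z * ?k z) = axis_integral r Y (\<lambda>z. G (- z) * ?k z)"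
      using axis_integral_minus[of r Y "\<lambda>z. G z * ?k z"] by (simp add: kernel_minus)
    then have "axis_integral r Y (\<lambda>z. g z * ?k z) + axis_integral r Y (\<lambda>z. G z * ?k z)
        = axis_integral r Y (\<lambda>z. g z * ?k z + G (- z) * ?k z)"
      using axis_integral_linear[OF r(1) continuous_on_mult[OF gc(1) kc] continuous_on_mult[OF gc(2) kc]]
      by simp
    then show ?thesis by (simp add: g_def algebra_simps)
  qed
  define \<delta> where "\<delta> Y = (B + 6 * M + P) * 2 ^ n * (N\<^sup>2 / (Y\<^sup>2 - N\<^sup>2))" for Y
  define X where "X = 2 * P * (fact n * (3 / (r * t)) ^ n) + exp (- (\<eta> * t)) * P * 2 ^ n * ln (1 + N\<^sup>2 / r\<^sup>2)"
  define c where "c = (1 + of_real (r\<^sup>2) / of_real (N\<^sup>2) :: complex) ^ n"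
  have main: "cmod (of_real pi * of_real N * (g (of_real N) + G (of_real N)) * c)
      \<le> 144 * M * 2 ^ n * r + 2 * X + 10 * (Y * \<delta> Y)" if Y: "N < Y" for Y
  proof -
    have YN: "N\<^sup>2 < Y\<^sup>2" using N Y by (intro power_strict_mono) auto
    have \<delta>1: "4 * (Y * ((B + 6 * M) * 2 ^ n * (N\<^sup>2 / (Y\<^sup>2 - N\<^sup>2)))) \<le> 4 * (Y * \<delta> Y)"
      and \<delta>2: "Y * (P * 2 ^ n * (N\<^sup>2 / (Y\<^sup>2 - N\<^sup>2))) \<le> Y * \<delta> Y"
      unfolding \<delta>_def using YN N Y P B0 M
      by (intro mult_left_mono mult_right_mono; simp)+
    have G_B: "cmod (G z) \<le> B" if "0 \<le> Re z" "r \<le> \<bar>Im z\<bar>" for z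
      using G_le[OF that(1)] B0(2) by (rule order_trans)
    have rg: "cmod (axis_integral r Y (\<lambda>z. g z * ?k z) - of_real pi * of_real N * g (of_real N) * c)
        \<le> 72 * M * 2 ^ n * r + 4 * (Y * \<delta> Y)"
      using right_half_plane_contour[OF r N n M B0(1) g_hol g_small g_B Y] \<delta>1 unfolding c_def by linarith
    have rG: "cmod (axis_integral r Y (\<lambda>z. G z * ?k z) - of_real pi * of_real N * G (of_real N) * c)
        \<le> 72 * M * 2 ^ n * r + 4 * (Y * \<delta> Y)"
      using right_half_plane_contour[OF r N n M B0(1) holomorphic_on_subset[OF G_hol subset_UNIV] G_small G_B Y]
        \<delta>1 unfolding c_def by linarith
    \<comment> \<open>Both halves of the axis are shifted to the left; the lower one after a reflection.\<close>
    define I where "I K = integral {r..Y} (\<lambda>y. exp (of_real t * Complex 0 y) * K (Complex 0 y) * ?k (Complex 0 y))" for K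
    let ?E = "{z. - \<eta> \<le> Re z \<and> Re z \<le> 0 \<and> r \<le> Im z}"
    have shift: "cmod (I K) \<le> X + Y * \<delta> Y"
      if "K holomorphic_on ?E" "\<And>z. z \<in> ?E \<Longrightarrow> cmod (K z) \<le> P / Im z" for K
    proof -
      have "cmod (I K) \<le> X + Y * (P * 2 ^ n * (N\<^sup>2 / (Y\<^sup>2 - N\<^sup>2)))"
        unfolding I_def X_def
        by (rule shift_left_bound[OF r N \<eta> P t that(1) _ Y]) (use that(2) in simp)
      then show ?thesis using \<delta>2 by linarith
    qed
    have F_le: "cmod (F z) \<le> P / Im z" "cmod (F (cnj z)) \<le> P / Im z" if "z \<in> ?E" for z
      using F[of z] F[of "cnj z"] that r by auto
    have up: "cmod (I F) \<le> X + Y * \<delta> Y"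
      by (rule shift[OF holomorphic_on_subset[OF hol]]) (use F_le in auto)
    have cnj_I: "cmod (I (\<lambda>z. cnj (F (cnj z)))) \<le> X + Y * \<delta> Y"
    proof -
      have "open (cnj -` U)" by (intro open_vimage U(1) continuous_intros)
      then have "cnj \<circ> F \<circ> cnj holomorphic_on cnj ` U"
        using U(3) by (intro holomorphic_on_compose_cnj_cnj)
          (simp_all add: image_image flip: image_cnj_conv_vimage_cnj)
      moreover have "?E \<subseteq> cnj ` U"
      proof
        fix z assume "z \<in> ?E"
        then have "cnj z \<in> ?D" using r by auto
        then show "z \<in> cnj ` U" unfolding image_cnj_conv_vimage_cnj using U(2) by blast
      qed
      ultimately have "cnj \<circ> F \<circ> cnj holomorphic_on ?E" by (rule holomorphic_on_subset)
      then have "(\<lambda>z. cnj (F (cnj z))) holomorphic_on ?E" by (simp only: o_def)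
      then show ?thesis by (rule shift) (use F_le(2) in simp)
    qed
    have "cnj (exp (of_real t * z) * cnj (F (cnj z)) * ?k z)
        = exp (of_real t * cnj z) * F (cnj z) * ?k (cnj z)" for z
      by (simp add: kernel_cnj exp_cnj)
    note cnj_integrand = this[of "Complex 0 y" for y, unfolded complex_cnj]
    have "cnj (I (\<lambda>z. cnj (F (cnj z)))) =
        integral {r..Y} (\<lambda>y. exp (of_real t * Complex 0 (- y)) * F (Complex 0 (- y)) * ?k (Complex 0 (- y)))"
      unfolding I_def integral_cnj by (intro integral_cong) (simp only: complex_cnj cnj_integrand)
    then have low: "cmod (integral {r..Y} (\<lambda>y. exp (of_real t * Complex 0 (- y)) * F (Complex 0 (- y)) * ?k (Complex 0 (- y))))
        \<le> X + Y * \<delta> Y" using cnj_I by (metis complex_mod_cnj)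
    let ?H = "\<lambda>z. exp (of_real t * z) * F z * ?k z"
    have Hc: "continuous_on ?ax ?H"
      using r \<eta> kc by (intro continuous_on_mult holomorphic_on_imp_continuous_on[OF holomorphic_on_subset[OF hol]] continuous_intros) auto
    have "continuous_on {r..Y} (\<lambda>y. ?H (Complex 0 y))" "continuous_on {r..Y} (\<lambda>y. ?H (Complex 0 (- y)))"
      by (rule continuous_on_compose2[OF Hc]; use r in \<open>auto intro!: continuous_intros simp: Complex_eq\<close>)+
    then have "axis_integral r Y ?H = I F + integral {r..Y} (\<lambda>y. ?H (Complex 0 (- y)))"
      unfolding axis_integral_def I_def by (intro integral_add integrable_continuous_real)
    then have "cmod (axis_integral r Y ?H) \<le> cmod (I F) + cmod (integral {r..Y} (\<lambda>y. ?H (Complex 0 (- y))))"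
      by (simp only: norm_triangle_ineq)
    then have H_le: "cmod (axis_integral r Y ?H) \<le> 2 * X + 2 * (Y * \<delta> Y)"
      using up low by linarith
    have tri: "cmod (a - b - d) \<le> cmod a + cmod b + cmod d" for a b d
      using norm_triangle_ineq4[of "a - b" d] norm_triangle_ineq4[of a b] by linarith
    have eq: "of_real pi * of_real N * (g (of_real N) + G (of_real N)) * c = axis_integral r Y ?H
        - (axis_integral r Y (\<lambda>z. g z * ?k z) - of_real pi * of_real N * g (of_real N) * c)
        - (axis_integral r Y (\<lambda>z. G z * ?k z) - of_real pi * of_real N * G (of_real N) * c)"
      unfolding axis_sum[symmetric] by (simp add: algebra_simps)
    have "cmod (of_real pi * of_real N * (g (of_real N) + G (of_real N)) * c)
        \<le> (2 * X + 2 * (Y * \<delta> Y)) + (72 * M * 2 ^ n * r + 4 * (Y * \<delta> Y)) + (72 * M * 2 ^ n * r + 4 * (Y * \<delta> Y))"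
      unfolding eq by (intro order_trans[OF tri] add_mono H_le rg rG)
    then show ?thesis by (simp add: mult_ac)
  qed
  have lim: "((\<lambda>Y. 144 * M * 2 ^ n * r + 2 * X + 10 * (Y * \<delta> Y)) \<longlongrightarrow> 144 * M * 2 ^ n * r + 2 * X + 10 * 0) at_top"
    unfolding \<delta>_def by (intro tendsto_intros far_error_tendsto)
  have "cmod (of_real pi * of_real N * (g (of_real N) + G (of_real N)) * c) \<le> 144 * M * 2 ^ n * r + 2 * X + 10 * 0"
    by (rule tendsto_lowerbound[OF lim eventually_mono[OF eventually_gt_at_top[of N] main]]) simp_all
  then have fin: "pi * (N * cmod (g (of_real N) + G (of_real N)) * cmod c) \<le> ?bound"
    using N by (simp add: norm_mult X_def mult_ac)
  have "cmod c \<ge> 1"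
  proof -
    have "(1 + of_real (r\<^sup>2) / of_real (N\<^sup>2) :: complex) = of_real (1 + r\<^sup>2 / N\<^sup>2)" by simp
    then have "cmod c = (1 + r\<^sup>2 / N\<^sup>2) ^ n"
      unfolding c_def norm_power by (simp only: norm_of_real) (simp add: abs_of_nonneg)
    then show ?thesis by (simp add: one_le_power)
  qed
  moreover have "pi \<ge> 1" using pi_gt3 by linarith
  ultimately have "1 * (N * cmod (g (of_real N) + G (of_real N)) * 1) \<le> pi * (N * cmod (g (of_real N) + G (of_real N)) * cmod c)"
    using N by (intro mult_mono) auto
  then have "N * cmod (g (of_real N) + G (of_real N)) \<le> ?bound" using fin by linarith
  moreover have "g (of_real N) = laplace_on {0<..} (\<lambda>\<tau>. f (t + \<tau>)) (of_real N)"
    using N by (intro g_eq) simp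
  ultimately show ?thesis by (simp only: G_def)
qed

section \<open>Pointwise bounds\<close>

text \<open>The measure \<open>N e\<^sup>-\<^sup>N\<^sup>\<tau> d\<tau>\<close> is a probability measure on the half-line with mean \<open>1 / N\<close>.\<close>

lemma laplace_average:
  assumes h: "set_borel_measurable lborel {0<..} h" and le: "\<And>\<tau>. \<tau> > 0 \<Longrightarrow> cmod (h \<tau> - a) \<le> L * \<tau>"
    and L: "L \<ge> 0" and N: "N > 0"
  shows "cmod (of_real N * laplace_on {0<..} h (of_real N) - a) \<le> 4 * L / N"
proof -
  have lin: "\<tau> \<le> 2 / N * exp (N / 2 * \<tau>)" for \<tau>
    using exp_ge_add_one_self[of "N / 2 * \<tau>"] N by (simp add: field_simps)
  have meas: "set_borel_measurable lborel {0<..} (\<lambda>\<tau>. h \<tau> - a)"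
    "set_borel_measurable lborel {0<..} (\<lambda>\<tau>::real. a)"
  proof -
    show c: "set_borel_measurable lborel {0<..} (\<lambda>\<tau>::real. a)" by (simp add: set_borel_measurable_def)
    show "set_borel_measurable lborel {0<..} (\<lambda>\<tau>. h \<tau> - a)"
      using h c unfolding set_borel_measurable_def by (simp add: scaleR_diff_right)
  qed
  have d_le: "cmod (h \<tau> - a) \<le> 2 * L / N * exp (N / 2 * \<tau>)" if "\<tau> \<in> {0<..}" for \<tau>
    using le[of \<tau>] mult_left_mono[OF lin[of \<tau>] L] that by (simp add: mult_ac)
  have a_le: "cmod a \<le> cmod a * exp (0 * \<tau>)" if "\<tau> \<in> {0<..}" for \<tau> :: real by simp
  have C: "2 * L / N \<ge> 0" using L N by simp
  have i1: "set_integrable lborel {0<..} (\<lambda>\<tau>. exp (- (of_real N * of_real \<tau>)) * (h \<tau> - a))"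
    by (rule laplace_on_integrable[OF _ _ meas(1) d_le C]) (use N in auto)
  have i2: "set_integrable lborel {0<..} (\<lambda>\<tau>. exp (- (of_real N * of_real \<tau>)) * a)"
    by (rule laplace_on_integrable[OF _ _ meas(2) a_le]) (use N in auto)
  have "cmod (laplace_on {0<..} (\<lambda>\<tau>. h \<tau> - a) (of_real N)) \<le> (2 * L / N) / (Re (of_real N) - N / 2)"
    by (rule laplace_on_bound[OF _ _ meas(1) d_le C]) (use N in auto)
  also have "\<dots> = 4 * L / N / N" using N by (simp add: field_simps)
  finally have small: "N * cmod (laplace_on {0<..} (\<lambda>\<tau>. h \<tau> - a) (of_real N)) \<le> N * (4 * L / N / N)"
    using N by (intro mult_left_mono) auto
  have "(\<lambda>\<tau>. exp (- (of_real N * complex_of_real \<tau>)) * a) = (\<lambda>\<tau>. of_real (exp (- (N * \<tau>))) * a)"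
    by (simp add: exp_of_real[symmetric])
  then have const: "laplace_on {0<..} (\<lambda>_. a) (of_real N) = of_real (1 / N) * a"
    using exp_decay_integral(2)[OF N] by (simp add: laplace_on_def set_integral_complex_of_real)
  have "laplace_on {0<..} h (of_real N)
      = (LINT \<tau>:{0<..}|lborel. exp (- (of_real N * of_real \<tau>)) * (h \<tau> - a) + exp (- (of_real N * of_real \<tau>)) * a)"
    unfolding laplace_on_def by (intro set_lebesgue_integral_cong) (auto simp: algebra_simps)
  also have "\<dots> = laplace_on {0<..} (\<lambda>\<tau>. h \<tau> - a) (of_real N) + of_real (1 / N) * a"
    unfolding const[symmetric] using set_integral_add(2)[OF i1 i2] by (simp add: laplace_on_def)
  finally have "of_real N * laplace_on {0<..} h (of_real N) - a = of_real N * laplace_on {0<..} (\<lambda>\<tau>. h \<tau> - a) (of_real N)"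
    using N by (simp add: distrib_left)
  then show ?thesis using small N by (simp add: norm_mult)
qed

text \<open>Adding the averages of \<open>f\<close> just after and just before \<open>t\<close> counts \<open>f t\<close> twice. Away from
  \<open>t\<close> boundedness takes the place of the Lipschitz condition, with constant \<open>2 M\<close>.\<close>

lemma tauberian_bound:
  assumes r: "0 < r" "r \<le> 1" and N: "N \<ge> 2" and n: "n \<ge> 1" and \<eta>: "0 < \<eta>" "\<eta> \<le> r"
    and P: "P \<ge> 0" and t: "t \<ge> 1"
    and f: "continuous_on {0<..} f" "\<And>\<tau>. 0 < \<tau> \<Longrightarrow> cmod (f \<tau>) \<le> M"
    and w: "\<And>\<tau>. 0 < \<tau> \<Longrightarrow> (w has_vector_derivative f \<tau>) (at \<tau>)" "continuous_on {0..} w"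
      "\<And>\<tau>. 0 \<le> \<tau> \<Longrightarrow> cmod (w \<tau>) \<le> M"
    and U: "open U" "{z. 0 < Re z \<or> \<bar>Re z\<bar> \<le> \<eta> \<and> r \<le> \<bar>Im z\<bar>} \<subseteq> U" "F holomorphic_on U"
    and lap: "\<And>z. 0 < Re z \<Longrightarrow> F z = laplace_on {0<..} f z"
    and F: "\<And>z. \<bar>Re z\<bar> \<le> \<eta> \<Longrightarrow> r \<le> \<bar>Im z\<bar> \<Longrightarrow> cmod (F z) \<le> P / \<bar>Im z\<bar>"
    and \<Lambda>: "\<Lambda> \<ge> 0" "\<And>\<tau>. 0 < \<tau> \<Longrightarrow> \<bar>\<tau> - t\<bar> < 1 \<Longrightarrow> cmod (f \<tau> - f t) \<le> \<Lambda> * \<bar>\<tau> - t\<bar>"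
  shows "cmod (f t) \<le> 72 * M * 2 ^ n * r + 2 * P * (fact n * (3 / (r * t)) ^ n)
      + exp (- (\<eta> * t)) * P * 2 ^ n * ln (1 + N\<^sup>2 / r\<^sup>2) + 4 * (\<Lambda> + 2 * M) / N"
proof -
  define L where "L = \<Lambda> + 2 * M"
  have M: "M \<ge> 0" using w(3)[of 0] norm_ge_zero[of "w 0"] by linarith
  have L: "L \<ge> 0" "2 * M \<le> L" using M \<Lambda>(1) by (auto simp: L_def)
  have far: "cmod (z - f t) \<le> L * \<tau>" if "cmod z \<le> M" "\<tau> \<ge> 1" for z \<tau>
  proof -
    have "cmod (z - f t) \<le> M + M"
      using that(1) f(2)[of t] t norm_triangle_ineq4[of z "f t"] by linarith
    also have "\<dots> \<le> L * 1" using L by simp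
    also have "\<dots> \<le> L * \<tau>" using L that by (intro mult_left_mono) auto
    finally show ?thesis .
  qed
  have near: "cmod (f (t + \<sigma>) - f t) \<le> L * \<bar>\<sigma>\<bar>" if "t + \<sigma> > 0" for \<sigma>
  proof (cases "\<bar>\<sigma>\<bar> < 1")
    case True
    then have "cmod (f (t + \<sigma>) - f t) \<le> \<Lambda> * \<bar>\<sigma>\<bar>" using \<Lambda>(2)[of "t + \<sigma>"] that by simp
    also have "\<dots> \<le> L * \<bar>\<sigma>\<bar>" using M by (intro mult_right_mono) (auto simp: L_def)
    finally show ?thesis .
  next
    case False
    then show ?thesis using far[OF f(2)[OF that]] by simp
  qed
  let ?g = "laplace_on {0<..} (\<lambda>\<tau>. f (t + \<tau>)) (of_real N)"
  let ?G = "laplace_on {0<..<t} (\<lambda>\<tau>. f (t - \<tau>)) (of_real N)"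
  have "continuous_on {0<..} (\<lambda>\<tau>. f (t + \<tau>))"
    using t by (auto intro!: continuous_on_compose2[OF f(1)] continuous_intros)
  then have ahead: "cmod (of_real N * ?g - f t) \<le> 4 * L / N"
  proof (intro laplace_average set_borel_measurable_continuous_open)
    show "cmod (f (t + \<tau>) - f t) \<le> L * \<tau>" if "\<tau> > 0" for \<tau>
      using near[of \<tau>] that t by simp
  qed (use N L in auto)
  \<comment> \<open>Extension by \<open>0\<close> turns the past into a function on the half-line. The jump occurs at distance
    \<open>t \<ge> 1\<close>, where the Lipschitz bound only expresses boundedness.\<close>
  define h where "h \<tau> = (if \<tau> < t then f (t - \<tau>) else 0)" for \<tau>
  have "?G = laplace_on {0<..} h (of_real N)"
    unfolding laplace_on_def set_lebesgue_integral_def h_def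
    by (intro Bochner_Integration.integral_cong) (auto simp: indicator_def)
  moreover have "cmod (of_real N * laplace_on {0<..} h (of_real N) - f t) \<le> 4 * L / N"
  proof (rule laplace_average)
    have "continuous_on {0<..<t} (\<lambda>\<tau>. f (t - \<tau>))"
      by (auto intro!: continuous_on_compose2[OF f(1)] continuous_intros)
    then have "set_borel_measurable lborel {0<..<t} (\<lambda>\<tau>. f (t - \<tau>))"
      by (intro set_borel_measurable_continuous_open) auto
    moreover have "indicator {0<..<t} \<tau> *\<^sub>R f (t - \<tau>) = indicator {0<..} \<tau> *\<^sub>R h \<tau>" for \<tau>
      by (simp add: h_def indicator_def)
    ultimately show "set_borel_measurable lborel {0<..} h"
      by (simp add: set_borel_measurable_def)
    show "cmod (h \<tau> - f t) \<le> L * \<tau>" if "\<tau> > 0" for \<tau>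
    proof (cases "\<tau> < t")
      case True
      then show ?thesis using near[of "- \<tau>"] that by (simp add: h_def)
    next
      case False
      then show ?thesis using far[of 0 \<tau>] t M by (simp add: h_def)
    qed
  qed (use L N in auto)
  ultimately have behind: "cmod (of_real N * ?G - f t) \<le> 4 * L / N" by simp
  have tri: "cmod (a - b - d) \<le> cmod a + cmod b + cmod d" for a b d :: complex
    using norm_triangle_ineq4[of "a - b" d] norm_triangle_ineq4[of a b] by linarith
  have "2 * f t = of_real N * (?g + ?G) - (of_real N * ?g - f t) - (of_real N * ?G - f t)"
    by (simp add: algebra_simps)
  also have "cmod \<dots> \<le> cmod (of_real N * (?g + ?G)) + 4 * L / N + 4 * L / N"
    by (intro order_trans[OF tri] add_mono order_refl ahead behind)
  also have "cmod (of_real N * (?g + ?G)) = N * cmod (?g + ?G)" using N by (simp add: norm_mult)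
  also have "\<dots> \<le> 144 * M * 2 ^ n * r + 4 * P * (fact n * (3 / (r * t)) ^ n)
      + 2 * (exp (- (\<eta> * t)) * P * 2 ^ n * ln (1 + N\<^sup>2 / r\<^sup>2))"
    by (rule contour_estimate[OF r N n \<eta> P _ f w U lap F]) (use t in auto)
  finally have "2 * cmod (f t) \<le> 144 * M * 2 ^ n * r + 4 * P * (fact n * (3 / (r * t)) ^ n)
      + 2 * (exp (- (\<eta> * t)) * P * 2 ^ n * ln (1 + N\<^sup>2 / r\<^sup>2)) + 4 * L / N + 4 * L / N"
    by (simp add: norm_mult)
  then show ?thesis unfolding L_def[symmetric] by linarith
qed

section \<open>Bounded semigroups\<close>

locale bounded_C0_semigroup =
  fixes T :: "real \<Rightarrow> 'a::complex_banach \<Rightarrow>\<^sub>L 'a" and M :: real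
  assumes C0: "C0_semigroup T" and bound: "\<And>t. t \<ge> 0 \<Longrightarrow> norm (T t) \<le> M"
begin

abbreviation A where "A \<equiv> generator T"

lemma semigroup_basics:
  shows T_add: "s \<ge> 0 \<Longrightarrow> t \<ge> 0 \<Longrightarrow> T (s + t) x = T s (T t x)"
    and T_zero: "T 0 x = x"
    and T_scaleC: "t \<ge> 0 \<Longrightarrow> T t (c *\<^sub>C x) = c *\<^sub>C T t x"
    and T_right_zero: "((\<lambda>t. T t x) \<longlongrightarrow> x) (at_right 0)"
    and T_norm: "t \<ge> 0 \<Longrightarrow> norm (T t x) \<le> M * norm x"
    and M_nonneg: "M \<ge> 0"
proof -
  show "((\<lambda>t. T t x) \<longlongrightarrow> x) (at_right 0)" "T 0 x = x"
    using C0 by (auto simp: C0_semigroup_def)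
  show "s \<ge> 0 \<Longrightarrow> t \<ge> 0 \<Longrightarrow> T (s + t) x = T s (T t x)" using C0 by (simp add: C0_semigroup_def)
  show "t \<ge> 0 \<Longrightarrow> T t (c *\<^sub>C x) = c *\<^sub>C T t x"
    using C0 by (simp add: C0_semigroup_def bounded_operators_def bounded_clinear_def)
  show "t \<ge> 0 \<Longrightarrow> norm (T t x) \<le> M * norm x"
    using norm_blinfun[of "T t" x] mult_right_mono[OF bound norm_ge_zero[of x]] by force
  show "M \<ge> 0" using bound[of 0] norm_ge_zero[of "T 0"] by linarith
qed

lemma abs_diff_at_right: "filterlim (\<lambda>y. \<bar>y - t\<bar>) (at_right 0) (at t within S)" for t :: real
proof -
  have "((\<lambda>y. \<bar>y - t\<bar>) \<longlongrightarrow> 0) (at t within S)" by (auto intro!: tendsto_eq_intros)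
  then show ?thesis by (auto simp: filterlim_at eventually_at_filter)
qed

text \<open>Continuity at \<open>0\<close> carries over to both sides of \<open>t\<close>: the difference \<open>T(y) x - T(t) x\<close> is
  \<open>\<plusminus> T(min y t)\<close> applied to \<open>T(\<bar>y - t\<bar>) x - x\<close>, and \<open>T\<close> is bounded.\<close>

lemma strong_continuity: "continuous_on {0..} (\<lambda>t. T t x)"
  unfolding continuous_on_def
proof
  fix t :: real assume t: "t \<in> {0..}"
  let ?F = "at t within {0..}"
  have "((\<lambda>y. M * norm (T \<bar>y - t\<bar> x - x)) \<longlongrightarrow> M * norm (x - x)) ?F"
    by (intro tendsto_intros filterlim_compose[OF T_right_zero abs_diff_at_right])
  then have lim: "((\<lambda>y. M * norm (T \<bar>y - t\<bar> x - x)) \<longlongrightarrow> 0) ?F" by simp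
  have "norm (T y x - T t x) \<le> M * norm (T \<bar>y - t\<bar> x - x)" if "y \<ge> 0" for y
  proof (cases "y \<le> t")
    case True
    have "T y x - T t x = - T y (T \<bar>y - t\<bar> x - x)"
      using T_add[of y "t - y" x] True that by (simp add: blinfun.diff_right)
    then show ?thesis using T_norm[OF that, of "T \<bar>y - t\<bar> x - x"] by simp
  next
    case False
    have "T y x - T t x = T t (T \<bar>y - t\<bar> x - x)"
      using T_add[of t "y - t" x] False t by (simp add: blinfun.diff_right)
    then show ?thesis using T_norm[of t "T \<bar>y - t\<bar> x - x"] t by simp
  qed
  then have "\<forall>\<^sub>F y in ?F. norm (T y x - T t x) \<le> M * norm (T \<bar>y - t\<bar> x - x)"
    by (auto simp: eventually_at_filter)
  then have "((\<lambda>y. T y x - T t x) \<longlongrightarrow> 0) ?F" by (rule Lim_null_comparison[OF _ lim])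
  then show "((\<lambda>y. T y x) \<longlongrightarrow> T t x) ?F" by (simp add: LIM_zero_iff)
qed

text \<open>Both one-sided difference quotients are \<open>T(min y t)\<close> applied to the difference quotient at \<open>0\<close>
  with step \<open>\<bar>y - t\<bar>\<close>.\<close>

lemma orbit_derivative:
  assumes x: "x \<in> dom A" and t: "t \<ge> 0"
  shows "((\<lambda>s. T s x) has_vector_derivative T t (the (A x))) (at t within {0..})"
proof -
  let ?F = "at t within {0..}"
  define q where "q h = (T h x - x) /\<^sub>R h" for h
  have q: "(q \<longlongrightarrow> the (A x)) (at_right 0)"
  proof -
    have "\<exists>y. (q \<longlongrightarrow> y) (at_right 0)" and A: "A x = Some (Lim (at_right 0) q)"
      using x by (auto simp: generator_def q_def[abs_def] Let_def dom_def split: if_splits)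
    then obtain y where y: "(q \<longlongrightarrow> y) (at_right 0)" by auto
    then show ?thesis using tendsto_Lim[OF _ y] A by simp
  qed
  let ?z = "the (A x)"
  have "((\<lambda>y. T (min y t) ?z) \<longlongrightarrow> T (min t t) ?z) ?F"
    using t by (intro continuous_on_tendsto_compose[OF strong_continuity[of ?z]] tendsto_intros)
      (auto simp: eventually_at_filter)
  then have lim1: "((\<lambda>y. T (min y t) ?z) \<longlongrightarrow> T t ?z) ?F" by simp
  have "((\<lambda>y. M * norm (q \<bar>y - t\<bar> - ?z)) \<longlongrightarrow> M * norm (?z - ?z)) ?F"
    by (intro tendsto_intros filterlim_compose[OF q abs_diff_at_right])
  then have lim2: "((\<lambda>y. M * norm (q \<bar>y - t\<bar> - ?z)) \<longlongrightarrow> 0) ?F" by simp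
  have "((\<lambda>y. T (min y t) (q \<bar>y - t\<bar> - ?z)) \<longlongrightarrow> 0) ?F"
    by (rule Lim_null_comparison[OF _ lim2])
      (use t in \<open>auto simp: eventually_at_filter intro!: always_eventually T_norm\<close>)
  from tendsto_add[OF lim1 this]
  have "((\<lambda>y. T (min y t) (q \<bar>y - t\<bar>)) \<longlongrightarrow> T t ?z) ?F"
    by (simp add: blinfun.diff_right)
  moreover have "(T y x - T t x) /\<^sub>R (y - t) = T (min y t) (q \<bar>y - t\<bar>)" if "y \<ge> 0" "y \<noteq> t" for y
  proof (cases "y < t")
    case True
    have "(T y x - T t x) /\<^sub>R (y - t) = (- (T t x - T y x)) /\<^sub>R (- (t - y))"
      by (simp only: minus_diff_eq)
    also have "\<dots> = (T t x - T y x) /\<^sub>R (t - y)"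
      by (simp only: inverse_minus_eq scaleR_minus_left scaleR_minus_right minus_minus)
    finally have "(T y x - T t x) /\<^sub>R (y - t) = (T t x - T y x) /\<^sub>R (t - y)" .
    moreover have "T t x = T y (T (t - y) x)" using T_add[of y "t - y" x] True that by simp
    then have "T (min y t) (q \<bar>y - t\<bar>) = (T t x - T y x) /\<^sub>R (t - y)"
      using True by (simp add: q_def blinfun.scaleR_right blinfun.diff_right min_def)
    ultimately show ?thesis by (simp only:)
  next
    case False
    then show ?thesis
      using T_add[of t "y - t" x] t that
      by (simp add: q_def blinfun.scaleR_right blinfun.diff_right min_def)
  qed
  then have "\<forall>\<^sub>F y in ?F. T (min y t) (q \<bar>y - t\<bar>) = (T y x - T t x) /\<^sub>R (y - t)"
    by (auto simp: eventually_at_filter)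
  ultimately have "((\<lambda>y. (T y x - T t x) /\<^sub>R (y - t)) \<longlongrightarrow> T t ?z) ?F"
    by (rule Lim_transform_eventually)
  then have "((\<lambda>y. (T y x - T t x) /\<^sub>R (y - t) - T t ?z) \<longlongrightarrow> 0) ?F"
    by (simp add: LIM_zero_iff)
  then have "((\<lambda>y. norm ((T y x - T t x) /\<^sub>R (y - t) - T t ?z)) \<longlongrightarrow> 0) ?F"
    by (rule tendsto_norm_zero)
  moreover have "norm ((T y x - T t x) /\<^sub>R (y - t) - T t ?z) = norm (T y x - T t x - (y - t) *\<^sub>R T t ?z) / norm (y - t)"
    if "y \<noteq> t" for y
  proof -
    have "(T y x - T t x) /\<^sub>R (y - t) - T t ?z = (T y x - T t x - (y - t) *\<^sub>R T t ?z) /\<^sub>R (y - t)"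
      using that by (simp add: scaleR_diff_right)
    then show ?thesis by (simp add: divide_inverse mult.commute)
  qed
  then have "\<forall>\<^sub>F y in ?F. norm ((T y x - T t x) /\<^sub>R (y - t) - T t ?z) = norm (T y x - T t x - (y - t) *\<^sub>R T t ?z) / norm (y - t)"
    by (auto simp: eventually_at_filter)
  ultimately have "((\<lambda>y. norm (T y x - T t x - (y - t) *\<^sub>R T t ?z) / norm (y - t)) \<longlongrightarrow> 0) ?F"
    by (rule Lim_transform_eventually)
  then show ?thesis
    by (simp add: has_vector_derivative_def has_derivative_iff_norm bounded_linear_scaleR_left)
qed

lemma functional_orbit:
  assumes \<xi>: "contractive_functional \<xi>"
  shows "continuous_on {0..} (\<lambda>t. \<xi> (T t y))" and "t \<ge> 0 \<Longrightarrow> cmod (\<xi> (T t y)) \<le> M * norm y"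
    and "x \<in> dom A \<Longrightarrow> t > 0 \<Longrightarrow> ((\<lambda>t. \<xi> (T t x)) has_vector_derivative \<xi> (T t (the (A x)))) (at t)"
proof -
  show "continuous_on {0..} (\<lambda>t. \<xi> (T t y))"
    by (rule bounded_linear.continuous_on[OF contractive_functionalD(4)[OF \<xi>] strong_continuity])
  show "t \<ge> 0 \<Longrightarrow> cmod (\<xi> (T t y)) \<le> M * norm y"
    using contractive_functionalD(3)[OF \<xi>, of "T t y"] T_norm[of t y] by linarith
  assume "x \<in> dom A" "t > 0"
  then have "((\<lambda>t. T t x) has_vector_derivative T t (the (A x))) (at t within {0..})"
    by (intro orbit_derivative) auto
  then have "((\<lambda>t. T t x) has_vector_derivative T t (the (A x))) (at t)"
    using \<open>t > 0\<close> by (simp add: at_within_interior[of t "{0..}"] interior_Ici)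
  then show "((\<lambda>t. \<xi> (T t x)) has_vector_derivative \<xi> (T t (the (A x)))) (at t)"
    by (rule bounded_linear.has_vector_derivative[OF contractive_functionalD(4)[OF \<xi>]])
qed

text \<open>The resolvent is the Laplace transform of the semigroup: integrate the derivative of
  \<open>e\<^sup>-\<^sup>l\<^sup>t T(t) R(l) y\<close> over the half-line.\<close>

lemma resolvent_laplace:
  assumes \<xi>: "contractive_functional \<xi>" and l: "l \<in> resolvent_set A" "Re l > 0"
  shows "\<xi> (resolvent l A y) = laplace_on {0<..} (\<lambda>t. \<xi> (T t y)) l"
proof -
  define x where "x = resolvent l A y"
  have x: "x \<in> dom A" "l *\<^sub>C x - the (A x) = y"
    unfolding x_def by (rule resolvent_inverse[OF l(1)])+
  let ?E = "\<lambda>t. exp (- (l * complex_of_real t))"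
  have cont: "isCont (\<lambda>t. \<xi> (T t z)) t" if "t > 0" for t z
    using functional_orbit(1)[OF \<xi>] that by (intro continuous_on_interior) (auto simp: interior_Ici)
  have "continuous_on {0<..} (\<lambda>t. \<xi> (T t y))"
    by (rule continuous_on_subset[OF functional_orbit(1)[OF \<xi>]]) auto
  then have int: "set_integrable lborel {0<..} (\<lambda>t. ?E t * \<xi> (T t y))"
    by (intro laplace_on_integrable[where C = "M * norm y" and b = 0] set_borel_measurable_continuous_open)
      (use functional_orbit(2)[OF \<xi>, of _ y] M_nonneg l(2) in auto)
  have "(LBINT t=ereal 0..\<infinity>. ?E t * \<xi> (T t y)) = 0 - - (?E 0 * \<xi> (T 0 x))"
  proof (rule interval_integral_FTC_integrable[where F = "\<lambda>t. - (?E t * \<xi> (T t x))"])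
    fix t assume "ereal 0 < ereal t"
    then have t: "t > 0" by simp
    have "(?E has_vector_derivative (- l * ?E t)) (at t)"
      by (rule has_vector_derivative_real_field) (auto intro!: derivative_eq_intros)
    from has_vector_derivative_minus[OF has_vector_derivative_mult[OF this functional_orbit(3)[OF \<xi> x(1) t]]]
    have "((\<lambda>t. - (?E t * \<xi> (T t x))) has_vector_derivative
        - (?E t * \<xi> (T t (the (A x))) + (- l * ?E t) * \<xi> (T t x))) (at t)" .
    also have "- (?E t * \<xi> (T t (the (A x))) + (- l * ?E t) * \<xi> (T t x)) = ?E t * \<xi> (T t y)"
    proof -
      have "the (A x) = l *\<^sub>C x - y" unfolding x(2)[symmetric] by simp
      then have eq: "\<xi> (T t (the (A x))) = l * \<xi> (T t x) - \<xi> (T t y)"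
        using T_scaleC[of t l x] t
        by (simp only: blinfun.diff_right contractive_functionalD(2,6)[OF \<xi>])
      show ?thesis unfolding eq by (simp add: algebra_simps)
    qed
    finally show "((\<lambda>t. - (?E t * \<xi> (T t x))) has_vector_derivative ?E t * \<xi> (T t y)) (at t)" .
    show "isCont (\<lambda>t. ?E t * \<xi> (T t y)) t" using cont[OF t] by (intro continuous_intros)
  next
    show "set_integrable lborel (einterval (ereal 0) \<infinity>) (\<lambda>t. ?E t * \<xi> (T t y))" using int by simp
    have "((\<lambda>t. \<xi> (T t x)) \<longlongrightarrow> \<xi> (T 0 x)) (at 0 within {0..})"
      using functional_orbit(1)[OF \<xi>, of x] by (auto simp: continuous_on_def)
    then have "((\<lambda>t. \<xi> (T t x)) \<longlongrightarrow> \<xi> (T 0 x)) (at_right 0)" by (rule tendsto_within_subset) auto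
    then have "((\<lambda>t. - (?E t * \<xi> (T t x))) \<longlongrightarrow> - (?E 0 * \<xi> (T 0 x))) (at_right 0)"
      by (intro tendsto_intros)
    then show "(((\<lambda>t. - (?E t * \<xi> (T t x))) \<circ> real_of_ereal) \<longlongrightarrow> - (?E 0 * \<xi> (T 0 x))) (at_right (ereal 0))"
      by (simp add: ereal_tendsto_simps)
    have "filterlim (\<lambda>t. Re l * t) at_top at_top"
      using l by (intro filterlim_tendsto_pos_mult_at_top[OF tendsto_const]) (auto intro: filterlim_ident)
    then have "((\<lambda>t. exp (- (Re l * t))) \<longlongrightarrow> 0) at_top"
      by (intro filterlim_compose[OF exp_at_bot]) (simp add: filterlim_uminus_at_bot)
    then have "((\<lambda>t. exp (- (Re l * t)) * (M * norm x)) \<longlongrightarrow> 0 * (M * norm x)) at_top"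
      by (intro tendsto_mult tendsto_const)
    then have lim: "((\<lambda>t. exp (- (Re l * t)) * (M * norm x)) \<longlongrightarrow> 0) at_top" by simp
    have "((\<lambda>t. - (?E t * \<xi> (T t x))) \<longlongrightarrow> 0) at_top"
    proof (rule Lim_null_comparison[OF _ lim])
      show "\<forall>\<^sub>F t in at_top. norm (- (?E t * \<xi> (T t x))) \<le> exp (- (Re l * t)) * (M * norm x)"
        using eventually_ge_at_top[of 0]
        by eventually_elim (use functional_orbit(2)[OF \<xi>] in \<open>auto simp: norm_mult intro!: mult_left_mono\<close>)
    qed
    then show "(((\<lambda>t. - (?E t * \<xi> (T t x))) \<circ> real_of_ereal) \<longlongrightarrow> 0) (at_left \<infinity>)"
      by (simp add: ereal_tendsto_simps)
  qed simp
  then show ?thesis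
    by (simp add: interval_integral_to_infinity_eq laplace_on_def T_zero x_def)
qed

lemma resolvent_bound:
  assumes l: "l \<in> resolvent_set A" "Re l > 0"
  shows "norm (resolvent l A) \<le> M / Re l"
proof (rule norm_blinfun_bound)
  show "M / Re l \<ge> 0" using M_nonneg l by simp
  fix y
  have "cmod (\<xi> (resolvent l A y)) \<le> M / Re l * norm y" if \<xi>: "contractive_functional \<xi>" for \<xi>
  proof -
    have "continuous_on {0<..} (\<lambda>t. \<xi> (T t y))"
      by (rule continuous_on_subset[OF functional_orbit(1)[OF \<xi>]]) auto
    then have "cmod (laplace_on {0<..} (\<lambda>t. \<xi> (T t y)) l) \<le> M * norm y / (Re l - 0)"
      using functional_orbit(2)[OF \<xi>] M_nonneg l(2)
      by (intro laplace_on_bound set_borel_measurable_continuous_open) auto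
    then show ?thesis unfolding resolvent_laplace[OF \<xi> l] by simp
  qed
  then show "norm (resolvent l A y) \<le> M / Re l * norm y" by (rule norm_le_of_functionals)
qed

text \<open>By the bound above, resolvent points cannot accumulate at a spectral point with positive
  real part, so the resolvent set is closed in the open right half-plane.\<close>

lemma right_half_plane_resolvent:
  assumes k: "k \<in> resolvent_set A" "Re k > 0"
  shows "{l. Re l > 0} \<subseteq> resolvent_set A"
proof -
  let ?H = "{l. Re l > 0}"
  have "openin (top_of_set ?H) (?H \<inter> resolvent_set A)"
    by (intro openin_open_Int resolvent_set_open)
  moreover have "closedin (top_of_set ?H) (?H \<inter> resolvent_set A)"
    unfolding closedin_limpt
  proof (intro conjI allI impI)
    fix l assume l: "l islimpt ?H \<inter> resolvent_set A \<and> l \<in> ?H"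
    \<comment> \<open>Within distance \<open>Re l / 2\<close> the resolvent is at most \<open>2 M / Re l\<close>, so the second bound makes the
      Neumann series reach \<open>l\<close>.\<close>
    define e where "e = min (Re l / 2) (Re l / (4 * (M + 1)))"
    have e: "e > 0" using l M_nonneg by (simp add: e_def)
    then obtain j where j: "j \<in> resolvent_set A" "dist j l < e"
      using l by (auto simp: islimpt_approachable)
    have "\<bar>Re (l - j)\<bar> \<le> cmod (l - j)" by (rule abs_Re_le_cmod)
    moreover have "cmod (l - j) < Re l / 2" using j(2) by (simp add: dist_norm norm_minus_commute e_def)
    ultimately have Rj: "Re j \<ge> Re l / 2" by simp
    have "cmod (l - j) * norm (resolvent j A) \<le> Re l / (4 * (M + 1)) * (M / (Re l / 2))"
    proof (rule mult_mono)
      show "cmod (l - j) \<le> Re l / (4 * (M + 1))" using j(2) by (simp add: dist_norm norm_minus_commute e_def)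
      have "norm (resolvent j A) \<le> M / Re j" using resolvent_bound[OF j(1)] Rj l by simp
      also have "\<dots> \<le> M / (Re l / 2)" using Rj l M_nonneg by (intro divide_left_mono) auto
      finally show "norm (resolvent j A) \<le> M / (Re l / 2)" .
    qed (use l M_nonneg in auto)
    also have "\<dots> = M / (2 * (M + 1))" using l M_nonneg by (simp add: divide_simps)
    also have "\<dots> \<le> 1 / 2" using M_nonneg by (simp add: divide_simps)
    finally show "l \<in> ?H \<inter> resolvent_set A" using resolvent_perturbation(1)[OF j(1)] l by auto
  qed simp
  moreover have "connected ?H" by (intro convex_connected convex_halfspace_Re_gt)
  ultimately have "?H \<inter> resolvent_set A = {} \<or> ?H \<inter> resolvent_set A = ?H"
    by (auto simp: connected_clopen)
  then show ?thesis using k by auto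
qed

end

section \<open>Asymptotically analytic semigroups\<close>

text \<open>The holomorphic approximation, on a wedge and with named constants: \<open>C\<close> and \<open>\<omega>\<close> for the growth
  of \<open>S\<close>, and \<open>M1\<close> and \<open>\<delta>\<close> for the decay of \<open>T - S\<close>. The bound \<open>c \<le> 1\<close> keeps points of the
  wedge comparable in size to their real parts.\<close>

locale asymptotically_analytic_semigroup = bounded_C0_semigroup T M
  for T :: "real \<Rightarrow> 'a::complex_banach \<Rightarrow>\<^sub>L 'a" and M +
  fixes S :: "complex \<Rightarrow> 'a \<Rightarrow>\<^sub>L 'a" and c C \<omega> \<delta> M1 :: real
  assumes c: "0 < c" "c \<le> 1" and C: "C \<ge> 0" and \<omega>: "\<omega> \<ge> 0" and \<delta>: "\<delta> > 0" and M1: "M1 \<ge> 0"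
    and S_deriv: "\<And>z. z \<in> wedge c \<Longrightarrow> \<exists>D. (S has_derivative (\<lambda>h. h *\<^sub>C D)) (at z within wedge c)"
    and S_le: "\<And>z. z \<in> wedge c \<Longrightarrow> norm (S z) \<le> C * exp (\<omega> * cmod z)"
    and approx: "\<And>t. t > 0 \<Longrightarrow> norm (T t - S (of_real t)) \<le> M1 * exp (- (\<delta> * t))"
    and axis: "\<And>s. s \<noteq> 0 \<Longrightarrow> \<i> * of_real s \<in> resolvent_set (generator T)"
begin

definition analytic_part :: "('a \<Rightarrow> complex) \<Rightarrow> 'a \<Rightarrow> complex \<Rightarrow> complex" where
  "analytic_part \<xi> y z = \<xi> (S z y)"

definition remainder :: "('a \<Rightarrow> complex) \<Rightarrow> 'a \<Rightarrow> real \<Rightarrow> complex" where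
  "remainder \<xi> y t = \<xi> (T t y) - analytic_part \<xi> y (of_real t)"

text \<open>In the right half-plane this is the Laplace transform of the analytic part on the half-line.
  The formula makes sense on the resolvent set, as far to the left as \<open>- \<delta>\<close>.\<close>

definition continued_transform :: "('a \<Rightarrow> complex) \<Rightarrow> 'a \<Rightarrow> complex \<Rightarrow> complex" where
  "continued_transform \<xi> y z = \<xi> (resolvent z A y) - laplace_on {0<..} (remainder \<xi> y) z"

text \<open>One resolvent point in the right half-plane suffices, and \<open>\<i>\<close> has such points near it.\<close>

lemma half_plane: "Re z > 0 \<Longrightarrow> z \<in> resolvent_set A"
proof -
  have "\<i> * of_real 1 \<in> resolvent_set A" by (rule axis) simp
  then obtain e where e: "e > 0" "ball \<i> e \<subseteq> resolvent_set A"
    using resolvent_set_open[of A] by (auto simp: open_contains_ball)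
  have "\<i> + of_real (e / 2) \<in> ball \<i> e" using e by (simp add: dist_norm)
  then have "\<i> + of_real (e / 2) \<in> resolvent_set A" using e by blast
  then show "Re z > 0 \<Longrightarrow> z \<in> resolvent_set A"
    using right_half_plane_resolvent[of "\<i> + of_real (e / 2)"] e by auto
qed

lemma real_in_wedge: "t > 0 \<Longrightarrow> of_real t \<in> wedge c"
  using c by (simp add: wedge_def)

context
  fixes \<xi> :: "'a \<Rightarrow> complex" and y :: 'a
  assumes \<xi>: "contractive_functional \<xi>"
begin

lemma analytic_part_holomorphic: "analytic_part \<xi> y holomorphic_on wedge c"
  unfolding holomorphic_on_def
proof
  fix z assume z: "z \<in> wedge c"
  obtain D where D: "(S has_derivative (\<lambda>h. h *\<^sub>C D)) (at z within wedge c)"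
    using S_deriv[OF z] by blast
  have bl: "bounded_linear (\<lambda>F. \<xi> (blinfun_apply F y))"
    by (rule bounded_linear_compose[OF contractive_functionalD(4)[OF \<xi>] blinfun.bounded_linear_left])
  have "((\<lambda>z. \<xi> (S z y)) has_derivative (\<lambda>h. \<xi> (blinfun_apply (h *\<^sub>C D) y))) (at z within wedge c)"
    by (rule bounded_linear.has_derivative[OF bl D])
  moreover have "(\<lambda>h. \<xi> (blinfun_apply (h *\<^sub>C D) y)) = (\<lambda>h. \<xi> (D y) * h)"
    by (simp add: scaleC_blinfun_apply contractive_functionalD(2)[OF \<xi>] mult.commute)
  ultimately have "(analytic_part \<xi> y has_field_derivative \<xi> (D y)) (at z within wedge c)"
    unfolding has_field_derivative_def analytic_part_def[abs_def] by simp
  then show "analytic_part \<xi> y field_differentiable at z within wedge c"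
    by (auto simp: field_differentiable_def)
qed

lemma analytic_part_le: "z \<in> wedge c \<Longrightarrow> cmod (analytic_part \<xi> y z) \<le> (C * norm y) * exp (\<omega> * cmod z)"
proof -
  assume z: "z \<in> wedge c"
  have "cmod (analytic_part \<xi> y z) \<le> norm (S z) * norm y"
    unfolding analytic_part_def by (rule order_trans[OF contractive_functionalD(3)[OF \<xi>] norm_blinfun])
  also have "\<dots> \<le> C * exp (\<omega> * cmod z) * norm y" by (intro mult_right_mono S_le z) auto
  finally show ?thesis by (simp add: mult_ac)
qed

lemma analytic_part_isCont: "z \<in> wedge c \<Longrightarrow> isCont (analytic_part \<xi> y) z"
  using holomorphic_on_imp_continuous_on[OF analytic_part_holomorphic]
  by (simp add: continuous_on_eq_continuous_at[OF wedge_open])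

lemma analytic_part_real_isCont: "t > 0 \<Longrightarrow> isCont (\<lambda>t. analytic_part \<xi> y (of_real t)) t"
  by (rule isCont_o2[where f = of_real and g = "analytic_part \<xi> y"])
    (intro continuous_intros, rule analytic_part_isCont[OF real_in_wedge])

lemma remainder_continuous: "continuous_on {0<..} (remainder \<xi> y)"
proof -
  have "continuous_on {0<..} (\<lambda>t. \<xi> (T t y))"
    by (rule continuous_on_subset[OF functional_orbit(1)[OF \<xi>]]) auto
  moreover have "continuous_on {0<..} (\<lambda>t. analytic_part \<xi> y (of_real t))"
    using analytic_part_real_isCont by (auto intro!: continuous_at_imp_continuous_on)
  ultimately show ?thesis unfolding remainder_def[abs_def] by (rule continuous_on_diff)
qed

lemma remainder_le: "t > 0 \<Longrightarrow> cmod (remainder \<xi> y t) \<le> (M1 * norm y) * exp (- \<delta> * t)"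
proof -
  assume t: "t > 0"
  have "remainder \<xi> y t = \<xi> ((T t - S (of_real t)) y)"
    by (simp add: remainder_def analytic_part_def blinfun.diff_left contractive_functionalD(6)[OF \<xi>])
  then have "cmod (remainder \<xi> y t) \<le> norm (T t - S (of_real t)) * norm y"
    by (simp only:) (rule order_trans[OF contractive_functionalD(3)[OF \<xi>] norm_blinfun])
  also have "\<dots> \<le> M1 * exp (- (\<delta> * t)) * norm y" by (intro mult_right_mono approx t) auto
  finally show ?thesis by (simp add: mult_ac)
qed

lemma remainder_measurable: "set_borel_measurable lborel {0<..} (remainder \<xi> y)"
  by (rule set_borel_measurable_continuous_open[OF open_greaterThan remainder_continuous])

lemma remainder_transform_holomorphic: "laplace_on {0<..} (remainder \<xi> y) holomorphic_on {z. - \<delta> < Re z}"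
  using remainder_le M1
  by (intro laplace_on_holomorphic[where C = "M1 * norm y", OF _ _ remainder_measurable]) auto

lemma remainder_transform_le: "- \<delta> < Re z \<Longrightarrow> cmod (laplace_on {0<..} (remainder \<xi> y) z) \<le> M1 * norm y / (Re z + \<delta>)"
  using laplace_on_bound[OF _ _ remainder_measurable, of "M1 * norm y" "- \<delta>" z] remainder_le M1 by simp

lemma analytic_part_bounded: "t > 0 \<Longrightarrow> cmod (analytic_part \<xi> y (of_real t)) \<le> (M + M1) * norm y"
proof -
  assume t: "t > 0"
  have "analytic_part \<xi> y (of_real t) = \<xi> (T t y) - remainder \<xi> y t" by (simp add: remainder_def)
  then have "cmod (analytic_part \<xi> y (of_real t)) \<le> cmod (\<xi> (T t y)) + cmod (remainder \<xi> y t)"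
    by (simp only: norm_triangle_ineq4)
  also have "cmod (remainder \<xi> y t) \<le> (M1 * norm y) * 1"
    using t \<delta> M1 by (intro order_trans[OF remainder_le[OF t]] mult_left_mono) auto
  also have "cmod (\<xi> (T t y)) \<le> M * norm y" using functional_orbit(2)[OF \<xi>] t by simp
  finally show ?thesis by (simp add: distrib_right)
qed

lemma continued_transform_holomorphic:
  "continued_transform \<xi> y holomorphic_on (resolvent_set A \<inter> {z. - \<delta> < Re z})"
  unfolding continued_transform_def[abs_def]
  by (intro holomorphic_on_diff holomorphic_on_subset[OF resolvent_functional_holomorphic[OF \<xi>]]
      holomorphic_on_subset[OF remainder_transform_holomorphic]) auto

lemma continued_transform_eq:
  assumes "Re z > 0"
  shows "continued_transform \<xi> y z = laplace_on {0<..} (\<lambda>t. analytic_part \<xi> y (of_real t)) z"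
proof -
  have "continuous_on {0<..} (\<lambda>t. \<xi> (T t y))"
    by (rule continuous_on_subset[OF functional_orbit(1)[OF \<xi>]]) auto
  then have i1: "set_integrable lborel {0<..} (\<lambda>t. exp (- (z * of_real t)) * \<xi> (T t y))"
    by (intro laplace_on_integrable[where C = "M * norm y" and b = 0] set_borel_measurable_continuous_open)
      (use functional_orbit(2)[OF \<xi>, of _ y] M_nonneg assms in auto)
  have i2: "set_integrable lborel {0<..} (\<lambda>t. exp (- (z * of_real t)) * remainder \<xi> y t)"
    by (rule laplace_on_integrable[where C = "M1 * norm y" and b = "- \<delta>", OF _ _ remainder_measurable])
      (use remainder_le M1 assms \<delta> in auto)
  have "continued_transform \<xi> y z
      = (LINT t:{0<..}|lborel. exp (- (z * of_real t)) * \<xi> (T t y) - exp (- (z * of_real t)) * remainder \<xi> y t)"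
    unfolding continued_transform_def resolvent_laplace[OF \<xi> half_plane[OF assms] assms]
    using set_integral_diff(2)[OF i1 i2] by (simp add: laplace_on_def)
  also have "\<dots> = laplace_on {0<..} (\<lambda>t. analytic_part \<xi> y (of_real t)) z"
    unfolding laplace_on_def by (intro set_lebesgue_integral_cong) (auto simp: remainder_def algebra_simps)
  finally show ?thesis .
qed

end

text \<open>The sign \<open>\<sigma> = \<plusminus>1\<close> selects the upper or the lower half-plane; the half-line is rotated
  clockwise for the upper one.\<close>

definition direction :: "real \<Rightarrow> complex" where
  "direction \<sigma> = Complex 1 (- \<sigma> * (c / 2))"

definition rotated_transform :: "('a \<Rightarrow> complex) \<Rightarrow> 'a \<Rightarrow> real \<Rightarrow> complex \<Rightarrow> complex" where
  "rotated_transform \<xi> y \<sigma> z = direction \<sigma> *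
     laplace_on {0<..} (\<lambda>t. analytic_part \<xi> y (of_real t * direction \<sigma>)) (z * direction \<sigma>)"

context
  fixes \<sigma> :: real
  assumes \<sigma>: "\<bar>\<sigma>\<bar> = 1"
begin

lemma direction_facts:
  shows "\<bar>Im (direction \<sigma>)\<bar> = c / 2" "Re (direction \<sigma>) = 1" "cmod (direction \<sigma>) \<le> 2"
    "Re (z * direction \<sigma>) = Re z + c / 2 * (\<sigma> * Im z)"
    "t > 0 \<Longrightarrow> of_real t * direction \<sigma> \<in> wedge c"
proof -
  show im: "\<bar>Im (direction \<sigma>)\<bar> = c / 2" using \<sigma> c by (simp add: direction_def abs_mult)
  show re: "Re (direction \<sigma>) = 1" by (simp add: direction_def)
  show "cmod (direction \<sigma>) \<le> 2" using cmod_le[of "direction \<sigma>"] im re c by simp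
  show "Re (z * direction \<sigma>) = Re z + c / 2 * (\<sigma> * Im z)" by (simp add: direction_def)
  show "t > 0 \<Longrightarrow> of_real t * direction \<sigma> \<in> wedge c"
    using im re c by (simp add: wedge_def abs_mult)
qed

lemma convex_rotated_half_plane: "convex {z. a < Re (z * direction \<sigma>)}" "open {z. a < Re (z * direction \<sigma>)}"
proof -
  have "{z. a < Re (z * direction \<sigma>)} = {z. Complex 1 (c / 2 * \<sigma>) \<bullet> z > a}"
    by (simp only: direction_facts(4)) (simp add: inner_complex_def mult_ac)
  then show "convex {z. a < Re (z * direction \<sigma>)}" by (simp only: convex_halfspace_gt)
  show "open {z. a < Re (z * direction \<sigma>)}"
    by (intro open_Collect_less continuous_intros)
qed

end

context
  fixes \<xi> :: "'a \<Rightarrow> complex" and y :: 'a and \<sigma> :: real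
  assumes \<xi>: "contractive_functional \<xi>" and \<sigma>: "\<bar>\<sigma>\<bar> = 1"
begin

lemma rotated_le: "t > 0 \<Longrightarrow> cmod (analytic_part \<xi> y (of_real t * direction \<sigma>)) \<le> (C * norm y) * exp (2 * \<omega> * t)"
proof -
  assume t: "t > 0"
  have "cmod (of_real t * direction \<sigma>) \<le> 2 * t"
    using direction_facts(3)[OF \<sigma>] t by (simp add: norm_mult)
  then have "\<omega> * cmod (of_real t * direction \<sigma>) \<le> \<omega> * (2 * t)" using \<omega> by (rule mult_left_mono)
  then have "(C * norm y) * exp (\<omega> * cmod (of_real t * direction \<sigma>)) \<le> (C * norm y) * exp (2 * \<omega> * t)"
    using C by (intro mult_left_mono) auto
  then show ?thesis using analytic_part_le[OF \<xi> direction_facts(5)[OF \<sigma> t], of y] by linarith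
qed

lemma rotated_measurable: "set_borel_measurable lborel {0<..} (\<lambda>t. analytic_part \<xi> y (of_real t * direction \<sigma>))"
proof -
  have "isCont (\<lambda>t. analytic_part \<xi> y (of_real t * direction \<sigma>)) t" if "t > 0" for t
    by (rule isCont_o2[where f = "\<lambda>t. of_real t * direction \<sigma>" and g = "analytic_part \<xi> y"])
      (intro continuous_intros, rule analytic_part_isCont[OF \<xi> direction_facts(5)[OF \<sigma> that]])
  then show ?thesis
    by (intro set_borel_measurable_continuous_open) (auto intro!: continuous_at_imp_continuous_on)
qed

lemma rotated_transform_holomorphic:
  "rotated_transform \<xi> y \<sigma> holomorphic_on {z. 2 * \<omega> < Re (z * direction \<sigma>)}"
proof -
  have lap: "laplace_on {0<..} (\<lambda>t. analytic_part \<xi> y (of_real t * direction \<sigma>)) holomorphic_on {z. 2 * \<omega> < Re z}"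
    using rotated_le C
    by (intro laplace_on_holomorphic[where C = "C * norm y", OF _ _ rotated_measurable]) auto
  have "(laplace_on {0<..} (\<lambda>t. analytic_part \<xi> y (of_real t * direction \<sigma>)) \<circ> (\<lambda>z. z * direction \<sigma>))
      holomorphic_on {z. 2 * \<omega> < Re (z * direction \<sigma>)}"
    by (rule holomorphic_on_compose_gen[OF _ lap]) (auto intro!: holomorphic_intros)
  then show ?thesis
    unfolding rotated_transform_def[abs_def] o_def by (intro holomorphic_on_mult holomorphic_on_const)
qed

lemma rotated_transform_le:
  assumes "2 * \<omega> < Re (z * direction \<sigma>)"
  shows "cmod (rotated_transform \<xi> y \<sigma> z) \<le> 2 * (C * norm y / (Re (z * direction \<sigma>) - 2 * \<omega>))"
  unfolding rotated_transform_def norm_mult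
proof (rule mult_mono[OF direction_facts(3)[OF \<sigma>]])
  show "cmod (laplace_on {0<..} (\<lambda>t. analytic_part \<xi> y (of_real t * direction \<sigma>)) (z * direction \<sigma>))
      \<le> C * norm y / (Re (z * direction \<sigma>) - 2 * \<omega>)"
    using rotated_le C assms by (intro laplace_on_bound[OF _ _ rotated_measurable]) auto
qed auto

text \<open>Contour rotation proves the identity where both exponentials decay fast, and analytic continuation
  extends it to the part of the right half-plane where both sides are holomorphic.\<close>

lemma transforms_agree_right:
  assumes z: "Re z > 0" "2 * \<omega> < Re (z * direction \<sigma>)"
  shows "continued_transform \<xi> y z = rotated_transform \<xi> y \<sigma> z"
proof -
  let ?W = "{z. Re z > 0} \<inter> {z. 2 * \<omega> < Re (z * direction \<sigma>)}"
  let ?V = "{z. 2 * \<omega> + 1 < Re z} \<inter> {z. 2 * \<omega> + 1 < Re (z * direction \<sigma>)}"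
  let ?D = "\<lambda>z. continued_transform \<xi> y z - rotated_transform \<xi> y \<sigma> z"
  define p where "p = of_real (2 * \<omega> + 2) + \<i> * of_real \<sigma>"
  have "\<sigma> * \<sigma> = 1" using \<sigma> by (metis abs_mult_self_eq mult_1)
  then have "Re (p * direction \<sigma>) = 2 * \<omega> + 2 + c / 2"
    by (simp only: direction_facts(4)[OF \<sigma>]) (simp add: p_def)
  moreover have "Re p = 2 * \<omega> + 2" by (simp add: p_def)
  ultimately have pV: "p \<in> ?V" using \<omega> c by (simp only: Int_iff mem_Collect_eq) simp
  have V: "open ?V" by (intro open_Int convex_rotated_half_plane[OF \<sigma>] open_halfspace_Re_gt)
  have "?D z = 0"
  proof (rule analytic_continuation[where S = ?W and U = ?V and \<xi> = p and f = ?D])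
    show "?D holomorphic_on ?W"
      using half_plane \<delta>
      by (intro holomorphic_on_diff holomorphic_on_subset[OF continued_transform_holomorphic[OF \<xi>]]
          holomorphic_on_subset[OF rotated_transform_holomorphic]) auto
    show "open ?W" by (intro open_Int convex_rotated_half_plane[OF \<sigma>] open_halfspace_Re_gt)
    show "connected ?W" by (intro convex_connected convex_Int convex_rotated_half_plane[OF \<sigma>] convex_halfspace_Re_gt)
    show "?V \<subseteq> ?W" using \<omega> by auto
    then show "p \<in> ?W" using pV by blast
    show "p islimpt ?V" by (rule interior_limit_point) (simp only: interior_open[OF V] pV)
    show "z \<in> ?W" using z by simp
    fix v assume v: "v \<in> ?V"
    have "laplace_on {0<..} (\<lambda>t. analytic_part \<xi> y (of_real t)) v = rotated_transform \<xi> y \<sigma> v"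
      unfolding rotated_transform_def
      by (rule laplace_rotate[OF analytic_part_holomorphic[OF \<xi>] analytic_part_le[OF \<xi>] \<omega>])
        (use C v c direction_facts[OF \<sigma>] in auto)
    then show "?D v = 0" using continued_transform_eq[OF \<xi>, of v y] v \<omega> by simp
  qed
  then show ?thesis by simp
qed

end

section \<open>The resolvent and the transform near the imaginary axis\<close>

text \<open>For \<open>\<bar>Im z\<bar>\<close> above \<open>high_frequency\<close> the rotated exponential beats the growth of \<open>S\<close>, and the
  resolvent is bounded in the right half-plane. The width of the strip is chosen so that the Neumann
  series converges across the axis, from \<open>strip_width\<close> to \<open>- strip_width\<close>.\<close>

definition high_resolvent_bound :: real where "high_resolvent_bound = 2 * C + M1 / \<delta>"
definition strip_width :: real where "strip_width = 1 / (4 * high_resolvent_bound + 4)"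
definition high_frequency :: real where "high_frequency = 4 * (2 * \<omega> + 1) / c"

lemma constants: "high_resolvent_bound \<ge> 0" "strip_width > 0" "strip_width \<le> 1" "2 * strip_width * high_resolvent_bound \<le> 1 / 2" "high_frequency > 0"
proof -
  show K: "high_resolvent_bound \<ge> 0" using C M1 \<delta> by (simp add: high_resolvent_bound_def)
  show "strip_width > 0" "strip_width \<le> 1" using K by (simp_all add: strip_width_def)
  show "2 * strip_width * high_resolvent_bound \<le> 1 / 2" using K by (simp add: strip_width_def field_simps)
  show "high_frequency > 0" using c \<omega> by (simp add: high_frequency_def)
qed

lemma sgn_Im: "Im z \<noteq> 0 \<Longrightarrow> \<bar>sgn (Im z)\<bar> = 1" "sgn (Im z) * Im z = \<bar>Im z\<bar>"
  by (simp_all add: abs_sgn_eq mult.commute flip: abs_sgn)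

text \<open>In the right half-plane the resolvent is the rotated transform plus the transform of the remainder.
  The bound is uniform up to the imaginary axis, whereas the bound from the semigroup alone is not.\<close>

lemma resolvent_bounded_high:
  assumes z: "Re z > 0" "2 * \<omega> + 1 \<le> c / 2 * \<bar>Im z\<bar>"
  shows "norm (resolvent z A) \<le> high_resolvent_bound"
proof (rule norm_blinfun_bound[OF constants(1)])
  fix y
  have "Im z \<noteq> 0" using z \<omega> by auto
  note \<sigma> = sgn_Im(1)[OF this]
  show "norm (resolvent z A y) \<le> high_resolvent_bound * norm y"
  proof (rule norm_le_of_functionals)
    fix \<xi> :: "'a \<Rightarrow> complex" assume \<xi>: "contractive_functional \<xi>"
    have re: "2 * \<omega> + 1 \<le> Re (z * direction (sgn (Im z)))"
      unfolding direction_facts(4)[OF \<sigma>] sgn_Im(2) using z by simp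
    have "continued_transform \<xi> y z = rotated_transform \<xi> y (sgn (Im z)) z"
      using re z by (intro transforms_agree_right[OF \<xi> \<sigma>]) auto
    then have "cmod (continued_transform \<xi> y z) \<le> 2 * (C * norm y / (Re (z * direction (sgn (Im z))) - 2 * \<omega>))"
      using rotated_transform_le[OF \<xi> \<sigma>, of z y] re by simp
    also have "\<dots> \<le> 2 * (C * norm y / 1)"
      using re C by (intro mult_left_mono divide_left_mono) auto
    finally have F: "cmod (continued_transform \<xi> y z) \<le> 2 * C * norm y" by simp
    have "cmod (laplace_on {0<..} (remainder \<xi> y) z) \<le> M1 * norm y / (Re z + \<delta>)"
      using remainder_transform_le[OF \<xi>] z \<delta> by simp
    also have "\<dots> \<le> M1 * norm y / \<delta>" using z \<delta> M1 by (intro divide_left_mono) auto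
    finally have d: "cmod (laplace_on {0<..} (remainder \<xi> y) z) \<le> M1 / \<delta> * norm y" by simp
    have "\<xi> (resolvent z A y) = continued_transform \<xi> y z + laplace_on {0<..} (remainder \<xi> y) z"
      by (simp add: continued_transform_def)
    then show "cmod (\<xi> (resolvent z A y)) \<le> high_resolvent_bound * norm y"
      using norm_triangle_ineq[of "continued_transform \<xi> y z"] F d
      unfolding high_resolvent_bound_def distrib_right by (smt (verit))
  qed
qed

text \<open>The Neumann series from the line \<open>Re z = strip_width\<close>, where the resolvent is already bounded.\<close>

lemma strip_resolvent:
  assumes z: "\<bar>Re z\<bar> \<le> strip_width" "2 * \<omega> + 1 \<le> c / 2 * \<bar>Im z\<bar>"
  shows "z \<in> resolvent_set A"
proof -
  let ?k = "Complex strip_width (Im z)"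
  have k: "?k \<in> resolvent_set A" using half_plane constants(2) by simp
  have nk: "norm (resolvent ?k A) \<le> high_resolvent_bound" using resolvent_bounded_high[of ?k] z constants(2) by simp
  have "z - ?k = of_real (Re z - strip_width)" by (simp add: complex_eq_iff)
  then have "cmod (z - ?k) = \<bar>Re z - strip_width\<bar>" by (simp only: norm_of_real)
  also have "\<dots> \<le> 2 * strip_width" using z by linarith
  finally have "cmod (z - ?k) * norm (resolvent ?k A) \<le> 2 * strip_width * high_resolvent_bound"
    using nk constants by (intro mult_mono) auto
  then show ?thesis using resolvent_perturbation(1)[OF k] constants(4) by (meson order_trans)
qed

text \<open>The identity with the rotated transform continues from the right half-plane into the strip. There
  \<open>Re (z q) - 2 \<omega>\<close>, with \<open>q\<close> the rotated direction, grows linearly with \<open>\<bar>Im z\<bar>\<close>.\<close>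

lemma continued_transform_high:
  assumes \<xi>: "contractive_functional \<xi>" and z: "\<bar>Re z\<bar> < min strip_width \<delta>" "high_frequency < \<bar>Im z\<bar>"
  shows "cmod (continued_transform \<xi> y z) \<le> 8 * C / c * norm y / \<bar>Im z\<bar>"
proof -
  define e where "e = min strip_width \<delta>"
  have e: "0 < e" "e \<le> strip_width" "e \<le> \<delta>" "e \<le> 1" using constants \<delta> by (auto simp: e_def)
  have ze: "\<bar>Re z\<bar> < e" using z(1) by (simp add: e_def)
  define \<sigma> where "\<sigma> = sgn (Im z)"
  have Im0: "Im z \<noteq> 0" using z constants(5) by auto
  have \<sigma>: "\<bar>\<sigma>\<bar> = 1" "\<sigma> * Im z = \<bar>Im z\<bar>" "\<sigma> * \<sigma> = 1"
    using sgn_Im[of z] Im0 unfolding \<sigma>_def by (auto simp: sgn_mult_self_eq[symmetric] sgn_if)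
  let ?V = "{v. \<bar>Re v\<bar> < e \<and> high_frequency < \<sigma> * Im v}"
  let ?U = "{v. 0 < Re v} \<inter> ?V"
  have Veq: "?V = {v. - e < Re v} \<inter> {v. Re v < e} \<inter> {v. Complex 0 \<sigma> \<bullet> v > high_frequency}"
    by (auto simp: inner_complex_def)
  have openV: "open ?V" and convV: "convex ?V"
    unfolding Veq
    by (intro open_Int open_halfspace_Re_gt open_halfspace_Re_lt open_halfspace_gt,
        intro convex_Int convex_halfspace_Re_gt convex_halfspace_Re_lt convex_halfspace_gt)
  have openU: "open ?U" by (intro open_Int openV open_halfspace_Re_gt)
  have Im_le: "\<sigma> * Im v \<le> \<bar>Im v\<bar>" for v
    using \<sigma>(1) abs_ge_self[of "\<sigma> * Im v"] by (simp add: abs_mult)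
  have re: "c / 4 * (\<sigma> * Im v) \<le> Re (v * direction \<sigma>) - 2 * \<omega>" if v: "v \<in> ?V" for v
  proof -
    have "c / 4 * high_frequency \<le> c / 4 * (\<sigma> * Im v)" using v c by (intro mult_left_mono) auto
    then have "2 * \<omega> + 1 \<le> c / 4 * (\<sigma> * Im v)" using c by (simp add: high_frequency_def)
    moreover have "Re v \<ge> - 1" using v e by auto
    ultimately show ?thesis unfolding direction_facts(4)[OF \<sigma>(1)] by linarith
  qed
  have pos: "0 < c / 4 * (\<sigma> * Im v)" if "v \<in> ?V" for v
    by (rule mult_pos_pos) (use that c constants(5) in auto)
  have V_res: "v \<in> resolvent_set A" if v: "v \<in> ?V" for v
  proof (rule strip_resolvent)
    have "high_frequency \<le> \<bar>Im v\<bar>" using v Im_le[of v] by simp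
    then have "c / 4 * high_frequency \<le> c / 4 * \<bar>Im v\<bar>" using c by (intro mult_left_mono) auto
    then have "2 * \<omega> + 1 \<le> c / 4 * \<bar>Im v\<bar>" using c by (simp add: high_frequency_def)
    moreover have "0 \<le> c / 4 * \<bar>Im v\<bar>" using c by simp
    ultimately show "2 * \<omega> + 1 \<le> c / 2 * \<bar>Im v\<bar>" by simp
  qed (use v e in auto)
  define p where "p = Complex (e / 2) (\<sigma> * (high_frequency + 1))"
  have "\<sigma> * Im p = high_frequency + 1" using \<sigma>(3) by (simp add: p_def mult.assoc[symmetric])
  moreover have "Re p = e / 2" by (simp add: p_def)
  ultimately have pU: "p \<in> ?U" using e(1) by (simp only: Int_iff mem_Collect_eq) simp
  have "continued_transform \<xi> y z - rotated_transform \<xi> y \<sigma> z = 0"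
  proof (rule analytic_continuation[where S = ?V and U = ?U and \<xi> = p
        and f = "\<lambda>v. continued_transform \<xi> y v - rotated_transform \<xi> y \<sigma> v"])
    show "(\<lambda>v. continued_transform \<xi> y v - rotated_transform \<xi> y \<sigma> v) holomorphic_on ?V"
    proof (intro holomorphic_on_diff holomorphic_on_subset[OF continued_transform_holomorphic[OF \<xi>]]
          holomorphic_on_subset[OF rotated_transform_holomorphic[OF \<xi> \<sigma>(1)]] subsetI)
      fix v assume v: "v \<in> ?V"
      show "v \<in> resolvent_set A \<inter> {z. - \<delta> < Re z}" using V_res[OF v] v e by auto
      show "v \<in> {z. 2 * \<omega> < Re (z * direction \<sigma>)}" using re[OF v] pos[OF v] by simp
    qed
    show "open ?V" by (rule openV)
    show "connected ?V" by (rule convex_connected[OF convV])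
    show "?U \<subseteq> ?V" by auto
    then show "p \<in> ?V" using pU by blast
    show "p islimpt ?U" by (rule interior_limit_point) (simp only: interior_open[OF openU] pU)
    show "z \<in> ?V" using z ze \<sigma>(2) by simp
    fix v assume v: "v \<in> ?U"
    then have "0 < Re v" "v \<in> ?V" by auto
    moreover have "2 * \<omega> < Re (v * direction \<sigma>)" using re[of v] pos[of v] \<open>v \<in> ?V\<close> by linarith
    ultimately show "continued_transform \<xi> y v - rotated_transform \<xi> y \<sigma> v = 0"
      using transforms_agree_right[OF \<xi> \<sigma>(1), of v y] by (simp only: diff_self)
  qed
  then have eq: "continued_transform \<xi> y z = rotated_transform \<xi> y \<sigma> z" by simp
  have zV: "z \<in> ?V" using z ze \<sigma>(2) by simp
  have "cmod (continued_transform \<xi> y z) \<le> 2 * (C * norm y / (Re (z * direction \<sigma>) - 2 * \<omega>))"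
    unfolding eq using re[OF zV] pos[OF zV] by (intro rotated_transform_le[OF \<xi> \<sigma>(1)]) simp
  also have "\<dots> \<le> 2 * (C * norm y / (c / 4 * (\<sigma> * Im z)))"
  proof (intro mult_left_mono divide_left_mono)
    show "0 < (Re (z * direction \<sigma>) - 2 * \<omega>) * (c / 4 * (\<sigma> * Im z))"
      using re[OF zV] pos[OF zV] by (intro mult_pos_pos[OF _ pos[OF zV]]) linarith
  qed (use re[OF zV] C in auto)
  also have "\<dots> = 8 * C / c * norm y / \<bar>Im z\<bar>" unfolding \<sigma>(2) by simp
  finally show ?thesis .
qed

lemma axis_resolvent_bounded:
  assumes "r > 0"
  obtains Q where "Q \<ge> 1" "\<And>s. r \<le> \<bar>s\<bar> \<Longrightarrow> \<bar>s\<bar> \<le> R \<Longrightarrow> norm (resolvent (\<i> * of_real s) A) \<le> Q"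
proof -
  let ?K = "{s. r \<le> \<bar>s\<bar> \<and> \<bar>s\<bar> \<le> R}"
  have "?K = {- R..- r} \<union> {r..R}" using assms by auto
  then have "compact ?K" by (simp add: compact_Un)
  moreover have "continuous_on ?K (\<lambda>s. resolvent (\<i> * of_real s) A)"
    by (rule continuous_on_compose2[OF continuous_on_resolvent])
      (use axis assms in \<open>auto intro!: continuous_intros\<close>)
  ultimately have "bounded ((\<lambda>s. resolvent (\<i> * of_real s) A) ` ?K)"
    by (intro compact_imp_bounded compact_continuous_image)
  then obtain K where K: "\<And>s. s \<in> ?K \<Longrightarrow> norm (resolvent (\<i> * of_real s) A) \<le> K"
    by (auto simp: bounded_iff)
  show thesis
  proof (rule that[of "max 1 K"])
    show "norm (resolvent (\<i> * of_real s) A) \<le> max 1 K" if "r \<le> \<bar>s\<bar>" "\<bar>s\<bar> \<le> R" for s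
      using K[of s] that by simp
  qed simp
qed

text \<open>The region and the bound that the contour estimate needs, with explicit dependence on the size
  \<open>Q\<close> of the resolvent on the part of the imaginary axis between the distances \<open>r\<close> and \<open>1\<close> from the
  origin. High frequencies are covered by \<open>continued_transform_high\<close>, the others by the Neumann series
  from the axis, where compactness bounds the resolvent beyond distance \<open>1\<close>.\<close>

lemma transform_parameters:
  obtains c0 P0 :: real where "c0 > 0" "c0 \<le> 1 / 2" "P0 \<ge> 0"
    "\<And>r Q z. \<lbrakk>0 < r; Q \<ge> 1; \<And>s. r \<le> \<bar>s\<bar> \<Longrightarrow> \<bar>s\<bar> \<le> 1 \<Longrightarrow> norm (resolvent (\<i> * of_real s) A) \<le> Q;
       \<bar>Re z\<bar> \<le> min r (c0 / Q); r \<le> \<bar>Im z\<bar>\<rbrakk> \<Longrightarrow>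
       z \<in> resolvent_set A \<inter> {z. - \<delta> < Re z} \<and>
       (\<forall>\<xi> y. contractive_functional \<xi> \<longrightarrow>
          cmod (continued_transform \<xi> y z) \<le> P0 * Q * norm y / \<bar>Im z\<bar>)"
proof -
  obtain K2 where K2: "K2 \<ge> 1" "\<And>s. 1 \<le> \<bar>s\<bar> \<Longrightarrow> \<bar>s\<bar> \<le> high_frequency \<Longrightarrow> norm (resolvent (\<i> * of_real s) A) \<le> K2"
    using axis_resolvent_bounded[of 1 high_frequency] by auto
  define c0 where "c0 = min (min (1 / 2) (strip_width / 2)) (min (\<delta> / 2) (1 / (2 * K2)))"
  define P0 where "P0 = 8 * C / c + (2 * K2 + 2 * M1 / \<delta>) * high_frequency"
  have c0: "c0 > 0" "c0 \<le> 1 / 2" "c0 \<le> strip_width / 2" "c0 \<le> \<delta> / 2" "c0 \<le> 1 / (2 * K2)"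
    using constants \<delta> K2(1) by (auto simp: c0_def)
  have P0: "8 * C / c \<le> P0" "(2 * K2 + 2 * M1 / \<delta>) * high_frequency \<le> P0" "0 \<le> P0"
    using C c M1 \<delta> K2(1) constants by (auto simp: P0_def)
  have "z \<in> resolvent_set A \<inter> {z. - \<delta> < Re z} \<and>
       (\<forall>\<xi> y. contractive_functional \<xi> \<longrightarrow> cmod (continued_transform \<xi> y z) \<le> P0 * Q * norm y / \<bar>Im z\<bar>)"
    if r: "0 < r" and Q: "Q \<ge> 1" and RQ: "\<And>s. r \<le> \<bar>s\<bar> \<Longrightarrow> \<bar>s\<bar> \<le> 1 \<Longrightarrow> norm (resolvent (\<i> * of_real s) A) \<le> Q"
      and z: "\<bar>Re z\<bar> \<le> min r (c0 / Q)" "r \<le> \<bar>Im z\<bar>" for r Q z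
  proof -
    have "c0 / Q \<le> c0 / 1" using Q c0 by (intro divide_left_mono) auto
    then have Rz: "\<bar>Re z\<bar> \<le> c0" using z by simp
    then have Rz\<delta>: "\<delta> / 2 \<le> Re z + \<delta>" using c0(4) by (auto simp: abs_le_iff)
    have Im0: "0 < \<bar>Im z\<bar>" using z r by linarith
    show ?thesis
    proof (cases "high_frequency < \<bar>Im z\<bar>")
      case True
      have "c / 4 * high_frequency \<le> c / 4 * \<bar>Im z\<bar>" using True c by (intro mult_left_mono) auto
      then have "2 * \<omega> + 1 \<le> c / 4 * \<bar>Im z\<bar>" using c by (simp add: high_frequency_def)
      moreover have "0 \<le> c / 4 * \<bar>Im z\<bar>" using c by simp
      ultimately have "2 * \<omega> + 1 \<le> c / 2 * \<bar>Im z\<bar>" by simp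
      then have res: "z \<in> resolvent_set A" using Rz c0(3) constants(2) by (intro strip_resolvent) auto
      have small: "\<bar>Re z\<bar> < min strip_width \<delta>" using Rz c0 constants(2) \<delta> by auto
      have "cmod (continued_transform \<xi> y z) \<le> P0 * Q * norm y / \<bar>Im z\<bar>" if \<xi>: "contractive_functional \<xi>" for \<xi> y
      proof -
        have "8 * C / c * 1 \<le> P0 * Q" using P0 Q by (intro mult_mono) auto
        then have "8 * C / c * norm y / \<bar>Im z\<bar> \<le> P0 * Q * norm y / \<bar>Im z\<bar>"
          by (intro divide_right_mono mult_right_mono) auto
        then show ?thesis using continued_transform_high[OF \<xi> small True, of y] by linarith
      qed
      then show ?thesis using res Rz\<delta> \<delta> by auto
    next
      case False
      let ?k = "\<i> * of_real (Im z)"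
      have k: "?k \<in> resolvent_set A" using Im0 by (intro axis) auto
      have nk: "norm (resolvent ?k A) \<le> K2 * Q"
      proof (cases "\<bar>Im z\<bar> \<le> 1")
        case True
        then have "norm (resolvent ?k A) \<le> 1 * Q" using RQ z by simp
        also have "\<dots> \<le> K2 * Q" using K2(1) Q by (intro mult_right_mono) auto
        finally show ?thesis .
      next
        case False
        then have "norm (resolvent ?k A) \<le> K2 * 1" using K2(2)[of "Im z"] \<open>\<not> high_frequency < \<bar>Im z\<bar>\<close> by simp
        also have "\<dots> \<le> K2 * Q" using K2(1) Q by (intro mult_left_mono) auto
        finally show ?thesis .
      qed
      have "z - ?k = of_real (Re z)" by (simp add: complex_eq_iff)
      then have "cmod (z - ?k) = \<bar>Re z\<bar>" by (simp only: norm_of_real)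
      also have "\<dots> \<le> c0 / Q" using z by simp
      also have "\<dots> \<le> 1 / (2 * K2) / Q" using c0(5) Q by (intro divide_right_mono) auto
      finally have "cmod (z - ?k) * norm (resolvent ?k A) \<le> 1 / (2 * K2) / Q * (K2 * Q)"
        using nk K2(1) Q by (intro mult_mono) auto
      also have "\<dots> = 1 / 2" using K2(1) Q by simp
      finally have small: "cmod (z - ?k) * norm (resolvent ?k A) \<le> 1 / 2" .
      have nz: "norm (resolvent z A) \<le> 2 * (K2 * Q)"
        using resolvent_perturbation(2)[OF k small] nk by linarith
      have "cmod (continued_transform \<xi> y z) \<le> P0 * Q * norm y / \<bar>Im z\<bar>" if \<xi>: "contractive_functional \<xi>" for \<xi> y
      proof -
        have "cmod (\<xi> (resolvent z A y)) \<le> norm (resolvent z A) * norm y"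
          by (rule order_trans[OF contractive_functionalD(3)[OF \<xi>] norm_blinfun])
        also have "\<dots> \<le> 2 * (K2 * Q) * norm y" by (intro mult_right_mono nz) auto
        finally have 1: "cmod (\<xi> (resolvent z A y)) \<le> 2 * (K2 * Q) * norm y" .
        have "cmod (laplace_on {0<..} (remainder \<xi> y) z) \<le> M1 * norm y / (Re z + \<delta>)"
          using remainder_transform_le[OF \<xi>, of z y] Rz\<delta> \<delta> by simp
        also have "\<dots> \<le> M1 * norm y / (\<delta> / 2)" using Rz\<delta> \<delta> M1 by (intro divide_left_mono mult_pos_pos) auto
        also have "\<dots> = (2 * M1 / \<delta>) * norm y * 1" by simp
        also have "\<dots> \<le> (2 * M1 / \<delta>) * norm y * Q" using Q M1 \<delta> by (intro mult_left_mono) auto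
        finally have 2: "cmod (laplace_on {0<..} (remainder \<xi> y) z) \<le> (2 * M1 / \<delta>) * norm y * Q" .
        have "cmod (continued_transform \<xi> y z) \<le> 2 * (K2 * Q) * norm y + (2 * M1 / \<delta>) * norm y * Q"
          unfolding continued_transform_def by (intro order_trans[OF norm_triangle_ineq4] add_mono 1 2)
        also have "\<dots> = (2 * K2 + 2 * M1 / \<delta>) * (Q * norm y)" by (simp add: algebra_simps)
        also have "\<dots> \<le> (2 * K2 + 2 * M1 / \<delta>) * (Q * norm y) * (high_frequency / \<bar>Im z\<bar>)"
        proof -
          have "1 \<le> high_frequency / \<bar>Im z\<bar>" using False Im0 by simp
          then have "(2 * K2 + 2 * M1 / \<delta>) * (Q * norm y) * 1 \<le> (2 * K2 + 2 * M1 / \<delta>) * (Q * norm y) * (high_frequency / \<bar>Im z\<bar>)"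
            using K2(1) M1 \<delta> Q by (intro mult_left_mono) auto
          then show ?thesis by simp
        qed
        also have "\<dots> = (2 * K2 + 2 * M1 / \<delta>) * high_frequency * (Q * norm y / \<bar>Im z\<bar>)" by simp
        also have "\<dots> \<le> P0 * (Q * norm y / \<bar>Im z\<bar>)" using P0(2) Q by (intro mult_right_mono) auto
        finally show ?thesis by simp
      qed
      then show ?thesis using resolvent_perturbation(1)[OF k small] Rz\<delta> \<delta> by auto
    qed
  qed
  then show thesis by (rule that[OF c0(1,2) P0(3)])
qed

text \<open>The analytic part differs from the derivative of the bounded orbit of \<open>x0\<close> by an exponentially
  small term, so its antiderivative is bounded as well. As the analytic part is bounded on the
  half-line, the antiderivative is Lipschitz and extends continuously to \<open>0\<close>.\<close>

lemma bounded_antiderivative: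
  assumes \<xi>: "contractive_functional \<xi>" and x0: "x0 \<in> dom A" "the (A x0) = y"
  obtains w where "\<And>t. 0 < t \<Longrightarrow> (w has_vector_derivative analytic_part \<xi> y (of_real t)) (at t)"
    "continuous_on {0..} w" "\<And>t. 0 \<le> t \<Longrightarrow> cmod (w t) \<le> 2 * M * norm x0 + M1 * norm y / \<delta>"
proof -
  obtain \<Phi> where \<Phi>: "\<And>z. z \<in> wedge c \<Longrightarrow> (\<Phi> has_field_derivative analytic_part \<xi> y z) (at z)"
    using holomorphic_convex_primitive'[OF wedge_convex wedge_open analytic_part_holomorphic[OF \<xi>]]
    by (metis at_within_open wedge_open)
  define p where "p t = \<Phi> (of_real t)" for t :: real
  have pd: "(p has_vector_derivative analytic_part \<xi> y (of_real t)) (at t)" if "t > 0" for t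
    unfolding p_def[abs_def] by (rule has_vector_derivative_real_field[OF \<Phi>[OF real_in_wedge[OF that]]])
  let ?L = "(M + M1) * norm y"
  have L: "?L \<ge> 0" using M_nonneg M1 by simp
  have lip: "?L-lipschitz_on {0<..} p"
  proof (rule lipschitz_onI[OF _ L])
    fix a b :: real assume ab: "a \<in> {0<..}" "b \<in> {0<..}"
    have "cmod (\<Phi> (of_real a) - \<Phi> (of_real b)) \<le> ?L * cmod (of_real a - of_real b)"
    proof (rule field_differentiable_bound[where S = "closed_segment (of_real a) (of_real b)"])
      fix z assume "z \<in> closed_segment (complex_of_real a) (of_real b)"
      then obtain \<tau> where \<tau>: "\<tau> > 0" "z = of_real \<tau>"
        using ab by (auto simp: closed_segment_of_real closed_segment_eq_real_ivl split: if_splits)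
      show "(\<Phi> has_field_derivative analytic_part \<xi> y z) (at z within closed_segment (of_real a) (of_real b))"
        unfolding \<tau>(2) by (rule has_field_derivative_at_within[OF \<Phi>[OF real_in_wedge[OF \<tau>(1)]]])
      show "cmod (analytic_part \<xi> y z) \<le> ?L"
        unfolding \<tau>(2) by (rule analytic_part_bounded[OF \<xi> \<tau>(1)])
    qed auto
    then show "dist (p a) (p b) \<le> ?L * dist a b"
      by (simp add: p_def dist_norm norm_of_real flip: of_real_diff)
  qed
  obtain g where g: "uniformly_continuous_on (closure {0<..}) g" "\<And>t. t \<in> {0<..} \<Longrightarrow> p t = g t"
    using uniformly_continuous_on_extension_on_closure[OF lipschitz_on_uniformly_continuous[OF lip]] by metis
  have gc: "continuous_on {0..} g" using uniformly_continuous_imp_continuous[OF g(1)] by simp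
  have gd: "(g has_vector_derivative analytic_part \<xi> y (of_real t)) (at t)" if "t > 0" for t
    by (rule has_vector_derivative_transform_within_open[OF pd[OF that], of "{0<..}"]) (use that g(2) in auto)
  define B where "B = 2 * M * norm x0 + M1 * norm y / \<delta>"
  have osc: "cmod (g b - g a) \<le> B" if ab: "0 < a" "a < b" for a b
  proof -
    let ?h = "\<lambda>t. g t - \<xi> (T t x0)"
    let ?\<phi> = "\<lambda>t. - (M1 * norm y / \<delta> * exp (- \<delta> * t))"
    have hd: "(?h has_vector_derivative - remainder \<xi> y t) (at t)" if "t > 0" for t
      using has_vector_derivative_diff[OF gd[OF that] functional_orbit(3)[OF \<xi> x0(1) that]]
      by (simp add: remainder_def x0(2))
    have "norm (?h b - ?h a) \<le> ?\<phi> b - ?\<phi> a"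
    proof (rule differentiable_bound_general[OF ab(2)])
      show "continuous_on {a..b} ?h"
        using ab by (intro continuous_at_imp_continuous_on ballI has_vector_derivative_continuous[OF hd]) auto
      show "continuous_on {a..b} ?\<phi>" by (intro continuous_intros)
      show "(?h has_vector_derivative - remainder \<xi> y t) (at t)" if "a < t" "t < b" for t
        using hd that ab by simp
      show "(?\<phi> has_vector_derivative (M1 * norm y) * exp (- \<delta> * t)) (at t)" if "a < t" "t < b" for t
        unfolding has_real_derivative_iff_has_vector_derivative[symmetric]
        using \<delta> by (auto intro!: derivative_eq_intros)
      show "norm (- remainder \<xi> y t) \<le> (M1 * norm y) * exp (- \<delta> * t)" if "a < t" "t < b" for t
        using remainder_le[OF \<xi>] that ab by simp
    qed
    also have "\<dots> \<le> M1 * norm y / \<delta>"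
    proof -
      have "M1 * norm y / \<delta> * exp (- \<delta> * a) \<le> M1 * norm y / \<delta> * 1"
        using ab \<delta> M1 by (intro mult_left_mono) auto
      moreover have "0 \<le> M1 * norm y / \<delta> * exp (- \<delta> * b)" using \<delta> M1 by simp
      ultimately show ?thesis by simp
    qed
    finally have h: "cmod (?h b - ?h a) \<le> M1 * norm y / \<delta>" .
    have "g b - g a = (?h b - ?h a) + \<xi> (T b x0) - \<xi> (T a x0)" by simp
    then have "cmod (g b - g a) \<le> cmod (?h b - ?h a) + cmod (\<xi> (T b x0)) + cmod (\<xi> (T a x0))"
      by (simp only:) (intro order_trans[OF norm_triangle_ineq4] add_mono norm_triangle_ineq order_refl)
    then show ?thesis
      unfolding B_def using h functional_orbit(2)[OF \<xi>, of a x0] functional_orbit(2)[OF \<xi>, of b x0] ab by simp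
  qed
  have B0: "B \<ge> 0" unfolding B_def using M_nonneg M1 \<delta> by simp
  define w where "w t = g t - g 1" for t
  have wc: "continuous_on (closure {0<..}) w" unfolding w_def using gc by (auto intro!: continuous_intros)
  have wB: "cmod (w t) \<le> B" if "t \<in> {0<..}" for t
  proof -
    consider "t < 1" | "t = 1" | "t > 1" by linarith
    then show ?thesis
      using osc[of t 1] osc[of 1 t] that B0 by cases (auto simp: w_def norm_minus_commute)
  qed
  show thesis
  proof (rule that)
    show "(w has_vector_derivative analytic_part \<xi> y (of_real t)) (at t)" if "0 < t" for t
      using has_vector_derivative_diff[OF gd[OF that] has_vector_derivative_const[of "g 1"]]
      by (simp add: w_def[abs_def])
    show "continuous_on {0..} w" using wc by simp
    show "cmod (w t) \<le> 2 * M * norm x0 + M1 * norm y / \<delta>" if "0 \<le> t" for t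
      unfolding B_def[symmetric] by (rule continuous_on_closure_norm_le[OF wc]) (use wB that in auto)
  qed
qed

text \<open>Cauchy's estimate on discs of radius \<open>c / 4\<close>, which stay inside the wedge for real centres from \<open>1\<close>
  on.\<close>

lemma analytic_part_lipschitz:
  assumes \<xi>: "contractive_functional \<xi>" and t: "t \<ge> 2" and \<tau>: "\<bar>\<tau> - t\<bar> < 1"
  shows "cmod (analytic_part \<xi> y (of_real \<tau>) - analytic_part \<xi> y (of_real t))
    \<le> 4 / c * C * norm y * exp (\<omega> * (t + 2)) * \<bar>\<tau> - t\<bar>"
proof -
  let ?s = "analytic_part \<xi> y"
  let ?L = "4 / c * C * norm y * exp (\<omega> * (t + 2))"
  have D: "cmod (deriv ?s (of_real u)) \<le> ?L" if u: "1 \<le> u" "u \<le> t + 1" for u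
  proof -
    have sub: "cball (of_real u) (c / 4) \<subseteq> wedge c"
    proof
      fix z assume "z \<in> cball (complex_of_real u) (c / 4)"
      then have z: "cmod (z - of_real u) \<le> c / 4" by (simp add: dist_norm norm_minus_commute)
      have "\<bar>Re z - u\<bar> \<le> c / 4" "\<bar>Im z\<bar> \<le> c / 4"
        using z abs_Re_le_cmod[of "z - of_real u"] abs_Im_le_cmod[of "z - of_real u"] by auto
      moreover have "c * (1 / 2) \<le> c * Re z"
        using calculation(1) u c by (intro mult_left_mono) linarith+
      moreover have "c / 4 < c * (1 / 2)" "0 < Re z" using calculation(1) c u by linarith+
      ultimately show "z \<in> wedge c" unfolding wedge_def mem_Collect_eq by (intro conjI; linarith)
    qed
    have "norm ((deriv ^^ 1) ?s (of_real u)) \<le> fact 1 * (C * norm y * exp (\<omega> * (t + 2))) / (c / 4) ^ 1"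
    proof (rule Cauchy_inequality)
      show "?s holomorphic_on ball (of_real u) (c / 4)"
        by (rule holomorphic_on_subset[OF analytic_part_holomorphic[OF \<xi>]]) (use sub ball_subset_cball in blast)
      show "continuous_on (cball (of_real u) (c / 4)) ?s"
        by (rule continuous_on_subset[OF holomorphic_on_imp_continuous_on[OF analytic_part_holomorphic[OF \<xi>]] sub])
      fix z assume z: "cmod (of_real u - z) = c / 4"
      then have zw: "z \<in> wedge c" using sub by (auto simp: dist_norm)
      have "cmod z \<le> t + 2"
        using norm_triangle_ineq4[of "of_real u" "of_real u - z"] z u c by simp
      then have "(C * norm y) * exp (\<omega> * cmod z) \<le> (C * norm y) * exp (\<omega> * (t + 2))"
        using C \<omega> by (intro mult_left_mono) (auto intro!: mult_left_mono)
      then show "cmod (?s z) \<le> C * norm y * exp (\<omega> * (t + 2))"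
        using analytic_part_le[OF \<xi> zw, of y] by linarith
    qed (use c in auto)
    then show ?thesis by (simp add: mult_ac)
  qed
  have "cmod (?s (of_real \<tau>) - ?s (of_real t)) \<le> ?L * cmod (of_real \<tau> - of_real t)"
  proof (rule field_differentiable_bound[where S = "closed_segment (of_real \<tau>) (of_real t)"])
    fix z assume "z \<in> closed_segment (complex_of_real \<tau>) (of_real t)"
    then obtain u where u: "1 \<le> u" "u \<le> t + 1" "z = of_real u"
      using t \<tau> by (auto simp: closed_segment_of_real closed_segment_eq_real_ivl split: if_splits)
    have "z \<in> wedge c" unfolding u(3) using u(1) by (intro real_in_wedge) simp
    then show "(?s has_field_derivative deriv ?s z) (at z within closed_segment (of_real \<tau>) (of_real t))"
      by (rule holomorphic_derivI[OF analytic_part_holomorphic[OF \<xi>] wedge_open])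
    show "cmod (deriv ?s z) \<le> ?L" unfolding u(3) by (rule D[OF u(1,2)])
  qed auto
  then show ?thesis by (simp add: norm_of_real flip: of_real_diff)
qed

section \<open>The uniform decay estimate\<close>

lemma resolvent_one: "1 \<in> resolvent_set A" "the (A (resolvent 1 A x)) = resolvent 1 A x - x"
proof -
  show 1: "1 \<in> resolvent_set A" by (rule half_plane) simp
  show "the (A (resolvent 1 A x)) = resolvent 1 A x - x"
    using resolvent_inverse(2)[OF 1, of x] by (simp add: diff_eq_eq add.commute eq_diff_eq)
qed

text \<open>As \<open>A R(1, A) = R(1, A) - I\<close>, this is \<open>T(t) A R(1, A)\<close> as a bounded operator.\<close>

abbreviation smoothed :: "real \<Rightarrow> 'a \<Rightarrow>\<^sub>L 'a" where
  "smoothed t \<equiv> T t o\<^sub>L (resolvent 1 A - id_blinfun)"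

text \<open>With \<open>N = e\<^sup>B\<^sup>t\<close> the logarithm in the contour bounds is linear in \<open>t\<close>.\<close>

lemma log_term_bound:
  fixes B r t :: real
  assumes "0 < r" "r \<le> 1" "B \<ge> 0" "t \<ge> 0"
  shows "ln (1 + (exp (B * t))\<^sup>2 / r\<^sup>2) \<le> 2 * (B * t + 1 / r)"
proof -
  have N: "1 \<le> exp (B * t) / r" using assms one_le_exp_iff[of "B * t"] by (simp add: order_trans[of r 1])
  have "1 + (exp (B * t))\<^sup>2 / r\<^sup>2 = 1 + (exp (B * t) / r)\<^sup>2" by (simp add: power_divide)
  also have "\<dots> \<le> (1 + exp (B * t) / r)\<^sup>2" using N by (simp add: power2_sum)
  finally have le: "1 + (exp (B * t))\<^sup>2 / r\<^sup>2 \<le> (1 + exp (B * t) / r)\<^sup>2" .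
  have "0 < 1 + (exp (B * t))\<^sup>2 / r\<^sup>2" by (rule add_pos_nonneg) auto
  moreover from this le have "0 < (1 + exp (B * t) / r)\<^sup>2" by linarith
  ultimately have "ln (1 + (exp (B * t))\<^sup>2 / r\<^sup>2) \<le> ln ((1 + exp (B * t) / r)\<^sup>2)"
    using le by (simp only: ln_le_cancel_iff)
  also have "\<dots> = 2 * ln (1 + exp (B * t) / r)" using N by (simp add: ln_realpow)
  finally have sq: "ln (1 + (exp (B * t))\<^sup>2 / r\<^sup>2) \<le> 2 * ln (1 + exp (B * t) / r)" .
  have q: "0 < 1 / r" using assms by simp
  then have q': "1 + 1 / r \<noteq> 0" by linarith
  have "1 \<le> exp (B * t)" using assms by simp
  then have "1 + exp (B * t) / r \<le> exp (B * t) * (1 + 1 / r)" by (simp add: distrib_left)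
  moreover have "0 < 1 + exp (B * t) / r" using N by linarith
  ultimately have "ln (1 + exp (B * t) / r) \<le> ln (exp (B * t) * (1 + 1 / r))"
    by (simp only: ln_le_cancel_iff order_less_le_trans)
  also have "\<dots> = ln (exp (B * t)) + ln (1 + 1 / r)" using q q' by (simp add: ln_mult)
  also have "\<dots> \<le> B * t + 1 / r" using q ln_add_one_self_le_self[of "1 / r"] by simp
  finally have le: "ln (1 + exp (B * t) / r) \<le> B * t + 1 / r" .
  show ?thesis by (rule order_trans[OF sq mult_left_mono[OF le]]) simp
qed

text \<open>All constants are uniform in \<open>r\<close>, \<open>Q\<close> and \<open>t\<close>, which leaves the choice of \<open>r\<close> as a function of
  \<open>t\<close> to the applications. Taking the averaging scale \<open>N\<close> exponential in
  \<open>t\<close> compensates the exponential growth of the derivative of the analytic part and costs only a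
  factor \<open>t\<close> in the logarithm.\<close>

lemma smoothed_bound:
  obtains c0 a :: real where "0 < c0" "0 < a"
    "\<And>n. n \<ge> 1 \<Longrightarrow> \<exists>K \<ge> 0. \<forall>r Q t. 0 < r \<longrightarrow> r \<le> 1 \<longrightarrow> Q \<ge> 1 \<longrightarrow>
      (\<forall>s. r \<le> \<bar>s\<bar> \<longrightarrow> \<bar>s\<bar> \<le> 1 \<longrightarrow> norm (resolvent (\<i> * of_real s) A) \<le> Q) \<longrightarrow> t \<ge> 2 \<longrightarrow>
      norm (smoothed t) \<le> K * (r + Q * (1 / (r * t)) ^ n
        + exp (- (min r (c0 / Q) * t)) * Q * (t + 1 / r) + exp (- (a * t)))"
proof -
  obtain c0 P0 where c0: "c0 > 0" "c0 \<le> 1 / 2" and P0: "P0 \<ge> 0" and par: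
    "\<And>r Q z. \<lbrakk>0 < r; Q \<ge> 1; \<And>s. r \<le> \<bar>s\<bar> \<Longrightarrow> \<bar>s\<bar> \<le> 1 \<Longrightarrow> norm (resolvent (\<i> * of_real s) A) \<le> Q;
       \<bar>Re z\<bar> \<le> min r (c0 / Q); r \<le> \<bar>Im z\<bar>\<rbrakk> \<Longrightarrow>
       z \<in> resolvent_set A \<inter> {z. - \<delta> < Re z} \<and>
       (\<forall>\<xi> y. contractive_functional \<xi> \<longrightarrow> cmod (continued_transform \<xi> y z) \<le> P0 * Q * norm y / \<bar>Im z\<bar>)"
    using transform_parameters by metis
  define E where "E = resolvent 1 A - id_blinfun"
  define Y where "Y = norm E + norm (resolvent 1 A)"
  define M0 where "M0 = (M + M1) * Y + (2 * M * Y + M1 * Y / \<delta>)"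
  \<comment> \<open>The scale \<open>1 / N = e\<^sup>-\<^sup>B\<^sup>t\<close> beats the Lipschitz constant, of order \<open>e\<^sup>\<omega>\<^sup>t\<close>, by the factor \<open>e\<^sup>-\<^sup>t\<close>.\<close>
  define B where "B = \<omega> + 1"
  define a where "a = min 1 \<delta>"
  define \<Lambda>0 where "\<Lambda>0 = 4 / c * C * Y * exp (2 * \<omega>)"
  have Y: "Y \<ge> 0" "norm E \<le> Y" "norm (resolvent 1 A) \<le> Y" by (auto simp: Y_def)
  have nn: "M0 \<ge> 0" "\<Lambda>0 \<ge> 0" "B \<ge> 1" and a: "0 < a" "a \<le> 1" "a \<le> \<delta>"
    using M_nonneg M1 Y(1) \<delta> C c \<omega> by (auto simp: M0_def \<Lambda>0_def B_def a_def)
  have main: "norm (smoothed t x) \<le> (72 * M0 * 2 ^ n * r + 2 * (P0 * Q * Y) * (fact n * (3 / (r * t)) ^ n)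
      + exp (- (min r (c0 / Q) * t)) * (P0 * Q * Y) * 2 ^ n * (2 * (B * t + 1 / r))
      + (4 * (\<Lambda>0 + 2 * M0) + M1 * Y) * exp (- (a * t))) * norm x"
    if n: "n \<ge> 1" and r: "0 < r" "r \<le> 1" and Q: "Q \<ge> 1" and t: "t \<ge> 2"
      and RQ: "\<And>s. r \<le> \<bar>s\<bar> \<Longrightarrow> \<bar>s\<bar> \<le> 1 \<Longrightarrow> norm (resolvent (\<i> * of_real s) A) \<le> Q"
    for n r Q t x
  proof -
    define \<eta> where "\<eta> = min r (c0 / Q)"
    define N where "N = exp (B * t)"
    define y where "y = E x"
    have \<eta>: "0 < \<eta>" "\<eta> \<le> r" using r c0 Q by (auto simp: \<eta>_def)
    have yx: "norm y \<le> Y * norm x" and Rx: "norm (resolvent 1 A x) \<le> Y * norm x"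
      unfolding y_def using Y(2,3)
      by (auto intro!: order_trans[OF norm_blinfun] mult_right_mono)
    have "B * t \<ge> 1 * 2" using nn(3) t by (intro mult_mono) auto
    then have N: "N \<ge> 2" using exp_ge_add_one_self[of "B * t"] unfolding N_def by linarith
    let ?bd = "72 * (M0 * norm x) * 2 ^ n * r + 2 * (P0 * Q * (Y * norm x)) * (fact n * (3 / (r * t)) ^ n)
        + exp (- (\<eta> * t)) * (P0 * Q * (Y * norm x)) * 2 ^ n * ln (1 + N\<^sup>2 / r\<^sup>2)
        + 4 * (4 / c * C * norm y * exp (\<omega> * (t + 2)) + 2 * (M0 * norm x)) / N"
    have "cmod (\<xi> (T t y)) \<le> ?bd + M1 * norm y * exp (- \<delta> * t)" if \<xi>: "contractive_functional \<xi>" for \<xi>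
    proof -
      let ?f = "\<lambda>\<tau>. analytic_part \<xi> y (of_real \<tau>)"
      have dom: "resolvent 1 A x \<in> dom A" "the (A (resolvent 1 A x)) = y"
        using resolvent_inverse(1)[OF resolvent_one(1)] resolvent_one(2)
        by (auto simp: y_def E_def blinfun.diff_left)
      obtain w where w: "\<And>t. 0 < t \<Longrightarrow> (w has_vector_derivative ?f t) (at t)"
        "continuous_on {0..} w" "\<And>t. 0 \<le> t \<Longrightarrow> cmod (w t) \<le> 2 * M * norm (resolvent 1 A x) + M1 * norm y / \<delta>"
        using bounded_antiderivative[OF \<xi> dom] by metis
      have M0_1: "(M + M1) * norm y \<le> M0 * norm x"
      proof -
        have "(M + M1) * norm y \<le> (M + M1) * (Y * norm x)" using yx M_nonneg M1 by (intro mult_left_mono) auto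
        also have "\<dots> \<le> M0 * norm x"
          unfolding M0_def mult.assoc[symmetric] using M_nonneg M1 Y(1) \<delta> by (intro mult_right_mono) auto
        finally show ?thesis .
      qed
      have M0_2: "2 * M * norm (resolvent 1 A x) + M1 * norm y / \<delta> \<le> M0 * norm x"
      proof -
        have "2 * M * norm (resolvent 1 A x) + M1 * norm y / \<delta> \<le> 2 * M * (Y * norm x) + M1 * (Y * norm x) / \<delta>"
          using yx Rx M_nonneg M1 \<delta> by (intro add_mono mult_left_mono divide_right_mono) auto
        also have "\<dots> = (2 * M * Y + M1 * Y / \<delta>) * norm x" by (simp add: algebra_simps)
        also have "\<dots> \<le> M0 * norm x"
          unfolding M0_def using M_nonneg M1 Y(1) by (intro mult_right_mono) auto
        finally show ?thesis .
      qed
      have "cmod (?f t) \<le> ?bd"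
      proof (rule tauberian_bound[OF r N n \<eta>])
        show "0 \<le> P0 * Q * (Y * norm x)" using P0 Q Y(1) by simp
        show "1 \<le> t" using t by simp
        show "continuous_on {0<..} ?f"
          using analytic_part_real_isCont[OF \<xi>] by (auto intro!: continuous_at_imp_continuous_on)
        show "cmod (?f \<tau>) \<le> M0 * norm x" if "0 < \<tau>" for \<tau>
          using analytic_part_bounded[OF \<xi> that, of y] M0_1 by linarith
        show "(w has_vector_derivative ?f \<tau>) (at \<tau>)" if "0 < \<tau>" for \<tau> by (rule w(1)[OF that])
        show "continuous_on {0..} w" by (rule w(2))
        show "cmod (w \<tau>) \<le> M0 * norm x" if "0 \<le> \<tau>" for \<tau> using w(3)[OF that] M0_2 by linarith
        show "open (resolvent_set A \<inter> {z. - \<delta> < Re z})"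
          by (intro open_Int resolvent_set_open open_halfspace_Re_gt)
        show "continued_transform \<xi> y holomorphic_on resolvent_set A \<inter> {z. - \<delta> < Re z}"
          by (rule continued_transform_holomorphic[OF \<xi>])
        show "{z. 0 < Re z \<or> \<bar>Re z\<bar> \<le> \<eta> \<and> r \<le> \<bar>Im z\<bar>} \<subseteq> resolvent_set A \<inter> {z. - \<delta> < Re z}"
        proof
          fix z assume "z \<in> {z. 0 < Re z \<or> \<bar>Re z\<bar> \<le> \<eta> \<and> r \<le> \<bar>Im z\<bar>}"
          then consider "0 < Re z" | "\<bar>Re z\<bar> \<le> \<eta>" "r \<le> \<bar>Im z\<bar>" by auto
          then show "z \<in> resolvent_set A \<inter> {z. - \<delta> < Re z}"
          proof cases
            case 1
            then show ?thesis using half_plane \<delta> by auto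
          next
            case 2
            then show ?thesis using par[OF r(1) Q RQ, of z] by (simp add: \<eta>_def)
          qed
        qed
        show "continued_transform \<xi> y z = laplace_on {0<..} ?f z" if "0 < Re z" for z
          by (rule continued_transform_eq[OF \<xi> that])
        show "cmod (continued_transform \<xi> y z) \<le> P0 * Q * (Y * norm x) / \<bar>Im z\<bar>"
          if z: "\<bar>Re z\<bar> \<le> \<eta>" "r \<le> \<bar>Im z\<bar>" for z
        proof -
          have "cmod (continued_transform \<xi> y z) \<le> P0 * Q * norm y / \<bar>Im z\<bar>"
            using par[OF r(1) Q RQ, of z] z \<xi> by (simp add: \<eta>_def)
          also have "\<dots> \<le> P0 * Q * (Y * norm x) / \<bar>Im z\<bar>"
            using yx P0 Q by (intro divide_right_mono mult_left_mono) auto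
          finally show ?thesis .
        qed
        show "0 \<le> 4 / c * C * norm y * exp (\<omega> * (t + 2))" using c C by simp
        show "cmod (?f \<tau> - ?f t) \<le> 4 / c * C * norm y * exp (\<omega> * (t + 2)) * \<bar>\<tau> - t\<bar>"
          if "0 < \<tau>" "\<bar>\<tau> - t\<bar> < 1" for \<tau>
          by (rule analytic_part_lipschitz[OF \<xi> t that(2)])
      qed
      moreover have "cmod (remainder \<xi> y t) \<le> M1 * norm y * exp (- \<delta> * t)"
        using remainder_le[OF \<xi>] t by simp
      moreover have eq: "\<xi> (T t y) = ?f t + remainder \<xi> y t" by (simp add: remainder_def)
      ultimately show ?thesis unfolding eq by (intro order_trans[OF norm_triangle_ineq] add_mono)
    qed
    then have 1: "norm (T t y) \<le> ?bd + M1 * norm y * exp (- \<delta> * t)" by (rule norm_le_of_functionals)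
    have ln_le: "ln (1 + N\<^sup>2 / r\<^sup>2) \<le> 2 * (B * t + 1 / r)"
      unfolding N_def using r nn(3) t by (intro log_term_bound) auto
    have 2: "exp (- (\<eta> * t)) * (P0 * Q * (Y * norm x)) * 2 ^ n * ln (1 + N\<^sup>2 / r\<^sup>2)
        \<le> exp (- (\<eta> * t)) * (P0 * Q * (Y * norm x)) * 2 ^ n * (2 * (B * t + 1 / r))"
      using P0 Q Y(1) by (intro mult_left_mono ln_le) auto
    have eN: "exp (\<omega> * (t + 2)) / N = exp (2 * \<omega>) * exp (- t)" "1 / N \<le> exp (- t)"
    proof -
      show "exp (\<omega> * (t + 2)) / N = exp (2 * \<omega>) * exp (- t)"
        unfolding N_def B_def by (simp add: exp_add[symmetric] exp_diff[symmetric] algebra_simps)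
      have "1 * t \<le> B * t" using nn(3) t by (intro mult_right_mono) auto
      then have "exp (- (B * t)) \<le> exp (- t)" by simp
      then show "1 / N \<le> exp (- t)" unfolding N_def by (simp add: exp_minus divide_inverse)
    qed
    have et: "exp (- t) \<le> exp (- (a * t))" "exp (- \<delta> * t) \<le> exp (- (a * t))"
      using a t mult_right_mono[of a 1 t] mult_right_mono[of a \<delta> t] by auto
    have 3: "4 * (4 / c * C * norm y * exp (\<omega> * (t + 2)) + 2 * (M0 * norm x)) / N
        \<le> 4 * (\<Lambda>0 + 2 * M0) * exp (- (a * t)) * norm x"
    proof -
      have "4 * (4 / c * C * norm y * exp (\<omega> * (t + 2)) + 2 * (M0 * norm x)) / N
          = 4 * (4 / c * C * (exp (\<omega> * (t + 2)) / N)) * norm y + 8 * (M0 * norm x) * (1 / N)"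
        by (simp add: algebra_simps add_divide_distrib)
      also have "\<dots> \<le> 4 * (4 / c * C * (exp (2 * \<omega>) * exp (- t))) * (Y * norm x) + 8 * (M0 * norm x) * exp (- t)"
        unfolding eN(1) using yx eN(2) c C nn by (intro add_mono mult_left_mono) auto
      also have "\<dots> = 4 * (\<Lambda>0 + 2 * M0) * norm x * exp (- t)"
        by (simp add: \<Lambda>0_def algebra_simps)
      also have "\<dots> \<le> 4 * (\<Lambda>0 + 2 * M0) * norm x * exp (- (a * t))"
        using nn by (intro mult_left_mono et(1)) auto
      finally show ?thesis by (simp add: mult_ac)
    qed
    have 4: "M1 * norm y * exp (- \<delta> * t) \<le> M1 * Y * exp (- (a * t)) * norm x"
    proof -
      have "M1 * norm y * exp (- \<delta> * t) \<le> M1 * (Y * norm x) * exp (- (a * t))"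
        using M1 yx et(2) Y(1) by (intro mult_mono) auto
      then show ?thesis by (simp add: mult_ac)
    qed
    have "norm (T t y) \<le> 72 * (M0 * norm x) * 2 ^ n * r + 2 * (P0 * Q * (Y * norm x)) * (fact n * (3 / (r * t)) ^ n)
        + exp (- (\<eta> * t)) * (P0 * Q * (Y * norm x)) * 2 ^ n * (2 * (B * t + 1 / r))
        + 4 * (\<Lambda>0 + 2 * M0) * exp (- (a * t)) * norm x + M1 * Y * exp (- (a * t)) * norm x"
      using 1 2 3 4 by linarith
    also have "\<dots> = (72 * M0 * 2 ^ n * r + 2 * (P0 * Q * Y) * (fact n * (3 / (r * t)) ^ n)
      + exp (- (\<eta> * t)) * (P0 * Q * Y) * 2 ^ n * (2 * (B * t + 1 / r))
      + (4 * (\<Lambda>0 + 2 * M0) + M1 * Y) * exp (- (a * t))) * norm x"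
      by (simp only: ring_distribs mult_ac)
    finally show ?thesis unfolding \<eta>_def y_def E_def by (simp only: blinfun_apply_blinfun_compose)
  qed
  show thesis
  proof (rule that[OF c0(1) a(1)])
    fix n :: nat assume n: "n \<ge> 1"
    define K where "K = 72 * M0 * 2 ^ n + 2 * (P0 * Y) * (fact n * 3 ^ n) + (P0 * Y) * 2 ^ n * (2 * B) + (4 * (\<Lambda>0 + 2 * M0) + M1 * Y)"
    have parts: "0 \<le> 72 * M0 * 2 ^ n" "0 \<le> 2 * (P0 * Y) * (fact n * 3 ^ n)" "0 \<le> (P0 * Y) * 2 ^ n * (2 * B)"
      "0 \<le> 4 * (\<Lambda>0 + 2 * M0) + M1 * Y"
      using nn P0 Y(1) M1 by auto
    have K: "K \<ge> 0" "72 * M0 * 2 ^ n \<le> K" "2 * (P0 * Y) * (fact n * 3 ^ n) \<le> K" "(P0 * Y) * 2 ^ n * (2 * B) \<le> K"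
      "4 * (\<Lambda>0 + 2 * M0) + M1 * Y \<le> K"
      unfolding K_def using parts by linarith+
    show "\<exists>K\<ge>0. \<forall>r Q t. 0 < r \<longrightarrow> r \<le> 1 \<longrightarrow> Q \<ge> 1 \<longrightarrow>
      (\<forall>s. r \<le> \<bar>s\<bar> \<longrightarrow> \<bar>s\<bar> \<le> 1 \<longrightarrow> norm (resolvent (\<i> * of_real s) A) \<le> Q) \<longrightarrow> t \<ge> 2 \<longrightarrow>
      norm (smoothed t) \<le> K * (r + Q * (1 / (r * t)) ^ n
        + exp (- (min r (c0 / Q) * t)) * Q * (t + 1 / r) + exp (- (a * t)))"
    proof (intro exI[of _ K] conjI K(1) allI impI)
      fix r Q t :: real
      assume r: "0 < r" "r \<le> 1" and Q: "1 \<le> Q" and t: "2 \<le> t"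
        and RQ: "\<forall>s. r \<le> \<bar>s\<bar> \<longrightarrow> \<bar>s\<bar> \<le> 1 \<longrightarrow> norm (resolvent (\<i> * of_real s) A) \<le> Q"
      define X where "X = exp (- (min r (c0 / Q) * t))"
      have pow: "(3 / (r * t)) ^ n = 3 ^ n * (1 / (r * t)) ^ n" by (simp add: power_mult_distrib[symmetric])
      have 1: "72 * M0 * 2 ^ n * r \<le> K * r" using K(2) r by (intro mult_right_mono) auto
      have "2 * (P0 * Q * Y) * (fact n * (3 / (r * t)) ^ n) = (2 * (P0 * Y) * (fact n * 3 ^ n)) * (Q * (1 / (r * t)) ^ n)"
        unfolding pow by (simp only: mult_ac)
      also have "\<dots> \<le> K * (Q * (1 / (r * t)) ^ n)" using K(3) r t Q by (intro mult_right_mono) auto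
      finally have 2: "2 * (P0 * Q * Y) * (fact n * (3 / (r * t)) ^ n) \<le> K * (Q * (1 / (r * t)) ^ n)" .
      have "1 * (1 / r) \<le> B * (1 / r)" using nn(3) r by (intro mult_right_mono) auto
      then have "B * t + 1 / r \<le> B * (t + 1 / r)" by (simp add: distrib_left)
      then have "X * (P0 * Q * Y) * 2 ^ n * (2 * (B * t + 1 / r)) \<le> X * (P0 * Q * Y) * 2 ^ n * (2 * (B * (t + 1 / r)))"
        using P0 Q Y(1) by (intro mult_left_mono) (auto simp: X_def)
      also have "\<dots> = ((P0 * Y) * 2 ^ n * (2 * B)) * (X * Q * (t + 1 / r))" by (simp only: mult_ac)
      also have "\<dots> \<le> K * (X * Q * (t + 1 / r))" using K(4) r t Q by (intro mult_right_mono) (auto simp: X_def)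
      finally have 3: "X * (P0 * Q * Y) * 2 ^ n * (2 * (B * t + 1 / r)) \<le> K * (X * Q * (t + 1 / r))" .
      have 4: "(4 * (\<Lambda>0 + 2 * M0) + M1 * Y) * exp (- (a * t)) \<le> K * exp (- (a * t))"
        using K(5) by (intro mult_right_mono) auto
      have le: "72 * M0 * 2 ^ n * r + 2 * (P0 * Q * Y) * (fact n * (3 / (r * t)) ^ n)
          + X * (P0 * Q * Y) * 2 ^ n * (2 * (B * t + 1 / r)) + (4 * (\<Lambda>0 + 2 * M0) + M1 * Y) * exp (- (a * t))
          \<le> K * (r + Q * (1 / (r * t)) ^ n + X * Q * (t + 1 / r) + exp (- (a * t)))"
        using add_mono[OF add_mono[OF add_mono[OF 1 2] 3] 4] by (simp only: distrib_left)
      show "norm (smoothed t) \<le> K * (r + Q * (1 / (r * t)) ^ n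
        + exp (- (min r (c0 / Q) * t)) * Q * (t + 1 / r) + exp (- (a * t)))"
        unfolding X_def[symmetric]
      proof (rule norm_blinfun_bound)
        show "0 \<le> K * (r + Q * (1 / (r * t)) ^ n + X * Q * (t + 1 / r) + exp (- (a * t)))"
          using K(1) r Q t by (intro mult_nonneg_nonneg add_nonneg_nonneg) (auto simp: X_def)
        fix x
        show "norm (smoothed t x) \<le> K * (r + Q * (1 / (r * t)) ^ n + X * Q * (t + 1 / r) + exp (- (a * t))) * norm x"
          using main[OF n r Q t, of x] RQ
            mult_right_mono[OF le norm_ge_zero[of x]] unfolding X_def by force
      qed
    qed
  qed
qed

end

section \<open>Decay of the semigroup\<close>

lemma wedge_subset_sector:
  assumes "\<theta> > 0"
  obtains c where "0 < c" "c \<le> 1" "wedge c \<subseteq> sector \<theta>"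
proof -
  define \<phi> where "\<phi> = min \<theta> 1"
  have \<phi>: "0 < \<phi>" "\<phi> < pi / 2" "\<phi> \<le> \<theta>" using assms pi_gt3 by (auto simp: \<phi>_def)
  define c where "c = min 1 (tan \<phi>)"
  have "tan \<phi> > 0" using \<phi> by (intro tan_gt_zero) auto
  moreover have "wedge c \<subseteq> sector \<theta>"
  proof
    fix z assume "z \<in> wedge c"
    then have z: "0 < Re z" "\<bar>Im z\<bar> < c * Re z" by (auto simp: wedge_def)
    then have "\<bar>Im z / Re z\<bar> < c" by (simp add: abs_divide divide_less_eq)
    moreover have "c \<le> tan \<phi>" by (simp add: c_def)
    ultimately have x: "Im z / Re z < tan \<phi>" "- (Im z / Re z) < tan \<phi>" by linarith+
    have at: "arctan (tan \<phi>) = \<phi>" using \<phi> by (intro arctan_tan) auto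
    have "arctan (Im z / Re z) < \<phi>" "arctan (- (Im z / Re z)) < \<phi>"
      using arctan_less_iff[THEN iffD2, OF x(1)] arctan_less_iff[THEN iffD2, OF x(2)] at by simp_all
    then have "\<bar>arctan (Im z / Re z)\<bar> < \<theta>" using \<phi>(3) unfolding arctan_minus by linarith
    moreover have "z \<noteq> 0" using z by auto
    ultimately show "z \<in> sector \<theta>" using z(1) by (simp add: sector_def arg_conv_arctan)
  qed
  ultimately show thesis using that[of c] by (auto simp: c_def)
qed

text \<open>A negative infimum is witnessed by one approximant \<open>S\<close> with one negative exponent. Restricting \<open>S\<close>
  to a wedge inside its sector, and making its exponent nonnegative, loses nothing.\<close>

lemma asymptotically_analytic_approximant:
  fixes T :: "real \<Rightarrow> 'a::complex_normed_vector \<Rightarrow>\<^sub>L 'a"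
  assumes "asymptotically_analytic T"
  obtains c C \<omega> \<delta> M1 S where "0 < c" "c \<le> 1" "C \<ge> 0" "\<omega> \<ge> 0" "\<delta> > 0" "M1 \<ge> 0"
    "\<And>z. z \<in> wedge c \<Longrightarrow> \<exists>D. (S has_derivative (\<lambda>h. h *\<^sub>C D)) (at z within wedge c)"
    "\<And>z. z \<in> wedge c \<Longrightarrow> norm (S z) \<le> C * exp (\<omega> * cmod z)"
    "\<And>t. t > 0 \<Longrightarrow> norm (T t - S (of_real t)) \<le> M1 * exp (- (\<delta> * t))"
proof -
  obtain S \<theta> where \<theta>: "\<theta> > 0" and S: "S \<in> H_space (sector \<theta>)"
    and gb: "growth_bound (\<lambda>t. T t - S (of_real t)) < 0"
    using assms by (auto simp: asymptotically_analytic_def nonanalytic_growth_bound_def Inf_less_iff)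
  obtain w M1 where w: "w < 0" "M1 \<ge> 1" "\<And>t. t > 0 \<Longrightarrow> norm (T t - S (of_real t)) \<le> M1 * exp (w * t)"
    using gb by (auto simp: growth_bound_def Inf_less_iff)
  obtain c where c: "0 < c" "c \<le> 1" "wedge c \<subseteq> sector \<theta>" using wedge_subset_sector[OF \<theta>] by blast
  obtain C w' where C: "C \<ge> 0" "\<And>z. z \<in> sector \<theta> \<Longrightarrow> norm (S z) \<le> C * exp (w' * cmod z)"
    using S by (auto simp: H_space_def exponentially_bounded_on_def)
  show thesis
  proof (rule that[of c C "max w' 0" "- w" M1 S])
    show "\<exists>D. (S has_derivative (\<lambda>h. h *\<^sub>C D)) (at z within wedge c)" if "z \<in> wedge c" for z
    proof -
      have "\<exists>D. (S has_derivative (\<lambda>h. h *\<^sub>C D)) (at z within sector \<theta>)"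
        using S that c(3) unfolding H_space_def vector_holomorphic_on_def by blast
      then show ?thesis using has_derivative_subset[OF _ c(3)] by blast
    qed
    show "norm (S z) \<le> C * exp (max w' 0 * cmod z)" if "z \<in> wedge c" for z
    proof -
      have "norm (S z) \<le> C * exp (w' * cmod z)" using C(2) that c(3) by blast
      also have "\<dots> \<le> C * exp (max w' 0 * cmod z)"
        using C(1) by (intro mult_left_mono) (auto intro!: mult_right_mono)
      finally show ?thesis .
    qed
  qed (use c w C(1) in auto)
qed

context asymptotically_analytic_semigroup
begin

text \<open>For fixed \<open>r\<close> the constant \<open>Q\<close> exists by compactness, and all terms of the bound but the first
  vanish in the limit, whatever \<open>r\<close> is. The exponent \<open>n = 1\<close> suffices.\<close>

lemma smoothed_tendsto_zero: "((\<lambda>t. norm (smoothed t)) \<longlongrightarrow> 0) at_top"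
proof -
  obtain c0 a where c0: "0 < c0" and a: "0 < a" and all:
    "\<And>n. n \<ge> 1 \<Longrightarrow> \<exists>K \<ge> 0. \<forall>r Q t. 0 < r \<longrightarrow> r \<le> 1 \<longrightarrow> Q \<ge> 1 \<longrightarrow>
      (\<forall>s. r \<le> \<bar>s\<bar> \<longrightarrow> \<bar>s\<bar> \<le> 1 \<longrightarrow> norm (resolvent (\<i> * of_real s) A) \<le> Q) \<longrightarrow> t \<ge> 2 \<longrightarrow>
      norm (smoothed t) \<le> K * (r + Q * (1 / (r * t)) ^ n
        + exp (- (min r (c0 / Q) * t)) * Q * (t + 1 / r) + exp (- (a * t)))"
    using smoothed_bound by metis
  obtain K where K: "K \<ge> 0" and bd: "\<And>r Q t. 0 < r \<Longrightarrow> r \<le> 1 \<Longrightarrow> Q \<ge> 1 \<Longrightarrow>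
      (\<forall>s. r \<le> \<bar>s\<bar> \<longrightarrow> \<bar>s\<bar> \<le> 1 \<longrightarrow> norm (resolvent (\<i> * of_real s) A) \<le> Q) \<Longrightarrow> t \<ge> 2 \<Longrightarrow>
      norm (smoothed t) \<le> K * (r + Q * (1 / (r * t)) ^ 1
        + exp (- (min r (c0 / Q) * t)) * Q * (t + 1 / r) + exp (- (a * t)))"
    using all[of 1] by auto
  have expd: "((\<lambda>t. exp (- (b * t))) \<longlongrightarrow> 0) at_top" "((\<lambda>t. exp (- (b * t)) * t) \<longlongrightarrow> 0) at_top"
    if b: "b > 0" for b :: real
  proof -
    have lim: "filterlim (\<lambda>t. b * t) at_top at_top"
      using b by (intro filterlim_tendsto_pos_mult_at_top[OF tendsto_const]) (auto intro: filterlim_ident)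
    then show "((\<lambda>t. exp (- (b * t))) \<longlongrightarrow> 0) at_top"
      by (intro filterlim_compose[OF exp_at_bot]) (simp add: filterlim_uminus_at_bot)
    have "((\<lambda>t. (b * t) ^ 1 / exp (b * t) / b) \<longlongrightarrow> 0 / b) at_top"
      by (intro tendsto_divide tendsto_const filterlim_compose[OF tendsto_power_div_exp_0 lim]) (use b in simp)
    then show "((\<lambda>t. exp (- (b * t)) * t) \<longlongrightarrow> 0) at_top"
      using b by (simp add: exp_minus field_simps)
  qed
  have small: "\<forall>\<^sub>F t in at_top. norm (smoothed t) < e" if e: "e > 0" for e
  proof -
    define r where "r = min 1 (e / (2 * (K + 1)))"
    have r: "0 < r" "r \<le> 1" using e K by (auto simp: r_def)
    have "K * r \<le> K * (e / (2 * (K + 1)))" using K by (intro mult_left_mono) (auto simp: r_def)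
    also have "\<dots> < e" using e K by (simp add: divide_simps mult.commute)
    finally have Kr: "K * r < e" .
    obtain Q where Q: "Q \<ge> 1" "\<And>s. r \<le> \<bar>s\<bar> \<Longrightarrow> \<bar>s\<bar> \<le> 1 \<Longrightarrow> norm (resolvent (\<i> * of_real s) A) \<le> Q"
      using axis_resolvent_bounded[OF r(1), of 1] by blast
    define \<eta> where "\<eta> = min r (c0 / Q)"
    have \<eta>: "\<eta> > 0" using r c0 Q(1) by (simp add: \<eta>_def)
    have inv: "((\<lambda>t. Q * (1 / r * inverse t)) \<longlongrightarrow> Q * (1 / r * 0)) at_top"
      by (intro tendsto_intros tendsto_inverse_0_at_top filterlim_ident)
    have "((\<lambda>t. K * (r + Q * (1 / r * inverse t) + Q * (exp (- (\<eta> * t)) * t + exp (- (\<eta> * t)) * (1 / r)) + exp (- (a * t))))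
        \<longlongrightarrow> K * (r + Q * (1 / r * 0) + Q * (0 + 0 * (1 / r)) + 0)) at_top"
      by (intro tendsto_intros inv expd \<eta> a)
    then have "\<forall>\<^sub>F t in at_top. K * (r + Q * (1 / r * inverse t) + Q * (exp (- (\<eta> * t)) * t + exp (- (\<eta> * t)) * (1 / r)) + exp (- (a * t))) < e"
      by (rule order_tendstoD(2)) (use Kr in simp)
    with eventually_ge_at_top[of 2] show ?thesis
    proof eventually_elim
      case (elim t)
      have "norm (smoothed t) \<le> K * (r + Q * (1 / (r * t)) ^ 1 + exp (- (\<eta> * t)) * Q * (t + 1 / r) + exp (- (a * t)))"
        unfolding \<eta>_def by (rule bd) (use r Q elim in auto)
      also have "\<dots> = K * (r + Q * (1 / r * inverse t) + Q * (exp (- (\<eta> * t)) * t + exp (- (\<eta> * t)) * (1 / r)) + exp (- (a * t)))"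
        by (simp add: divide_inverse algebra_simps)
      finally show ?case using elim by linarith
    qed
  qed
  show ?thesis
    by (rule tendstoI) (use small in simp)
qed

lemma dominatingD:
  assumes "dominating_function A m"
  shows "0 < \<bar>s\<bar> \<Longrightarrow> \<bar>s\<bar> \<le> 1 \<Longrightarrow> norm (resolvent (\<i> * of_real s) A) \<le> m \<bar>s\<bar>"
    and "0 < x \<Longrightarrow> x \<le> z \<Longrightarrow> z \<le> 1 \<Longrightarrow> m z \<le> m x"
    and "continuous_on {0<..1} m"
proof -
  have m: "antimono_on {0<..1} m" "continuous_on {0<..1} m"
    "\<And>s. 0 < \<bar>s\<bar> \<and> \<bar>s\<bar> \<le> 1 \<Longrightarrow> norm (resolvent (\<i> * of_real s) A) \<le> m \<bar>s\<bar>"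
    using assms unfolding dominating_function_def by blast+
  show "0 < \<bar>s\<bar> \<Longrightarrow> \<bar>s\<bar> \<le> 1 \<Longrightarrow> norm (resolvent (\<i> * of_real s) A) \<le> m \<bar>s\<bar>"
    using m(3) by blast
  show "0 < x \<Longrightarrow> x \<le> z \<Longrightarrow> z \<le> 1 \<Longrightarrow> m z \<le> m x"
    using m(1) by (auto simp: monotone_on_def)
  show "continuous_on {0<..1} m" by (rule m(2))
qed

text \<open>Otherwise the Neumann series at \<open>\<i>s\<close> would reach the spectral point \<open>0\<close>.\<close>

lemma dominating_lower_bound:
  assumes zero: "0 \<notin> resolvent_set A" and m: "dominating_function A m" and s: "0 < s" "s \<le> 1"
  shows "1 / (2 * s) \<le> m s"
proof (rule ccontr)
  assume "\<not> 1 / (2 * s) \<le> m s"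
  then have "m s < 1 / (2 * s)" by simp
  moreover have "norm (resolvent (\<i> * of_real s) A) \<le> m s"
    using dominatingD(1)[OF m, of s] s by simp
  ultimately have "norm (resolvent (\<i> * of_real s) A) \<le> 1 / (2 * s)" by linarith
  then have "s * norm (resolvent (\<i> * of_real s) A) \<le> s * (1 / (2 * s))" using s by (intro mult_left_mono) auto
  then have "cmod (0 - \<i> * of_real s) * norm (resolvent (\<i> * of_real s) A) \<le> 1 / 2"
    using s by (simp add: norm_mult)
  then show False using resolvent_perturbation(1)[OF axis, of s 0] zero s by simp
qed

text \<open>The lower bound makes \<open>m\<close> at least \<open>v\<close> at the point \<open>1 / (2 v)\<close>, and continuity supplies the
  intermediate value. Hence the right inverse is under control at all large arguments.\<close>

lemma dominating_range:
  assumes zero: "0 \<notin> resolvent_set A" and m: "dominating_function A m" and v: "v \<ge> 1" "v \<ge> m 1"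
  shows "v \<in> m ` {0<..1}"
proof -
  define s where "s = 1 / (2 * v)"
  have s: "0 < s" "s \<le> 1" "1 / (2 * s) = v" using v by (auto simp: s_def)
  have "v \<le> m s" using dominating_lower_bound[OF zero m s(1,2)] s(3) by simp
  moreover have "continuous_on {s..1} m"
    by (rule continuous_on_subset[OF dominatingD(3)[OF m]]) (use s(1) in auto)
  ultimately obtain x where "s \<le> x" "x \<le> 1" "m x = v"
    using IVT2'[of m 1 v s] v(2) s(2) by blast
  then show ?thesis using s(1) by (intro image_eqI[of _ _ x]) auto
qed

text \<open>In the uniform bound take \<open>Q = t\<^sup>1\<^sup>-\<^sup>\<epsilon>\<close> and \<open>r = m\<^sup>-\<^sup>1(Q)\<close>, so that monotonicity of \<open>m\<close> gives the
  bound \<open>Q\<close> for the resolvent beyond \<open>r\<close>. All other terms are compared with \<open>r\<close> through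
  \<open>1 / Q \<le> 2 r\<close>.\<close>

lemma smoothed_rate:
  assumes zero: "0 \<notin> resolvent_set A" and m: "dominating_function A m" and minv: "right_inverse m minv"
    and \<epsilon>: "0 < \<epsilon>" "\<epsilon> < 1"
  shows "(\<lambda>t. norm (smoothed t)) \<in> O[at_top](\<lambda>t. minv (t powr (1 - \<epsilon>)))"
proof -
  obtain c0 a where c0: "0 < c0" and a: "0 < a" and all:
    "\<And>n. n \<ge> 1 \<Longrightarrow> \<exists>K \<ge> 0. \<forall>r Q t. 0 < r \<longrightarrow> r \<le> 1 \<longrightarrow> Q \<ge> 1 \<longrightarrow>
      (\<forall>s. r \<le> \<bar>s\<bar> \<longrightarrow> \<bar>s\<bar> \<le> 1 \<longrightarrow> norm (resolvent (\<i> * of_real s) A) \<le> Q) \<longrightarrow> t \<ge> 2 \<longrightarrow>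
      norm (smoothed t) \<le> K * (r + Q * (1 / (r * t)) ^ n
        + exp (- (min r (c0 / Q) * t)) * Q * (t + 1 / r) + exp (- (a * t)))"
    using smoothed_bound by metis
  \<comment> \<open>\<open>(r t)\<^sup>-\<^sup>n\<close> is at most a multiple of \<open>t\<^sup>-\<^sup>n\<^sup>\<epsilon>\<close>, and the factor \<open>Q \<le> t\<close> in front has to become \<open>1 / Q\<close>.\<close>
  define n where "n = nat \<lceil>2 / \<epsilon>\<rceil>"
  have n: "2 \<le> real n * \<epsilon>" "n \<ge> 1"
  proof -
    have "2 / \<epsilon> \<le> real n" unfolding n_def by (rule of_nat_ceiling)
    then show 1: "2 \<le> real n * \<epsilon>" using \<epsilon> by (simp add: pos_divide_le_eq)
    then show "n \<ge> 1" by (cases n) auto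
  qed
  obtain K where K: "K \<ge> 0" and bd: "\<And>r Q t. 0 < r \<Longrightarrow> r \<le> 1 \<Longrightarrow> Q \<ge> 1 \<Longrightarrow>
      (\<forall>s. r \<le> \<bar>s\<bar> \<longrightarrow> \<bar>s\<bar> \<le> 1 \<longrightarrow> norm (resolvent (\<i> * of_real s) A) \<le> Q) \<Longrightarrow> t \<ge> 2 \<Longrightarrow>
      norm (smoothed t) \<le> K * (r + Q * (1 / (r * t)) ^ n
        + exp (- (min r (c0 / Q) * t)) * Q * (t + 1 / r) + exp (- (a * t)))"
    using all[OF n(2)] by auto
  \<comment> \<open>As \<open>1 / (2 Q) \<le> r\<close>, the minimum of \<open>r\<close> and \<open>c0 / Q\<close> is at least \<open>c1 / Q\<close>.\<close>
  define c1 where "c1 = min (1 / 2) c0"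
  have c1: "c1 > 0" "c1 \<le> 1 / 2" "c1 \<le> c0" using c0 by (auto simp: c1_def)
  \<comment> \<open>Replaces \<open>exp (- c1 t\<^sup>\<epsilon>)\<close> by a multiple of \<open>t\<^sup>-\<^sup>4\<close>.\<close>
  define k where "k = 2 * n"
  have "real k * \<epsilon> = 2 * (real n * \<epsilon>)" by (simp add: k_def)
  then have k: "4 \<le> real k * \<epsilon>" using n(1) by linarith
  define K' where "K' = K * (1 + 2 ^ n * 2 + 6 * fact k / c1 ^ k + 2 / a)"
  define Z where "Z = max 1 (m 1)"
  have "Z \<le> t powr (1 - \<epsilon>)" if "Z powr (1 / (1 - \<epsilon>)) \<le> t" for t
  proof -
    have "Z = (Z powr (1 / (1 - \<epsilon>))) powr (1 - \<epsilon>)"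
      using \<epsilon> by (simp add: powr_powr Z_def)
    also have "\<dots> \<le> t powr (1 - \<epsilon>)" using that \<epsilon> by (intro powr_mono2) auto
    finally show ?thesis .
  qed
  then have ev: "\<forall>\<^sub>F t in at_top. Z \<le> t powr (1 - \<epsilon>)"
    using eventually_ge_at_top by (rule eventually_mono[rotated])
  have "\<forall>\<^sub>F t in at_top. norm (norm (smoothed t)) \<le> K' * norm (minv (t powr (1 - \<epsilon>)))"
    using ev eventually_ge_at_top[of 2]
  proof eventually_elim
    case (elim t)
    define Q where "Q = t powr (1 - \<epsilon>)"
    define r where "r = minv Q"
    have t: "t \<ge> 2" using elim by simp
    have Q: "Q \<ge> 1" "Q \<ge> m 1" using elim by (auto simp: Q_def Z_def)
    have "Q \<in> m ` {0<..1}" by (rule dominating_range[OF zero m Q])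
    then have r: "0 < r" "r \<le> 1" "m r = Q" using minv by (auto simp: right_inverse_def r_def)
    have Qt: "Q \<le> t" unfolding Q_def using t \<epsilon> powr_mono[of "1 - \<epsilon>" 1 t] by simp
    have rQ: "1 / r \<le> 2 * Q" using dominating_lower_bound[OF zero m r(1,2)] r by (simp add: divide_simps mult_ac)
    then have Qr: "1 / Q \<le> 2 * r" using r Q by (simp add: divide_simps mult_ac)
    have RQ: "norm (resolvent (\<i> * of_real s) A) \<le> Q" if "r \<le> \<bar>s\<bar>" "\<bar>s\<bar> \<le> 1" for s
    proof -
      have "norm (resolvent (\<i> * of_real s) A) \<le> m \<bar>s\<bar>"
        using that r by (intro dominatingD(1)[OF m]) auto
      also have "\<dots> \<le> m r" using that r by (intro dominatingD(2)[OF m]) auto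
      finally show ?thesis using r by simp
    qed
    define X where "X = exp (- (min r (c0 / Q) * t))"
    have T2: "Q * (1 / (r * t)) ^ n \<le> (2 ^ n * 2) * r"
    proof -
      have "1 / (r * t) = 1 / r * (1 / t)" by simp
      also have "\<dots> \<le> 2 * Q * (1 / t)" using rQ t by (intro mult_right_mono) auto
      finally have "(1 / (r * t)) ^ n \<le> (2 * Q * (1 / t)) ^ n" using r t by (intro power_mono) auto
      also have "\<dots> = 2 ^ n * (Q / t) ^ n" by (simp add: power_mult_distrib[symmetric])
      also have "Q / t = t powr (- \<epsilon>)" using t by (simp add: Q_def powr_diff powr_minus divide_inverse)
      also have "(t powr (- \<epsilon>)) ^ n = t powr (- \<epsilon> * real n)" using t by (simp add: powr_realpow[symmetric] powr_powr)
      also have "\<dots> \<le> t powr (- 2)" using n t by (intro powr_mono) (auto simp: mult.commute)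
      finally have "Q * (1 / (r * t)) ^ n \<le> Q * (2 ^ n * t powr (- 2))" using Q by (intro mult_left_mono) auto
      also have "\<dots> = 2 ^ n * (Q * t powr (- 2))" by simp
      also have "Q * t powr (- 2) \<le> 1 / Q"
      proof -
        have QQ: "Q * Q \<le> t * t" using Qt Q by (intro mult_mono) auto
        have tp: "t powr (- 2) = 1 / (t * t)" using t by (simp add: powr_minus powr_numeral power2_eq_square divide_inverse)
        show ?thesis unfolding tp using QQ Q t by (simp add: divide_simps)
      qed
      also have "\<dots> \<le> 2 * r" by (rule Qr)
      finally show ?thesis by simp
    qed
    have T3: "X * Q * (t + 1 / r) \<le> (6 * fact k / c1 ^ k) * r"
    proof -
      define x where "x = c1 * t powr \<epsilon>"
      have x: "x > 0" using c1 t by (simp add: x_def)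
      have "c1 / Q \<le> min r (c0 / Q)"
      proof -
        have "c1 / Q \<le> (1 / 2) / Q" using c1 Q by (intro divide_right_mono) auto
        also have "\<dots> \<le> r" using Qr by simp
        finally have "c1 / Q \<le> r" .
        moreover have "c1 / Q \<le> c0 / Q" using c1 Q by (intro divide_right_mono) auto
        ultimately show ?thesis by simp
      qed
      then have "c1 / Q * t \<le> min r (c0 / Q) * t" using t by (intro mult_right_mono) auto
      moreover have "c1 / Q * t = x"
        using t by (simp add: x_def Q_def powr_diff field_simps)
      ultimately have "X \<le> exp (- x)" by (simp add: X_def)
      also have "\<dots> \<le> fact k / x ^ k"
        using power_le_fact_exp[of x k] x by (simp add: exp_minus field_simps)
      also have "x ^ k = c1 ^ k * t powr (real k * \<epsilon>)"
        using t by (simp add: x_def power_mult_distrib powr_realpow[symmetric] powr_powr mult.commute)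
      also have "fact k / (c1 ^ k * t powr (real k * \<epsilon>)) \<le> fact k / (c1 ^ k * t ^ 4)"
      proof -
        have "t powr 4 \<le> t powr (real k * \<epsilon>)" using k t by (intro powr_mono) auto
        then have "t ^ 4 \<le> t powr (real k * \<epsilon>)" using t by (simp add: powr_numeral)
        then show ?thesis using c1 t by (intro divide_left_mono mult_left_mono mult_pos_pos) auto
      qed
      finally have X: "X \<le> fact k / (c1 ^ k * t ^ 4)" .
      have "t + 1 / r \<le> 3 * t" using rQ Qt by linarith
      then have "X * Q * (t + 1 / r) \<le> fact k / (c1 ^ k * t ^ 4) * t * (3 * t)"
        using X Qt Q r t c1 by (intro mult_mono) (auto simp: X_def)
      also have "\<dots> = 3 * fact k / c1 ^ k * (1 / (t * t))" using t c1 by (simp add: power4_eq_xxxx)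
      also have "\<dots> \<le> 3 * fact k / c1 ^ k * (1 / Q)"
      proof -
        have "1 * Q \<le> t * t" using Qt Q t by (intro mult_mono) auto
        then have "1 / (t * t) \<le> 1 / Q" using Q t by (intro divide_left_mono mult_pos_pos) auto
        then show ?thesis using c1 by (intro mult_left_mono) auto
      qed
      also have "\<dots> \<le> 3 * fact k / c1 ^ k * (2 * r)" using c1 Qr by (intro mult_left_mono) auto
      finally show ?thesis by simp
    qed
    have T4: "exp (- (a * t)) \<le> 2 / a * r"
    proof -
      have "a * t \<le> exp (a * t)" using exp_ge_add_one_self[of "a * t"] by linarith
      then have "exp (- (a * t)) \<le> 1 / (a * t)" using a t by (simp add: exp_minus field_simps)
      also have "\<dots> \<le> 1 / (a * Q)" using a t Q Qt by (intro divide_left_mono mult_left_mono mult_pos_pos) auto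
      also have "\<dots> = 1 / a * (1 / Q)" by simp
      also have "\<dots> \<le> 1 / a * (2 * r)" using a Qr by (intro mult_left_mono) auto
      finally show ?thesis by simp
    qed
    have "norm (smoothed t) \<le> K * (r + Q * (1 / (r * t)) ^ n + X * Q * (t + 1 / r) + exp (- (a * t)))"
      unfolding X_def by (rule bd) (use r Q t RQ in auto)
    also have "\<dots> \<le> K * (r + (2 ^ n * 2) * r + (6 * fact k / c1 ^ k) * r + 2 / a * r)"
      using K by (intro mult_left_mono add_mono T2 T3 T4 order_refl)
    also have "\<dots> = K' * r" by (simp add: K'_def algebra_simps)
    finally show ?case using r by (simp add: r_def Q_def)
  qed
  then show ?thesis by (rule bigoI)
qed

end

theorem theorem3p7:
  fixes T :: "real \<Rightarrow> 'a::complex_banach \<Rightarrow>\<^sub>L 'a"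
    and A :: "'a \<rightharpoonup> 'a"
  assumes "C0_semigroup T"
    and "bounded_semigroup T"
    and "asymptotically_analytic T"
    and "A = generator T"
    and "((*) \<i> ` spectrum A) \<inter> \<real> = {0}"
  shows "((\<lambda>t. onorm (\<lambda>x. blinfun_apply (T t) (the (A (blinfun_apply (resolvent 1 A) x)))))
            \<longlongrightarrow> 0) at_top \<and>
    (\<forall>m minv \<epsilon>. dominating_function A m \<longrightarrow> right_inverse m minv \<longrightarrow> 0 < \<epsilon> \<longrightarrow> \<epsilon> < 1 \<longrightarrow>
       (\<lambda>t. onorm (\<lambda>x. blinfun_apply (T t) (the (A (blinfun_apply (resolvent 1 A) x)))))
         \<in> O[at_top](\<lambda>t. minv (t powr (1 - \<epsilon>))))"
proof -
  obtain M where M: "\<And>t. t \<ge> 0 \<Longrightarrow> norm (T t) \<le> M"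
    using assms(2) unfolding bounded_semigroup_def bounded_iff by fastforce
  obtain c C \<omega> \<delta> M1 S where S: "0 < c" "c \<le> 1" "C \<ge> 0" "\<omega> \<ge> 0" "\<delta> > 0" "M1 \<ge> 0"
    "\<And>z. z \<in> wedge c \<Longrightarrow> \<exists>D. (S has_derivative (\<lambda>h. h *\<^sub>C D)) (at z within wedge c)"
    "\<And>z. z \<in> wedge c \<Longrightarrow> norm (S z) \<le> C * exp (\<omega> * cmod z)"
    "\<And>t. t > 0 \<Longrightarrow> norm (T t - S (of_real t)) \<le> M1 * exp (- (\<delta> * t))"
    by (rule asymptotically_analytic_approximant[OF assms(3)]) (rule that, assumption+)
  have axis: "\<i> * of_real s \<in> resolvent_set (generator T)" if "s \<noteq> 0" for s
  proof (rule ccontr)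
    assume "\<i> * of_real s \<notin> resolvent_set (generator T)"
    then have "\<i> * (\<i> * of_real s) \<in> (*) \<i> ` spectrum A"
      using assms(4) by (intro imageI) (simp add: spectrum_def)
    moreover have "\<i> * (\<i> * of_real s) = of_real (- s)" by (simp add: mult.assoc[symmetric])
    ultimately have "of_real (- s) \<in> ((*) \<i> ` spectrum A) \<inter> \<real>" by (metis IntI Reals_of_real)
    then have "complex_of_real (- s) = 0" unfolding assms(5) by blast
    then show False using that by simp
  qed
  have zero: "0 \<notin> resolvent_set (generator T)"
  proof -
    have "0 \<in> (*) \<i> ` spectrum A" using assms(5) by blast
    then have "0 \<in> spectrum A" by auto
    then show ?thesis using assms(4) by (simp add: spectrum_def)
  qed
  interpret asymptotically_analytic_semigroup T M S c C \<omega> \<delta> M1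
  proof
    show "C0_semigroup T" by (rule assms(1))
    show "norm (T t) \<le> M" if "t \<ge> 0" for t by (rule M[OF that])
    show "0 < c" "c \<le> 1" "C \<ge> 0" "\<omega> \<ge> 0" "\<delta> > 0" "M1 \<ge> 0" by (rule S)+
    show "\<exists>D. (S has_derivative (\<lambda>h. h *\<^sub>C D)) (at z within wedge c)" if "z \<in> wedge c" for z
      by (rule S(7)[OF that])
    show "norm (S z) \<le> C * exp (\<omega> * cmod z)" if "z \<in> wedge c" for z by (rule S(8)[OF that])
    show "norm (T t - S (of_real t)) \<le> M1 * exp (- (\<delta> * t))" if "t > 0" for t by (rule S(9)[OF that])
    show "\<i> * of_real s \<in> resolvent_set (generator T)" if "s \<noteq> 0" for s by (rule axis[OF that])
  qed
  have eq: "onorm (\<lambda>x. T t (the (A (resolvent 1 A x)))) = norm (smoothed t)" for t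
  proof -
    have "(\<lambda>x. T t (the (A (resolvent 1 A x)))) = blinfun_apply (smoothed t)"
      unfolding assms(4) resolvent_one(2) by (simp add: fun_eq_iff blinfun.diff_left)
    then show ?thesis by (simp only: norm_blinfun.rep_eq)
  qed
  show ?thesis
    unfolding eq
  proof (intro conjI allI impI)
    show "((\<lambda>t. norm (smoothed t)) \<longlongrightarrow> 0) at_top" by (rule smoothed_tendsto_zero)
    fix m minv \<epsilon> assume "dominating_function A m" "right_inverse m minv" "0 < \<epsilon>" "\<epsilon> < (1::real)"
    then show "(\<lambda>t. norm (smoothed t)) \<in> O[at_top](\<lambda>t. minv (t powr (1 - \<epsilon>)))"
      unfolding assms(4) by (rule smoothed_rate[OF zero])
  qed
qed

end
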